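(* Suppose that $s=\{s_n;n\in\mathbb{N}_0^d\}$ is a positive semi-definite $d$-sequence such that each of the first $d-1$ marginal $1$-sequences $$\{s_{(n,0,\dots,0)};n\in\mathbb{N}_0\},\ \{s_{(0,n,0,\dots,0)};n\in\mathbb{N}_0\},\ \dots,\ \{s_{(0,\dots,0,n,0)};n\in\mathbb{N}_0\}$$ satisfies the Carleman condition. Then $s$ is a moment sequence. If in addition the last marginal $1$-sequence $\{s_{(0,\dots,0,n)};n\in\mathbb{N}_0\}$ satisfies the Carleman condition, then the moment sequence $s$ is also determinate.
   Context: A $d$-sequence $s=\{s_\alpha;\alpha\in\mathbb{N}_0^d\}$ is positive semi-definite if $\sum_{\alpha,\beta}s_{\alpha+\beta}\xi_\alpha\overline{\xi_\beta}\ge0$ for every finitely supported complex sequence $\{\xi_\alpha;\alpha\in\mathbb{N}_0^d\}$. A positive semi-definite $1$-sequence $\{s_n;n\in\mathbb{N}_0\}$ satisfies the Carleman condition if $\sum_{n=1}^\infty s_{2n}^{-1/(2n)}=+\infty$ (with $0^{-1/(2n)}=+\infty$). $\mathcal{M}(\mathbb{R}^d)$ is the set of positive Borel measures on $\mathbb{R}^d$ having all moments finite. A $d$-sequence $s$ is a moment sequence if there is $\mu\in\mathcal{M}(\mathbb{R}^d)$ with $s_\alpha=\int x^\alpha\,d\mu(x)$ for all $\alpha\in\mathbb{N}_0^d$; it is determinate if there is exactly one such $\mu\in\mathcal{M}(\mathbb{R}^d)$. *)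

theory Defs
  imports "HOL-Analysis.Analysis"
begin

text \<open>
  A \<open>d\<close>-sequence is a function \<open>nat ^ 'n \<Rightarrow> complex\<close> with \<open>d = CARD('n)\<close>. The values are a priori
  complex; positive semi-definiteness forces them to be real. The index type is linearly ordered, so
  that the last coordinate is \<open>Max UNIV\<close>.
\<close>

text \<open>Used with index monoid \<open>nat ^ 'n\<close> (componentwise addition) for \<open>d\<close>-sequences.\<close>

definition positive_semidefinite :: "('a::comm_monoid_add \<Rightarrow> complex) \<Rightarrow> bool" where
  "positive_semidefinite s \<longleftrightarrow>
    (\<forall>\<xi> :: 'a \<Rightarrow> complex. finite {\<alpha>. \<xi> \<alpha> \<noteq> 0} \<longrightarrow>
      (\<Sum>\<alpha> | \<xi> \<alpha> \<noteq> 0. \<Sum>\<beta> | \<xi> \<beta> \<noteq> 0. s (\<alpha> + \<beta>) * \<xi> \<alpha> * cnj (\<xi> \<beta>)) \<in> \<real>\<^sub>\<ge>\<^sub>0)"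

text \<open>
  Meant for positive semi-definite sequences, whose entries of even index are real and nonnegative,
  so that \<^const>\<open>Re\<close> discards nothing. The sum over \<open>n \<ge> 1\<close> is shifted to start at \<open>0\<close>, and a
  vanishing entry contributes \<open>\<infinity>\<close>.
\<close>

definition carleman :: "(nat \<Rightarrow> complex) \<Rightarrow> bool" where
  "carleman s \<longleftrightarrow>
    (\<Sum>n. if s (2 * Suc n) = 0 then \<infinity>
          else ennreal (Re (s (2 * Suc n)) powr (- 1 / real (2 * Suc n)))) = (\<infinity> :: ennreal)"

definition marginal :: "(nat ^ 'n \<Rightarrow> complex) \<Rightarrow> 'n::finite \<Rightarrow> nat \<Rightarrow> complex" where
  "marginal s i n = s (axis i n)"

definition monomial :: "nat ^ 'n \<Rightarrow> real ^ 'n::finite \<Rightarrow> real" where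
  "monomial \<alpha> x = (\<Prod>i\<in>UNIV. (x $ i) ^ (\<alpha> $ i))"

definition finite_moment_measures :: "(real ^ 'n::finite) measure set" where
  "finite_moment_measures =
    {\<mu>. sets \<mu> = sets borel \<and> (\<forall>\<alpha>. integrable \<mu> (monomial \<alpha>))}"

definition represents :: "(real ^ 'n::finite) measure \<Rightarrow> (nat ^ 'n \<Rightarrow> complex) \<Rightarrow> bool" where
  "represents \<mu> s \<longleftrightarrow> (\<forall>\<alpha>. s \<alpha> = complex_of_real (\<integral>x. monomial \<alpha> x \<partial>\<mu>))"

definition moment_sequence :: "(nat ^ 'n::finite \<Rightarrow> complex) \<Rightarrow> bool" where
  "moment_sequence s \<longleftrightarrow> (\<exists>\<mu>\<in>finite_moment_measures. represents \<mu> s)"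

definition determinate :: "(nat ^ 'n::finite \<Rightarrow> complex) \<Rightarrow> bool" where
  "determinate s \<longleftrightarrow> (\<exists>!\<mu>. \<mu> \<in> finite_moment_measures \<and> represents \<mu> s)"

end

theory Submission
  imports Defs "HOL-Probability.Probability"
    "HOL-Computational_Algebra.Fundamental_Theorem_Algebra" "HOL-Library.Poly_Mapping"
begin

text \<open>
  Uniqueness proceeds one coordinate at a time. For two measures with the same moments and a weight \<open>w\<close>
  built from indicators in the coordinates already treated and a polynomial, the difference of the
  Fourier transforms of \<open>w\<close> in the direction \<open>x\<^sub>i\<close> is flat at \<open>0\<close>, and its \<open>n\<close>-th derivative is bounded
  by a multiple of \<open>s (2 n e\<^sub>i) powr (1/2)\<close>. By the Denjoy--Carleman theorem (proved with Bang's argument)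
  it vanishes, so an indicator in \<open>x\<^sub>i\<close> can be added to the weight.

  Existence is by induction on the set \<open>I\<close> of Carleman coordinates, the step adding a coordinate \<open>i\<close>
  without any growth condition. For every polynomial \<open>p \<ge> 0\<close> in \<open>x\<^sub>i\<close> the functional weighted by \<open>p(x\<^sub>i)\<close> has
  a unique representing measure in the coordinates \<open>I\<close>; uniqueness makes this measure additive in \<open>p\<close>.
  Hence on each cell of a finite partition of the coordinates \<open>I\<close> one gets a one-dimensional
  functional that is nonnegative on nonnegative polynomials, and can be approximated by finitely many atoms. The
  resulting discrete measures have moments converging to \<open>s\<close>, and Helly's theorem gives a limit.
\<close>

section \<open>The Denjoy--Carleman theorem\<close>

text \<open>In several variables nonnegative polynomials need not be sums of squares, so
  \<open>psd\<close> alone yields no measure. In one variable they are sums of two squares; this is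
  why only a single coordinate \<open>i\<close> is weighted and why the weight \<open>p\<close>
  preserves \<open>psd\<close>. The weight must also respect the growth condition: Cauchy-Schwarz
  bounds the square of the weighted moment of order \<open>2 * n\<close> by a constant times the
  moment of order \<open>4 * n\<close>, and monotonicity of the normalised Carleman terms shows that
  every second term already suffices for divergence. Cells replace a disintegration: no conditional
  laws in \<open>x\<^sub>i\<close> are formed, only finitely many functionals that assign to
  \<open>p\<close> the mass of a cell, and the rounding error disappears in the limit. In the
  uniqueness part a weight has to be a density, hence nonnegative, whereas a monomial has no sign;
  it enters as the difference of two nonnegative weights.\<close>

lemma power_div_fact_le_exp:
  fixes x :: real
  assumes "0 \<le> x"
  shows "x ^ n / fact n \<le> exp x"
proof -
  have "(\<Sum>k\<in>{n}. x ^ k /\<^sub>R fact k) \<le> (suminf (\<lambda>k. x ^ k /\<^sub>R fact k))"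
    using assms by (intro sum_le_suminf summable_exp_generic) auto
  then show ?thesis
    by (simp add: exp_def divide_inverse mult.commute)
qed

text \<open>After exchanging the sums, \<open>a k\<close> carries the factor \<open>k + 1\<close>
  times the tail of the series of inverse squares, which is at most \<open>2 / (k + 1)\<close>. The
  extra summand with denominator \<open>real N + 1\<close> stands for the part of that tail beyond
  \<open>N\<close>; with it the induction telescopes.\<close>

lemma carleman_inequality_partial:
  fixes a :: "nat \<Rightarrow> real"
  assumes "\<And>k. 0 \<le> a k"
  shows "(\<Sum>n<N. (\<Sum>k\<le>n. (real k + 1) * a k) / (real n + 1)\<^sup>2) + 2 * (\<Sum>k<N. (real k + 1) * a k) / (real N + 1)
    \<le> 2 * (\<Sum>k<N. a k)"
proof (induction N)
  case (Suc N)
  define S where "S = (\<Sum>k<N. (real k + 1) * a k)"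
  define T where "T = S + (real N + 1) * a N"
  have T0: "0 \<le> T"
    unfolding T_def S_def using assms by (intro add_nonneg_nonneg sum_nonneg mult_nonneg_nonneg) auto
  have "1 / (real N + 1)\<^sup>2 + 2 / (real N + 2) \<le> 2 / (real N + 1)"
    by (simp add: divide_simps power2_eq_square) (simp add: algebra_simps)
  then have "T * (1 / (real N + 1)\<^sup>2 + 2 / (real N + 2)) \<le> T * (2 / (real N + 1))"
    using T0 by (rule mult_left_mono)
  then have "T / (real N + 1)\<^sup>2 + 2 * T / (real N + 2) \<le> 2 * T / (real N + 1)"
    by (simp add: algebra_simps)
  also have "2 * T / (real N + 1) = 2 * S / (real N + 1) + 2 * a N"
    unfolding T_def by (simp add: field_simps)
  finally have key: "T / (real N + 1)\<^sup>2 + 2 * T / (real N + 2) \<le> 2 * S / (real N + 1) + 2 * a N" .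
  have T: "(\<Sum>k<Suc N. (real k + 1) * a k) = T"
    unfolding T_def S_def by simp
  define X where "X = (\<Sum>n<N. (\<Sum>k\<le>n. (real k + 1) * a k) / (real n + 1)\<^sup>2)"
  have IH: "X + 2 * S / (real N + 1) \<le> 2 * (\<Sum>k<N. a k)"
    using Suc unfolding X_def S_def .
  have E: "(\<Sum>n<Suc N. (\<Sum>k\<le>n. (real k + 1) * a k) / (real n + 1)\<^sup>2) = X + T / (real N + 1)\<^sup>2"
    using T unfolding X_def lessThan_Suc_atMost by (simp add: lessThan_Suc_atMost[symmetric])
  have R: "real (Suc N) + 1 = real N + 2" by simp
  show ?case
    unfolding E T R sum.lessThan_Suc[of a] using add_mono[OF key IH] by (simp only: distrib_left add.assoc add.left_commute add.commute add_le_cancel_left)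
qed simp

text \<open>The weights \<open>k + 1\<close> are chosen so that AM-GM loses only the factor
  \<open>((n + 1)!) powr (- 1 / (n + 1)) \<le> e / (n + 1)\<close>.\<close>
theorem carleman_inequality:
  fixes a :: "nat \<Rightarrow> real"
  assumes pos: "\<And>k. 0 < a k" and summable: "summable a"
  shows "summable (\<lambda>n. (\<Prod>k\<le>n. a k) powr (1 / (real n + 1)))"
proof (rule summableI_nonneg_bounded)
  fix N
  define S where "S n = (\<Sum>k\<le>n. (real k + 1) * a k)" for n
  have *: "(\<Prod>k\<le>n. a k) powr (1 / (real n + 1)) \<le> exp 1 * (S n / (real n + 1)\<^sup>2)" for n
  proof -
    define m where "m = real n + 1"
    have m: "m > 0" "real (Suc n) = m" by (simp_all add: m_def)
    have prod: "(\<Prod>k\<le>n. (real k + 1) * a k) = fact (Suc n) * (\<Prod>k\<le>n. a k)"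
      unfolding prod.distrib by (induction n) (simp_all add: algebra_simps)
    have "(m / exp 1) ^ Suc n \<le> fact (Suc n)"
    proof -
      have "m ^ Suc n / fact (Suc n) \<le> exp m"
        using m by (intro power_div_fact_le_exp) auto
      moreover have "exp m = exp (1::real) ^ Suc n"
        using m by (metis exp_of_nat_mult mult_1_right)
      ultimately show ?thesis
        by (simp add: field_simps power_divide del: power_Suc fact_Suc)
    qed
    then have "((m / exp 1) ^ Suc n) powr (1 / m) \<le> fact (Suc n) powr (1 / m)"
      using m by (intro powr_mono2) auto
    also have "((m / exp 1) ^ Suc n) powr (1 / m) = m / exp 1"
      using m by (subst powr_realpow[symmetric]) (auto simp: powr_powr simp del: power_Suc)
    finally have f: "m / exp 1 \<le> fact (Suc n) powr (1 / m)" .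
    have "m / exp 1 * (\<Prod>k\<le>n. a k) powr (1 / m) \<le> fact (Suc n) powr (1 / m) * (\<Prod>k\<le>n. a k) powr (1 / m)"
      using f by (intro mult_right_mono) auto
    also have "\<dots> = (\<Prod>k\<le>n. (real k + 1) * a k) powr (1 / m)"
      unfolding prod using pos by (subst powr_mult) (auto intro!: prod_nonneg less_imp_le simp del: fact_Suc)
    also have "\<dots> \<le> (\<Sum>k\<le>n. (real k + 1) * a k / m)"
      using arith_geom_mean[of "{..n}" "\<lambda>k. (real k + 1) * a k"] pos
      by (simp add: less_imp_le m_def add.commute)
    also have "\<dots> = S n / m"
      by (simp add: S_def sum_divide_distrib)
    finally have "(\<Prod>k\<le>n. a k) powr (1 / m) \<le> S n / m / (m / exp 1)"
      using m by (simp add: field_simps)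
    also have "\<dots> = exp 1 * (S n / m\<^sup>2)"
      by (simp add: power2_eq_square)
    finally show ?thesis by (simp add: m_def)
  qed
  have S0: "0 \<le> S n" for n
    unfolding S_def using pos by (intro sum_nonneg mult_nonneg_nonneg) (auto simp: less_imp_le)
  have "(\<Sum>n<N. (\<Prod>k\<le>n. a k) powr (1 / (real n + 1))) \<le> (\<Sum>n<N. exp 1 * (S n / (real n + 1)\<^sup>2))"
    by (intro sum_mono *)
  also have "\<dots> = exp 1 * (\<Sum>n<N. S n / (real n + 1)\<^sup>2)"
    by (simp add: sum_distrib_left)
  also have "\<dots> \<le> exp 1 * (2 * (\<Sum>k<N. a k))"
  proof (intro mult_left_mono)
    have "0 \<le> 2 * (\<Sum>k<N. (real k + 1) * a k) / (real N + 1)"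
      using pos by (intro divide_nonneg_pos mult_nonneg_nonneg sum_nonneg) (auto simp: less_imp_le)
    then show "(\<Sum>n<N. S n / (real n + 1)\<^sup>2) \<le> 2 * (\<Sum>k<N. a k)"
      using carleman_inequality_partial[of a N] pos by (simp add: S_def less_imp_le)
  qed auto
  also have "\<dots> \<le> exp 1 * (2 * suminf a)"
    using pos summable by (intro mult_left_mono sum_le_suminf) (auto simp: less_imp_le)
  finally show "(\<Sum>n<N. (\<Prod>k\<le>n. a k) powr (1 / (real n + 1))) \<le> exp 1 * (2 * suminf a)" .
qed auto

lemma log_convex_ratio_mono:
  fixes M :: "nat \<Rightarrow> real"
  assumes pos: "\<And>n. 0 < M n" and conv: "\<And>n. (M (Suc n))\<^sup>2 \<le> M n * M (Suc (Suc n))"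
  shows "incseq (\<lambda>n. M (Suc n) / M n)"
  using pos conv by (intro incseq_SucI) (simp add: divide_simps power2_eq_square mult.commute)

text \<open>The ratios of successive entries are nondecreasing, so each of the \<open>j\<close>
  factors is at most the last admissible ratio \<open>M (Suc N) / M N\<close>.\<close>

lemma log_convex_le:
  fixes M :: "nat \<Rightarrow> real"
  assumes pos: "\<And>n. 0 < M n" and conv: "\<And>n. (M (Suc n))\<^sup>2 \<le> M n * M (Suc (Suc n))"
    and "n + j \<le> Suc N"
  shows "M (n + j) \<le> M n * (M (Suc N) / M N) ^ j"
  using assms(3)
proof (induction j)
  case (Suc j)
  have r: "M (Suc (n + j)) / M (n + j) \<le> M (Suc N) / M N"
    using log_convex_ratio_mono[of M, OF pos conv] Suc.prems by (auto simp: incseq_def)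
  have "M (n + Suc j) = M (n + j) * (M (Suc (n + j)) / M (n + j))"
    using pos[of "n + j"] by simp
  also have "\<dots> \<le> (M n * (M (Suc N) / M N) ^ j) * (M (Suc N) / M N)"
    using Suc r pos by (intro mult_mono) (auto intro!: mult_nonneg_nonneg zero_le_power divide_nonneg_nonneg simp: less_imp_le)
  finally show ?case by (simp add: mult_ac)
qed simp

text \<open>One step of Bang's argument. The predicate \<open>\<forall>n. \<bar>F n x\<bar> \<le> exp (n - k) * M n\<close> measures how flat
  \<open>F 0\<close> is at \<open>x\<close>; moving by at most \<open>M N / (e * M (N + 1))\<close> costs one unit of \<open>k\<close>.\<close>
lemma bang_step:
  fixes F :: "nat \<Rightarrow> real \<Rightarrow> real" and M :: "nat \<Rightarrow> real"
  assumes deriv: "\<And>n x. (F n has_real_derivative F (Suc n) x) (at x)"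
    and bound: "\<And>n x. \<bar>F n x\<bar> \<le> M n"
    and pos: "\<And>n. 0 < M n" and conv: "\<And>n. (M (Suc n))\<^sup>2 \<le> M n * M (Suc (Suc n))"
    and flat: "\<And>n. \<bar>F n x\<bar> \<le> exp (real n - real (Suc N)) * M n"
    and h: "\<bar>h\<bar> \<le> M N / (exp 1 * M (Suc N))"
  shows "\<bar>F n (x + h)\<bar> \<le> exp (real n - real N) * M n"
proof (cases "n < Suc N \<and> h \<noteq> 0")
  case False
  then consider "n > N" | "h = 0" by linarith
  then show ?thesis
  proof cases
    \<comment> \<open>Above order \<open>N\<close> the claimed factor is at least 1 and the global
      bound is enough.\<close>
    case 1
    then have "1 \<le> exp (real n - real N)" by simp
    then have "1 * M n \<le> exp (real n - real N) * M n"
      using pos by (intro mult_right_mono) (auto simp: less_imp_le)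
    then show ?thesis using bound[of n "x + h"] by linarith
  next
    case 2
    have "exp (real n - real (Suc N)) * M n \<le> exp (real n - real N) * M n"
      using pos by (intro mult_right_mono) (auto simp: less_imp_le)
    then show ?thesis using 2 flat[of n] by simp
  qed
next
  case True
  \<comment> \<open>The Taylor expansion stops at the derivative of index \<open>Suc N\<close>:
    there the flatness factor is \<open>exp 0 = 1\<close>, so the remainder at the unknown point
    \<open>t\<close> is controlled by the global bound alone.\<close>
  define m where "m = Suc N - n"
  have m: "m > 0" "n + m = Suc N" using True by (auto simp: m_def)
  define r where "r = M (Suc N) / M N"
  have r: "r > 0" using pos by (simp add: r_def)
  define C where "C = exp (real n - real (Suc N)) * M n"
  have C: "C > 0" using pos by (simp add: C_def)
  define a b where "a = x - \<bar>h\<bar>" and "b = x + \<bar>h\<bar>"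
  have "\<exists>t. (if x + h < x then x + h < t \<and> t < x else x < t \<and> t < x + h) \<and>
      F n (x + h) = (\<Sum>j<m. (F (n + j) x / fact j) * ((x + h) - x)^j) + (F (n + m) t / fact m) * ((x + h) - x)^m"
    by (rule Taylor[of m "\<lambda>j. F (n + j)" _ a b]) (use True m deriv in \<open>auto simp: a_def b_def\<close>)
  then obtain t where t: "F n (x + h) = (\<Sum>j<m. (F (n + j) x / fact j) * h^j) + (F (n + m) t / fact m) * h^m"
    by auto
  have rh: "exp 1 * r * \<bar>h\<bar> \<le> 1"
    using h pos[of N] pos[of "Suc N"] by (simp add: r_def field_simps)
  \<comment> \<open>Each order contributes the factor
    \<open>exp 1 * r * \<bar>h\<bar> \<le> 1\<close>. The Taylor sum is then at most
    \<open>C * exp 1\<close>, which is the one unit of flatness lost.\<close>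
  have key: "exp (real (n + j) - real (Suc N)) * M (n + j) / fact j * \<bar>h\<bar> ^ j \<le> C / fact j" if "j \<le> m" for j
  proof -
    have "exp (real (n + j) - real (Suc N)) = exp (real n - real (Suc N)) * exp 1 ^ j"
      by (simp add: exp_add[symmetric] exp_of_nat_mult[symmetric])
    moreover have "M (n + j) \<le> M n * r ^ j"
      unfolding r_def using that m by (intro log_convex_le pos conv) auto
    ultimately have "exp (real (n + j) - real (Suc N)) * M (n + j) / fact j * \<bar>h\<bar> ^ j
        \<le> exp (real n - real (Suc N)) * exp 1 ^ j * (M n * r ^ j) / fact j * \<bar>h\<bar> ^ j"
      by (auto intro!: mult_right_mono mult_left_mono divide_right_mono)
    also have "\<dots> = C / fact j * (exp 1 * r * \<bar>h\<bar>) ^ j"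
      by (simp add: C_def power_mult_distrib)
    also have "\<dots> \<le> C / fact j * 1"
      using rh r C by (intro mult_left_mono power_le_one) auto
    finally show ?thesis by simp
  qed
  have "\<bar>F n (x + h)\<bar> \<le> (\<Sum>j<m. \<bar>(F (n + j) x / fact j) * h^j\<bar>) + \<bar>(F (n + m) t / fact m) * h^m\<bar>"
    unfolding t by (rule order.trans[OF abs_triangle_ineq]) (intro add_mono sum_abs order.refl)
  also have "\<dots> \<le> (\<Sum>j<m. C / fact j) + C / fact m"
  proof (intro add_mono sum_mono)
    fix j assume "j \<in> {..<m}"
    have "\<bar>(F (n + j) x / fact j) * h^j\<bar> = \<bar>F (n + j) x\<bar> / fact j * \<bar>h\<bar> ^ j"
      by (simp add: abs_mult power_abs)
    also have "\<dots> \<le> exp (real (n + j) - real (Suc N)) * M (n + j) / fact j * \<bar>h\<bar> ^ j"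
      by (intro mult_right_mono divide_right_mono flat) auto
    also have "\<dots> \<le> C / fact j"
      using \<open>j \<in> {..<m}\<close> by (intro key) auto
    finally show "\<bar>(F (n + j) x / fact j) * h^j\<bar> \<le> C / fact j" .
  next
    have "\<bar>(F (n + m) t / fact m) * h^m\<bar> = \<bar>F (n + m) t\<bar> / fact m * \<bar>h\<bar> ^ m"
      by (simp add: abs_mult power_abs)
    also have "\<dots> \<le> exp (real (n + m) - real (Suc N)) * M (n + m) / fact m * \<bar>h\<bar> ^ m"
      using bound[of "n + m" t] m by (intro mult_right_mono divide_right_mono) auto
    also have "\<dots> \<le> C / fact m" by (intro key) auto
    finally show "\<bar>(F (n + m) t / fact m) * h^m\<bar> \<le> C / fact m" .
  qed
  also have "\<dots> = C * (\<Sum>j<Suc m. 1 ^ j /\<^sub>R fact j)"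
    by (simp add: sum_distrib_left divide_inverse distrib_left)
  also have "\<dots> \<le> C * exp 1"
    unfolding exp_def using C by (intro mult_left_mono sum_le_suminf summable_exp_generic) auto
  also have "\<dots> = exp (real n - real N) * M n"
    by (simp add: C_def mult_ac exp_add[symmetric] exp_minus)
  finally show ?thesis .
qed

text \<open>Infinite flatness at 0 allows starting at any level \<open>N\<close> and walking towards
  \<open>x\<close> with step lengths \<open>g i\<close>, losing one level per step. Since the
  \<open>g i\<close> have divergent sum, a large \<open>N\<close> lets the walk reach
  \<open>x\<close> while still at level \<open>k\<close>, for every \<open>k\<close>.\<close>

theorem denjoy_carleman_bang:
  fixes F :: "nat \<Rightarrow> real \<Rightarrow> real" and M :: "nat \<Rightarrow> real"
  assumes deriv: "\<And>n x. (F n has_real_derivative F (Suc n) x) (at x)"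
    and bound: "\<And>n x. \<bar>F n x\<bar> \<le> M n"
    and pos: "\<And>n. 0 < M n" and conv: "\<And>n. (M (Suc n))\<^sup>2 \<le> M n * M (Suc (Suc n))"
    and zero: "\<And>n. F n 0 = 0"
    and div: "\<not> summable (\<lambda>n. M n / M (Suc n))"
  shows "F 0 x = 0"
proof -
  define g where "g i = M i / (exp 1 * M (Suc i))" for i
  have g0: "g i \<ge> 0" for i using pos by (simp add: g_def less_imp_le)
  \<comment> \<open>Downward induction on the level; at level \<open>N\<close> the sum is empty and
    only \<open>y = 0\<close> is reachable.\<close>
  have reach: "\<bar>F n y\<bar> \<le> exp (real n - real k) * M n" if "k \<le> N" "\<bar>y\<bar> \<le> (\<Sum>i=k..<N. g i)" for n k N y
    using that
  proof (induction k arbitrary: y n rule: inc_induct)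
    case base
    then show ?case using zero pos by (simp add: less_imp_le)
  next
    case (step k)
    define H where "H = (\<Sum>i=Suc k..<N. g i)"
    have H0: "H \<ge> 0" unfolding H_def by (intro sum_nonneg g0)
    have split: "(\<Sum>i=k..<N. g i) = g k + H"
      unfolding H_def using step by (simp add: sum.atLeast_Suc_lessThan)
    \<comment> \<open>\<open>z\<close> is the point nearest to \<open>y\<close> within the radius
      reachable at level \<open>Suc k\<close>; the remaining distance is a single step of length at
      most \<open>g k\<close>.\<close>
    define z where "z = max (- H) (min y H)"
    have z: "\<bar>z\<bar> \<le> H" using H0 by (auto simp: z_def)
    have "\<bar>y - z\<bar> \<le> g k" using step.prems H0 g0[of k] unfolding split z_def by auto
    then have "\<bar>F n (z + (y - z))\<bar> \<le> exp (real n - real k) * M n"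
      by (intro bang_step[of F M, OF deriv bound pos conv]) (use step.IH z in \<open>auto simp: g_def H_def\<close>)
    then show ?case by simp
  qed
  have small: "\<bar>F 0 x\<bar> \<le> exp (- real k) * M 0" for k
  proof -
    have "\<exists>N\<ge>k. \<bar>x\<bar> \<le> (\<Sum>i=k..<N. g i)"
    proof (rule ccontr)
      assume "\<not> ?thesis"
      then have *: "(\<Sum>i=k..<N. g i) \<le> \<bar>x\<bar>" if "N \<ge> k" for N using that by fastforce
      have "summable (\<lambda>i. g (i + k))"
      proof (rule summableI_nonneg_bounded)
        fix N
        have "(\<Sum>i<N. g (i + k)) = (\<Sum>i=k..<N+k. g i)"
          using sum.shift_bounds_nat_ivl[of g 0 k N] by (simp add: atLeast0LessThan)
        then show "(\<Sum>i<N. g (i + k)) \<le> \<bar>x\<bar>" using *[of "N + k"] by simp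
      qed (rule g0)
      then have "summable g" by (simp add: summable_iff_shift)
      then have "summable (\<lambda>i. exp 1 * g i)" by (rule summable_mult)
      then show False using div by (simp add: g_def)
    qed
    then show ?thesis using reach[of k _ x 0] by auto
  qed
  have "(\<lambda>k. exp (- real k) * M 0) \<longlonglongrightarrow> 0 * M 0"
    by (intro tendsto_mult tendsto_const) real_asymp
  then have "\<bar>F 0 x\<bar> \<le> 0"
    by (intro LIMSEQ_le_const[where X = "\<lambda>k. exp (- real k) * M 0"]) (use small in auto)
  then show ?thesis by simp
qed

text \<open>The product of the ratios \<open>M k / M (Suc k)\<close> telescopes to
  \<open>M 0 / M (Suc n)\<close>, so Carleman's inequality turns convergence of the ratio series
  into convergence of the root series.\<close>

corollary denjoy_carleman:
  fixes F :: "nat \<Rightarrow> real \<Rightarrow> real" and M :: "nat \<Rightarrow> real"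
  assumes deriv: "\<And>n x. (F n has_real_derivative F (Suc n) x) (at x)"
    and bound: "\<And>n x. \<bar>F n x\<bar> \<le> C * M n"
    and pos: "\<And>n. 0 < M n" and conv: "\<And>n. (M (Suc n))\<^sup>2 \<le> M n * M (Suc (Suc n))"
    and zero: "\<And>n. F n 0 = 0"
    and div: "\<not> summable (\<lambda>n. M (Suc n) powr (- 1 / real (Suc n)))"
  shows "F 0 x = 0"
proof -
  define a where "a n = M n / M (Suc n)" for n
  have apos: "a n > 0" for n using pos by (simp add: a_def)
  have prod: "(\<Prod>k\<le>n. a k) = M 0 / M (Suc n)" for n
    by (induction n) (use pos in \<open>simp_all add: a_def less_imp_neq[symmetric]\<close>)
  \<comment> \<open>The majorant must be strictly positive, also when \<open>C = 0\<close>.\<close>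
  define D where "D = \<bar>C\<bar> + 1"
  have D0: "D \<noteq> 0" unfolding D_def by linarith
  have "\<not> summable (\<lambda>n. (D * M n) / (D * M (Suc n)))"
  proof
    assume "summable (\<lambda>n. (D * M n) / (D * M (Suc n)))"
    then have "summable a" using D0 by (simp add: a_def[abs_def])
    then have s: "summable (\<lambda>n. (M 0 / M (Suc n)) powr (1 / (real n + 1)))"
      using carleman_inequality[of a] apos by (simp add: prod)
    have "summable (\<lambda>n. M (Suc n) powr (- 1 / real (Suc n)))"
    proof (rule summable_comparison_test[OF _ summable_mult[OF s, of "1 / min 1 (M 0)"]], intro exI allI impI)
      fix n :: nat
      have c: "min 1 (M 0) \<le> M 0 powr (1 / (real n + 1))"
      proof (cases "M 0 \<ge> 1")
        case True then show ?thesis using ge_one_powr_ge_zero[of "M 0" "1 / (real n + 1)"] by auto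
      next
        case False
        then have "M 0 powr 1 \<le> M 0 powr (1 / (real n + 1))"
          using pos[of 0] by (intro powr_mono') auto
        then show ?thesis using pos[of 0] by auto
      qed
      have "M (Suc n) powr (- 1 / real (Suc n)) * min 1 (M 0) \<le> M (Suc n) powr (- 1 / real (Suc n)) * M 0 powr (1 / (real n + 1))"
        using c by (intro mult_left_mono) auto
      also have "\<dots> = (M 0 / M (Suc n)) powr (1 / (real n + 1))"
        using pos[of 0] pos[of "Suc n"]
        by (simp add: powr_divide powr_minus_divide add.commute)
      finally show "norm (M (Suc n) powr (- 1 / real (Suc n))) \<le> 1 / min 1 (M 0) * (M 0 / M (Suc n)) powr (1 / (real n + 1))"
        using pos[of 0] by (simp add: field_simps)
    qed
    then show False using div by simp
  qed
  moreover have "\<bar>F n x\<bar> \<le> D * M n" for n x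
  proof -
    have "C * M n \<le> D * M n" using pos[of n] by (intro mult_right_mono) (auto simp: D_def)
    then show ?thesis using bound[of n x] by linarith
  qed
  moreover have "(D * M (Suc n))\<^sup>2 \<le> (D * M n) * (D * M (Suc (Suc n)))" for n
    using mult_left_mono[OF conv[of n], of "D\<^sup>2"] by (simp add: power_mult_distrib power2_eq_square mult_ac)
  moreover have "D * M n > 0" for n using pos[of n] by (simp add: D_def)
  ultimately show ?thesis
    using denjoy_carleman_bang[of F, OF deriv, of "\<lambda>n. D * M n"] zero by blast
qed

lemma quadratic_nonneg_discriminant:
  fixes a b c :: real
  assumes "\<And>t. 0 \<le> a + 2 * b * t + c * t\<^sup>2"
  shows "b\<^sup>2 \<le> a * c"
proof (cases "c = 0")
  case True
  have "b = 0"
  proof (rule ccontr)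
    assume b: "b \<noteq> 0"
    have "a + 2 * b * (- (\<bar>a\<bar> + 1) / (2 * b)) = a - (\<bar>a\<bar> + 1)" using b by simp
    then show False using assms[of "- (\<bar>a\<bar> + 1) / (2 * b)"] True by (simp add: abs_if split: if_splits)
  qed
  then show ?thesis using True by simp
next
  case False
  have c: "c > 0"
  proof (rule ccontr)
    assume "\<not> c > 0"
    then have c: "c < 0" using False by simp
    have lim: "filterlim (\<lambda>t::real. a + 2 * b * t + c * t\<^sup>2) at_bot at_top"
      using c by real_asymp
    have "eventually (\<lambda>t. a + 2 * b * t + c * t\<^sup>2 < 0) at_top"
      using lim unfolding filterlim_at_bot_dense by auto
    then show False using assms by (auto simp: eventually_at_top_linorder not_less[symmetric])
  qed
  have "0 \<le> c * (a + 2 * b * (- b / c) + c * (- b / c)\<^sup>2)"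
    using c by (intro mult_nonneg_nonneg assms) auto
  also have "\<dots> = a * c - b\<^sup>2"
    using False by (simp add: field_simps power2_eq_square)
  finally show ?thesis by simp
qed

lemma integral_cauchy_schwarz:
  fixes f g :: "'a \<Rightarrow> real"
  assumes "integrable M (\<lambda>x. (f x)\<^sup>2)" "integrable M (\<lambda>x. (g x)\<^sup>2)" "integrable M (\<lambda>x. f x * g x)"
  shows "(\<integral>x. f x * g x \<partial>M)\<^sup>2 \<le> (\<integral>x. (f x)\<^sup>2 \<partial>M) * (\<integral>x. (g x)\<^sup>2 \<partial>M)"
proof (rule quadratic_nonneg_discriminant)
  fix t :: real
  have "0 \<le> (\<integral>x. (f x + t * g x)\<^sup>2 \<partial>M)" by simp
  also have "(\<lambda>x. (f x + t * g x)\<^sup>2) = (\<lambda>x. (f x)\<^sup>2 + 2 * t * (f x * g x) + t\<^sup>2 * (g x)\<^sup>2)"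
    by (auto simp: power2_eq_square algebra_simps)
  also have "(\<integral>x. (f x)\<^sup>2 + 2 * t * (f x * g x) + t\<^sup>2 * (g x)\<^sup>2 \<partial>M)
      = (\<integral>x. (f x)\<^sup>2 \<partial>M) + 2 * t * (\<integral>x. f x * g x \<partial>M) + t\<^sup>2 * (\<integral>x. (g x)\<^sup>2 \<partial>M)"
    using assms by simp
  finally show "0 \<le> (\<integral>x. (f x)\<^sup>2 \<partial>M) + 2 * (\<integral>x. f x * g x \<partial>M) * t + (\<integral>x. (g x)\<^sup>2 \<partial>M) * t\<^sup>2"
    by (simp add: mult_ac)
qed

section \<open>Weighted one-dimensional marginals\<close>

lemma cos_first_order_bound:
  fixes a b :: real
  shows "\<bar>cos (a + b) - cos a - b * cos (a + pi / 2)\<bar> \<le> b\<^sup>2"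
proof -
  have s: "\<bar>sin b - b\<bar> \<le> b\<^sup>2 / 2"
  proof -
    have "(\<Sum>m<2. sin_coeff m * b ^ m) = b"
      by (simp add: lessThan_nat_numeral sin_coeff_def)
    then show ?thesis using Maclaurin_sin_bound[of b 2] by (simp add: fact_numeral)
  qed
  have "cos b = 1 - 2 * (sin (b / 2))\<^sup>2"
    using cos_double_sin[of "b / 2"] by simp
  moreover have "(sin (b / 2))\<^sup>2 \<le> (b / 2)\<^sup>2"
    using abs_sin_x_le_abs_x[of "b / 2"] by (rule abs_le_square_iff[THEN iffD1])
  ultimately have c: "\<bar>cos b - 1\<bar> \<le> b\<^sup>2 / 2"
    by (simp add: power_divide abs_le_iff)
  have "cos (a + b) - cos a - b * cos (a + pi / 2) = cos a * (cos b - 1) - sin a * (sin b - b)"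
    by (simp add: cos_add algebra_simps)
  also have "\<bar>\<dots>\<bar> \<le> \<bar>cos a\<bar> * \<bar>cos b - 1\<bar> + \<bar>sin a\<bar> * \<bar>sin b - b\<bar>"
    by (metis abs_triangle_ineq4 abs_mult)
  also have "\<dots> \<le> 1 * (b\<^sup>2 / 2) + 1 * (b\<^sup>2 / 2)"
    using s c by (intro add_mono mult_mono) auto
  finally show ?thesis by simp
qed

text \<open>Used to differentiate under an integral sign without a limit theorem: the first-order
  error of the integrand is at most \<open>h^2\<close> times an integrable function.\<close>

lemma has_real_derivative_quadratic_boundI:
  fixes f :: "real \<Rightarrow> real"
  assumes "\<And>h. \<bar>f (x + h) - f x - h * D\<bar> \<le> K * h\<^sup>2"
  shows "(f has_real_derivative D) (at x)"
proof -
  have "(\<lambda>h. (f (x + h) - f x) / h - D) \<midarrow>0\<rightarrow> 0"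
  proof (rule Lim_null_comparison[where g = "\<lambda>h. K * \<bar>h\<bar>"])
    show "(\<lambda>h. K * \<bar>h\<bar>) \<midarrow>0\<rightarrow> (0::real)"
      by (intro tendsto_eq_intros) auto
    show "\<forall>\<^sub>F h in at 0. norm ((f (x + h) - f x) / h - D) \<le> K * \<bar>h\<bar>"
    proof (rule eventually_mono[OF eventually_neq_at_within[of 0]])
      fix h :: real assume h: "h \<noteq> 0"
      have "norm ((f (x + h) - f x) / h - D) = \<bar>f (x + h) - f x - h * D\<bar> / \<bar>h\<bar>"
        using h by (simp add: diff_divide_distrib flip: abs_divide)
      also have "\<dots> \<le> K * h\<^sup>2 / \<bar>h\<bar>" by (intro divide_right_mono assms) auto
      also have "h\<^sup>2 / \<bar>h\<bar> = \<bar>h\<bar>" using h by (simp add: power2_eq_square abs_if)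
      then have "K * h\<^sup>2 / \<bar>h\<bar> = K * \<bar>h\<bar>" by (metis times_divide_eq_right)
      finally show "norm ((f (x + h) - f x) / h - D) \<le> K * \<bar>h\<bar>" .
    qed
  qed
  then show ?thesis unfolding DERIV_def by (simp add: LIM_zero_iff)
qed

lemma integrable_bounded_mult:
  fixes f g :: "'a \<Rightarrow> real"
  assumes "integrable M f" "g \<in> borel_measurable M" "\<And>x. \<bar>g x\<bar> \<le> 1"
  shows "integrable M (\<lambda>x. f x * g x)"
proof (rule Bochner_Integration.integrable_bound[OF assms(1)])
  show "(\<lambda>x. f x * g x) \<in> borel_measurable M" using assms by measurable
  show "AE x in M. norm (f x * g x) \<le> norm (f x)"
    using assms(3) by (auto simp: abs_mult mult_left_le)
qed

text \<open>The phase shift by \<open>\<pi> / 2\<close> makes all derivatives of one shape.\<close>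
lemma has_real_derivative_cos_integral:
  fixes X w :: "'a \<Rightarrow> real"
  assumes [measurable]: "X \<in> borel_measurable M" "w \<in> borel_measurable M"
    and w0: "\<And>x. 0 \<le> w x"
    and int: "\<And>n. integrable M (\<lambda>x. w x * X x ^ n)"
  shows "((\<lambda>r. \<integral>x. w x * X x ^ n * cos (r * X x + \<theta> + n * (pi / 2)) \<partial>M) has_real_derivative
    (\<integral>x. w x * X x ^ Suc n * cos (r * X x + \<theta> + Suc n * (pi / 2)) \<partial>M)) (at r)"
proof (rule has_real_derivative_quadratic_boundI)
  fix h
  define A B C where "A x = w x * X x ^ n * cos ((r + h) * X x + \<theta> + n * (pi / 2))"
    and "B x = w x * X x ^ n * cos (r * X x + \<theta> + n * (pi / 2))"
    and "C x = w x * X x ^ Suc n * cos (r * X x + \<theta> + Suc n * (pi / 2))" for x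
  have iA: "integrable M A" and iB: "integrable M B" and iC: "integrable M C"
    unfolding A_def[abs_def] B_def[abs_def] C_def[abs_def] by (intro integrable_bounded_mult int; simp)+
  have iabs: "integrable M (\<lambda>x. \<bar>w x * X x ^ (n + 2)\<bar>)" using int by (rule integrable_abs)
  have "\<bar>A x - B x - h * C x\<bar> \<le> h\<^sup>2 * \<bar>w x * X x ^ (n + 2)\<bar>" for x
  proof -
    define a where "a = r * X x + \<theta> + n * (pi / 2)"
    have "A x - B x - h * C x = (w x * X x ^ n) * (cos (a + h * X x) - cos a - (h * X x) * cos (a + pi / 2))"
    proof -
      have 1: "(r + h) * X x + \<theta> + n * (pi / 2) = a + h * X x"
        by (simp add: a_def algebra_simps)
      have 2: "r * X x + \<theta> + Suc n * (pi / 2) = a + pi / 2"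
        by (simp add: a_def distrib_right)
      show ?thesis
        unfolding A_def B_def C_def 1 2 a_def[symmetric] by (simp add: algebra_simps)
    qed
    also have "\<bar>\<dots>\<bar> \<le> \<bar>w x * X x ^ n\<bar> * (h * X x)\<^sup>2"
      unfolding abs_mult by (intro mult_left_mono cos_first_order_bound) auto
    also have "\<dots> = h\<^sup>2 * \<bar>w x * X x ^ (n + 2)\<bar>"
      by (simp add: abs_mult power_mult_distrib power_abs power2_eq_square mult_ac)
    finally show ?thesis .
  qed
  then have "\<bar>\<integral>x. A x - B x - h * C x \<partial>M\<bar> \<le> (\<integral>x. h\<^sup>2 * \<bar>w x * X x ^ (n + 2)\<bar> \<partial>M)"
    using iA iB iC iabs by (intro order.trans[OF integral_abs_bound integral_mono]) auto
  then show "\<bar>(\<integral>x. w x * X x ^ n * cos ((r + h) * X x + \<theta> + n * (pi / 2)) \<partial>M)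
      - (\<integral>x. w x * X x ^ n * cos (r * X x + \<theta> + n * (pi / 2)) \<partial>M)
      - h * (\<integral>x. w x * X x ^ Suc n * cos (r * X x + \<theta> + Suc n * (pi / 2)) \<partial>M)\<bar>
    \<le> (\<integral>x. \<bar>w x * X x ^ (n + 2)\<bar> \<partial>M) * h\<^sup>2"
    using iA iB iC unfolding A_def[symmetric] B_def[symmetric] C_def[symmetric] by (simp add: mult.commute)
qed

text \<open>A vanishing entry is a case of its own because \<open>0 powr x = 0\<close>, whereas the
  convention requires an infinite term.\<close>

definition carleman_real :: "(nat \<Rightarrow> real) \<Rightarrow> bool" where
  "carleman_real m \<longleftrightarrow> (\<exists>n. m (2 * Suc n) = 0) \<or>
    \<not> summable (\<lambda>n. m (2 * Suc n) powr (- 1 / real (2 * Suc n)))"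

text \<open>Equal weighted moments make all derivatives of the difference \<open>F 0\<close> vanish
  at 0, and Cauchy-Schwarz against \<open>w\<close> bounds the \<open>n\<close>-th one by a multiple
  of \<open>u n\<close>, so Denjoy-Carleman applies. The free phase \<open>\<theta>\<close> covers
  the real and the imaginary part of the Fourier transform at once.\<close>

lemma weighted_cos_integrals_eq:
  fixes X w :: "'a \<Rightarrow> real"
  assumes sets: "sets N = sets M"
    and [measurable]: "X \<in> borel_measurable M" "w \<in> borel_measurable M"
    and w0: "\<And>x. 0 \<le> w x"
    and iM: "\<And>n. integrable M (\<lambda>x. w x * X x ^ n)" "\<And>n. integrable M (\<lambda>x. X x ^ (2 * n))" "integrable M (\<lambda>x. (w x)\<^sup>2)"
    and iN: "\<And>n. integrable N (\<lambda>x. w x * X x ^ n)" "\<And>n. integrable N (\<lambda>x. X x ^ (2 * n))" "integrable N (\<lambda>x. (w x)\<^sup>2)"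
    and mM: "\<And>n. (\<integral>x. X x ^ (2 * n) \<partial>M) = m (2 * n)" and mN: "\<And>n. (\<integral>x. X x ^ (2 * n) \<partial>N) = m (2 * n)"
    and eq: "\<And>n. (\<integral>x. w x * X x ^ n \<partial>M) = (\<integral>x. w x * X x ^ n \<partial>N)"
    and carl: "\<not> summable (\<lambda>n. m (2 * Suc n) powr (- 1 / real (2 * Suc n)))"
    and mpos: "\<And>n. 0 < m (2 * n)"
  shows "(\<integral>x. w x * cos (r * X x + \<theta>) \<partial>M) = (\<integral>x. w x * cos (r * X x + \<theta>) \<partial>N)"
proof -
  have [measurable]: "X \<in> borel_measurable N" "w \<in> borel_measurable N"
    using assms(2,3) by (simp_all add: measurable_cong_sets[OF sets refl])
  define F where "F n r = (\<integral>x. w x * X x ^ n * cos (r * X x + \<theta> + n * (pi / 2)) \<partial>M)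
    - (\<integral>x. w x * X x ^ n * cos (r * X x + \<theta> + n * (pi / 2)) \<partial>N)" for n r
  define u where "u n = sqrt (m (2 * n))" for n
  have upos: "u n > 0" for n using mpos by (simp add: u_def)
  have bd: "\<bar>\<integral>x. w x * X x ^ n * cos (r * X x + \<theta> + n * (pi / 2)) \<partial>L\<bar> \<le> sqrt (\<integral>x. (w x)\<^sup>2 \<partial>L) * u n"
    if [measurable]: "X \<in> borel_measurable L" "w \<in> borel_measurable L"
      and iL: "\<And>n. integrable L (\<lambda>x. w x * X x ^ n)" "\<And>n. integrable L (\<lambda>x. X x ^ (2 * n))" "integrable L (\<lambda>x. (w x)\<^sup>2)"
      and mL: "\<And>n. (\<integral>x. X x ^ (2 * n) \<partial>L) = m (2 * n)" for L n r
  proof -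
    have i: "integrable L (\<lambda>x. w x * X x ^ n * cos (r * X x + \<theta> + n * (pi / 2)))"
      by (intro integrable_bounded_mult iL; simp)
    have sq: "(\<bar>X x\<bar> ^ n)\<^sup>2 = X x ^ (2 * n)" for x
      by (metis power2_abs power_mult mult.commute power_abs)
    have iw: "integrable L (\<lambda>x. w x * \<bar>X x\<bar> ^ n)"
      using integrable_abs[OF iL(1)[of n]] w0 by (simp add: abs_mult power_abs)
    have "\<bar>\<integral>x. w x * X x ^ n * cos (r * X x + \<theta> + n * (pi / 2)) \<partial>L\<bar> \<le> (\<integral>x. w x * \<bar>X x\<bar> ^ n \<partial>L)"
    proof (rule order.trans[OF integral_abs_bound integral_mono])
      fix x
      show "\<bar>w x * X x ^ n * cos (r * X x + \<theta> + n * (pi / 2))\<bar> \<le> w x * \<bar>X x\<bar> ^ n"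
        unfolding abs_mult power_abs using w0[of x]
        by (simp add: mult_left_le)
    qed (use i iw in auto)
    also have "\<dots> = sqrt ((\<integral>x. w x * \<bar>X x\<bar> ^ n \<partial>L)\<^sup>2)"
      using w0 by (simp add: real_sqrt_abs abs_of_nonneg)
    also have "\<dots> \<le> sqrt ((\<integral>x. (w x)\<^sup>2 \<partial>L) * (\<integral>x. (\<bar>X x\<bar> ^ n)\<^sup>2 \<partial>L))"
      by (intro real_sqrt_le_mono integral_cauchy_schwarz iw) (auto simp: sq iL)
    also have "\<dots> = sqrt (\<integral>x. (w x)\<^sup>2 \<partial>L) * u n"
      by (simp add: sq mL u_def real_sqrt_mult)
    finally show ?thesis .
  qed
  \<comment> \<open>Even moments of a measure are log-convex, and square roots keep this.\<close>
  have conv: "(u (Suc n))\<^sup>2 \<le> u n * u (Suc (Suc n))" for n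
  proof -
    have e: "(\<lambda>x. X x ^ n * X x ^ Suc (Suc n)) = (\<lambda>x. X x ^ (2 * Suc n))"
      by (simp add: power_add[symmetric] mult_2 flip: power_Suc)
    have "(\<integral>x. X x ^ n * X x ^ Suc (Suc n) \<partial>M)\<^sup>2 \<le> (\<integral>x. (X x ^ n)\<^sup>2 \<partial>M) * (\<integral>x. (X x ^ Suc (Suc n))\<^sup>2 \<partial>M)"
      by (rule integral_cauchy_schwarz) (use iM(2) in \<open>simp_all only: e power_mult[symmetric] mult.commute[of _ 2]\<close>)
    then have "(m (2 * Suc n))\<^sup>2 \<le> m (2 * n) * m (2 * Suc (Suc n))"
      by (simp only: e power_mult[symmetric] mult.commute[of _ 2] mM)
    then have "sqrt ((m (2 * Suc n))\<^sup>2) \<le> sqrt (m (2 * n) * m (2 * Suc (Suc n)))"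
      by (rule real_sqrt_le_mono)
    then show ?thesis using mpos[of "Suc n"] unfolding u_def real_sqrt_mult by simp
  qed
  have "F 0 r = 0"
  proof (rule denjoy_carleman[of F "sqrt (\<integral>x. (w x)\<^sup>2 \<partial>M) + sqrt (\<integral>x. (w x)\<^sup>2 \<partial>N)" u])
    show "\<And>n x. (F n has_real_derivative F (Suc n) x) (at x)"
      unfolding F_def by (intro DERIV_diff has_real_derivative_cos_integral iM iN w0) simp_all
    show "\<bar>F n r\<bar> \<le> (sqrt (\<integral>x. (w x)\<^sup>2 \<partial>M) + sqrt (\<integral>x. (w x)\<^sup>2 \<partial>N)) * u n" for n r
      unfolding F_def distrib_right
      by (intro order.trans[OF abs_triangle_ineq4] add_mono bd iM iN mM mN) simp_all
    show "F n 0 = 0" for n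
      unfolding F_def using eq[of n] by simp
    have "u (Suc n) powr (- 1 / real (Suc n)) = m (2 * Suc n) powr (- 1 / real (2 * Suc n))" for n
    proof -
      have "u (Suc n) = m (2 * Suc n) powr (1 / 2)"
        using mpos[of "Suc n"] unfolding u_def by (simp only: powr_half_sqrt less_imp_le)
      then have "u (Suc n) powr (- 1 / real (Suc n)) = m (2 * Suc n) powr (1 / 2 * (- 1 / real (Suc n)))"
        by (simp only: powr_powr)
      also have "1 / 2 * (- 1 / real (Suc n)) = - 1 / real (2 * Suc n)"
        by simp
      finally show ?thesis .
    qed
    then show "\<not> summable (\<lambda>n. u (Suc n) powr (- 1 / real (Suc n)))"
      using carl by simp
  qed (rule upos conv)+
  then show ?thesis by (simp add: F_def)
qed

lemma weighted_distribution_eqI: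
  fixes X w :: "'a \<Rightarrow> real"
  assumes sets: "sets N = sets M"
    and [measurable]: "X \<in> borel_measurable M" "w \<in> borel_measurable M"
    and w0: "\<And>x. 0 \<le> w x"
    and iM: "\<And>n. integrable M (\<lambda>x. w x * X x ^ n)" "\<And>n. integrable M (\<lambda>x. X x ^ (2 * n))" "integrable M (\<lambda>x. (w x)\<^sup>2)"
    and iN: "\<And>n. integrable N (\<lambda>x. w x * X x ^ n)" "\<And>n. integrable N (\<lambda>x. X x ^ (2 * n))" "integrable N (\<lambda>x. (w x)\<^sup>2)"
    and mM: "\<And>n. (\<integral>x. X x ^ (2 * n) \<partial>M) = m (2 * n)" and mN: "\<And>n. (\<integral>x. X x ^ (2 * n) \<partial>N) = m (2 * n)"
    and eq: "\<And>n. (\<integral>x. w x * X x ^ n \<partial>M) = (\<integral>x. w x * X x ^ n \<partial>N)"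
    and carl: "carleman_real m"
    and [measurable]: "B \<in> sets borel"
  shows "(\<integral>x. w x * indicator B (X x) \<partial>M) = (\<integral>x. w x * indicator B (X x) \<partial>N)"
proof (cases "\<exists>n. m (2 * n) = 0")
  case True
  then obtain n where n: "m (2 * n) = 0" by auto
  \<comment> \<open>A vanishing even moment forces \<open>X = 0\<close> almost everywhere, so only
    the total weighted mass matters. For \<open>n = 0\<close> the measure itself is null.\<close>
  have *: "(\<integral>x. w x * indicator B (X x) \<partial>L) = (\<integral>x. w x * X x ^ 0 \<partial>L) * indicator B 0"
    if "\<And>n. integrable L (\<lambda>x. X x ^ (2 * n))" "(\<integral>x. X x ^ (2 * n) \<partial>L) = 0"
      and [measurable]: "X \<in> borel_measurable L" "w \<in> borel_measurable L" for L
  proof -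
    have "AE x in L. X x ^ (2 * n) = 0"
      using that by (subst integral_nonneg_eq_0_iff_AE[symmetric]) auto
    then have "AE x in L. w x * indicator B (X x) = w x * X x ^ 0 * indicator B 0"
      by eventually_elim (auto split: split_indicator)
    then have "(\<integral>x. w x * indicator B (X x) \<partial>L) = (\<integral>x. w x * X x ^ 0 * indicator B 0 \<partial>L)"
      by (rule integral_cong_AE[rotated 2]) auto
    then show ?thesis by simp
  qed
  show ?thesis
    using *[of M] *[of N] iM iN mM mN n eq[of 0] assms(2,3)
    by (simp add: measurable_cong_sets[OF sets refl])
next
  case False
  then have ns: "\<not> summable (\<lambda>n. m (2 * Suc n) powr (- 1 / real (2 * Suc n)))"
    using carl unfolding carleman_real_def by blast
  have mpos: "0 < m (2 * n)" for n
  proof -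
    have "0 \<le> m (2 * n)" unfolding mM[symmetric] by simp
    then show ?thesis using False by (metis order_le_less)
  qed
  note cos = weighted_cos_integrals_eq[OF sets assms(2,3) w0 iM iN mM mN eq ns mpos]
  have [measurable]: "X \<in> borel_measurable N" "w \<in> borel_measurable N"
    using assms(2,3) by (simp_all add: measurable_cong_sets[OF sets refl])
  have iw: "integrable M w" "integrable N w" using iM(1)[of 0] iN(1)[of 0] by simp_all
  define c where "c = (\<integral>x. w x \<partial>M)"
  have cN: "c = (\<integral>x. w x \<partial>N)" using eq[of 0] by (simp add: c_def)
  show ?thesis
  proof (cases "c = 0")
    case True
    then have "AE x in M. w x = 0" "AE x in N. w x = 0"
      using w0 iw cN c_def by (simp_all add: integral_nonneg_eq_0_iff_AE[symmetric])
    then have "(\<integral>x. w x * indicator B (X x) \<partial>M) = 0" "(\<integral>x. w x * indicator B (X x) \<partial>N) = 0"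
      by (auto intro!: integral_eq_zero_AE)
    then show ?thesis by simp
  next
    case False
    then have c: "c > 0" using w0 by (simp add: c_def order_less_le)
    \<comment> \<open>The weighted law of \<open>X\<close>, normalised by the common mass
      \<open>c\<close> so that uniqueness of characteristic functions applies.\<close>
    define D where "D L = distr (density L (\<lambda>x. ennreal (w x / c))) borel X" for L
    have D: "real_distribution (D L)"
        "\<And>f. f \<in> borel_measurable borel \<Longrightarrow> (\<integral>y. f y \<partial>D L) = (\<integral>x. (w x / c) *\<^sub>R (f (X x) :: complex) \<partial>L)"
        "\<And>f. f \<in> borel_measurable borel \<Longrightarrow> (\<integral>y. f y \<partial>D L) = (\<integral>x. (w x / c) *\<^sub>R (f (X x) :: real) \<partial>L)"
      if [measurable]: "X \<in> borel_measurable L" "w \<in> borel_measurable L" and L: "integrable L w" "(\<integral>x. w x \<partial>L) = c" for L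
    proof -
      have "emeasure (density L (\<lambda>x. ennreal (w x / c))) (space L) = (\<integral>\<^sup>+x. ennreal (w x / c) \<partial>L)"
        by (subst emeasure_density) (auto intro!: nn_integral_cong)
      also have "\<dots> = ennreal (\<integral>x. w x / c \<partial>L)"
        using L c w0 by (intro nn_integral_eq_integral) auto
      also have "\<dots> = 1" using L c by simp
      finally have "prob_space (density L (\<lambda>x. ennreal (w x / c)))"
        by (intro prob_spaceI) simp
      then show "real_distribution (D L)"
        unfolding D_def by (intro prob_space.real_distribution_distr) auto
      show "f \<in> borel_measurable borel \<Longrightarrow> (\<integral>y. f y \<partial>D L) = (\<integral>x. (w x / c) *\<^sub>R (f (X x) :: complex) \<partial>L)" for f
        unfolding D_def using c w0 by (subst integral_distr, simp, simp, subst integral_density) auto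
      show "f \<in> borel_measurable borel \<Longrightarrow> (\<integral>y. f y \<partial>D L) = (\<integral>x. (w x / c) *\<^sub>R (f (X x) :: real) \<partial>L)" for f
        unfolding D_def using c w0 by (subst integral_distr, simp, simp, subst integral_density) auto
    qed
    have ReIm: "Re (\<integral>x. (w x / c) *\<^sub>R iexp (t * X x) \<partial>L) = (\<integral>x. w x * cos (t * X x + 0) \<partial>L) / c"
         "Im (\<integral>x. (w x / c) *\<^sub>R iexp (t * X x) \<partial>L) = (\<integral>x. w x * cos (t * X x + (- pi / 2)) \<partial>L) / c"
      if [measurable]: "X \<in> borel_measurable L" "w \<in> borel_measurable L" and L: "integrable L w" for L t
    proof -
      have i: "integrable L (\<lambda>x. (w x / c) *\<^sub>R iexp (t * X x))"
        by (rule Bochner_Integration.integrable_bound[of _ "\<lambda>x. w x / c"]) (use L in auto)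
      show "Re (\<integral>x. (w x / c) *\<^sub>R iexp (t * X x) \<partial>L) = (\<integral>x. w x * cos (t * X x + 0) \<partial>L) / c"
        using i by (subst integral_Re[symmetric]) (auto simp: Re_exp)
      have "cos (y + (- pi / 2)) = sin y" for y by (simp add: cos_diff)
      then show "Im (\<integral>x. (w x / c) *\<^sub>R iexp (t * X x) \<partial>L) = (\<integral>x. w x * cos (t * X x + (- pi / 2)) \<partial>L) / c"
        using i by (subst integral_Im[symmetric]) (auto simp: Im_exp)
    qed
    have "D M = D N"
    proof (rule Levy_uniqueness)
      show "char (D M) = char (D N)"
      proof
        fix t
        show "char (D M) t = char (D N) t"
        proof -
          have M: "char (D M) t = (\<integral>x. (w x / c) *\<^sub>R iexp (t * X x) \<partial>M)"
            unfolding char_def using iw c_def by (intro D(2)) auto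
          have N: "char (D N) t = (\<integral>x. (w x / c) *\<^sub>R iexp (t * X x) \<partial>N)"
            unfolding char_def using iw cN by (intro D(2)) auto
          show ?thesis
            unfolding M N by (rule complex_eqI) (use iw in \<open>simp_all only: ReIm assms(2,3) measurable_cong_sets[OF sets refl] cos\<close>)
        qed
      qed
    qed (use D(1) iw c_def cN in auto)
    then have "(\<integral>y. indicator B y \<partial>D M) = (\<integral>y. indicator B y \<partial>D N)" by (simp only:)
    then have "(\<integral>x. (w x / c) *\<^sub>R (indicator B (X x) :: real) \<partial>M) = (\<integral>x. (w x / c) *\<^sub>R (indicator B (X x) :: real) \<partial>N)"
      using iw c_def cN by (subst (asm) (1 2) D(3)) auto
    then show ?thesis using c by simp
  qed
qed

section \<open>Uniqueness\<close>

lemma monomial_add: "monomial (\<alpha> + \<beta>) x = monomial \<alpha> x * monomial \<beta> x"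
  by (simp add: monomial_def power_add prod.distrib)

lemma monomial_zero [simp]: "monomial 0 x = 1"
  by (simp add: monomial_def)

lemma monomial_axis [simp]: "monomial (axis i n) x = (x $ i) ^ n"
proof -
  have "monomial (axis i n) x = (\<Prod>j\<in>UNIV. if j = i then (x $ i) ^ n else 1)"
    unfolding monomial_def by (intro prod.cong) (auto simp: axis_def)
  then show ?thesis by simp
qed

lemma axis_add: "axis i (m + n) = axis i m + (axis i n :: nat ^ 'n)"
  by (simp add: vec_eq_iff axis_def)

lemma axis_zero: "axis i 0 = (0 :: nat ^ 'n)"
  by (simp add: vec_eq_iff axis_def)

lemma monomial_continuous [continuous_intros]: "continuous_on S (monomial \<alpha>)"
  unfolding monomial_def[abs_def] by (intro continuous_intros)

lemma monomial_measurable [measurable]: "monomial \<alpha> \<in> borel_measurable borel"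
  by (intro borel_measurable_continuous_onI continuous_intros)

definition has_moments :: "(real ^ 'n::finite) measure \<Rightarrow> (nat ^ 'n \<Rightarrow> real) \<Rightarrow> bool" where
  "has_moments \<mu> \<phi> \<longleftrightarrow> sets \<mu> = sets borel \<and>
    (\<forall>\<alpha>. integrable \<mu> (monomial \<alpha>) \<and> (\<integral>x. monomial \<alpha> x \<partial>\<mu>) = \<phi> \<alpha>)"

lemma has_moments_finite_measure:
  fixes \<mu> :: "(real ^ 'n::finite) measure"
  assumes "has_moments \<mu> \<phi>"
  shows "finite_measure \<mu>"
proof -
  have "integrable \<mu> (monomial 0)" using assms unfolding has_moments_def by blast
  moreover have "(monomial 0 :: real ^ 'n \<Rightarrow> real) = (\<lambda>x. 1)" by (rule ext) simp
  ultimately have "integrable \<mu> (\<lambda>x. 1 :: real)" by simp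
  then show ?thesis by (intro finite_measureI) (simp add: integrable_iff_bounded less_top)
qed

text \<open>Each step of the induction on \<open>J\<close> trades polynomial information in one
  coordinate for an indicator. The claim is kept for all \<open>\<alpha>\<close>, since the next
  coordinate needs equality of all moments weighted by the indicators already present.\<close>

lemma box_moments_eq:
  fixes \<mu> \<nu> :: "(real ^ 'n::finite) measure"
  assumes M: "has_moments \<mu> \<phi>" and N: "has_moments \<nu> \<phi>"
    and carl: "\<And>i. carleman_real (\<lambda>n. \<phi> (axis i n))"
    and B: "\<And>i. B i \<in> sets borel"
    and "finite J"
  shows "(\<integral>x. (\<Prod>i\<in>J. indicator (B i) (x $ i)) * monomial \<alpha> x \<partial>\<mu>)
    = (\<integral>x. (\<Prod>i\<in>J. indicator (B i) (x $ i)) * monomial \<alpha> x \<partial>\<nu>)"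
  using \<open>finite J\<close>
proof (induction J arbitrary: \<alpha>)
  case empty
  then show ?case using M N by (simp add: has_moments_def)
next
  case (insert i J)
  note B[measurable]
  have [measurable_cong]: "sets \<mu> = sets borel" "sets \<nu> = sets borel"
    using M N by (simp_all add: has_moments_def)
  define I where "I x = (\<Prod>i\<in>J. indicator (B i) (x $ i) :: real)" for x :: "real ^ 'n"
  have I01: "0 \<le> I x" "I x \<le> 1" "I x * I x = I x" for x
    unfolding I_def using insert.hyps(1)
    by (auto intro!: prod_nonneg prod_le_1 prod.cong simp: prod.distrib[symmetric] indicator_times_eq_if
        split: split_indicator)
  have [measurable]: "I \<in> borel_measurable borel" unfolding I_def[abs_def] by measurable
  have iI: "integrable L (\<lambda>x. I x * monomial \<beta> x)" if "has_moments L \<phi>" for L \<beta>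
  proof -
    have [measurable_cong]: "sets L = sets borel" using that by (simp add: has_moments_def)
    have "integrable L (\<lambda>x. monomial \<beta> x * I x)"
      using that I01 by (intro integrable_bounded_mult) (auto simp: has_moments_def)
    then show ?thesis by (simp add: mult.commute)
  qed
  \<comment> \<open>Both \<open>w 0\<close> and \<open>w 1\<close> are nonnegative, and their
    difference is the signed weight \<open>I x * monomial \<alpha> x\<close> that is wanted.\<close>
  define w where "w e x = I x * (1 + e * monomial \<alpha> x + (monomial \<alpha> x)\<^sup>2)" for e :: real and x
  have w0: "0 \<le> w e x" if "e \<in> {0, 1}" for e x
  proof -
    have "0 \<le> 1 + e * monomial \<alpha> x + (monomial \<alpha> x)\<^sup>2"
      using that zero_le_power2[of "monomial \<alpha> x + 1 / 2"] by (auto simp: power2_eq_square algebra_simps)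
    then show ?thesis unfolding w_def by (intro mult_nonneg_nonneg I01)
  qed
  have [measurable]: "w e \<in> borel_measurable borel" for e unfolding w_def[abs_def] by measurable
  have wX: "w e x * (x $ i) ^ n = I x * monomial (axis i n) x + e * (I x * monomial (\<alpha> + axis i n) x)
      + I x * monomial (\<alpha> + \<alpha> + axis i n) x" for e x n
    by (simp add: w_def monomial_add power2_eq_square algebra_simps)
  have w2: "(w e x)\<^sup>2 = I x * monomial 0 x + 2 * e * (I x * monomial \<alpha> x) + (2 + e\<^sup>2) * (I x * monomial (\<alpha> + \<alpha>) x)
      + 2 * e * (I x * monomial (\<alpha> + \<alpha> + \<alpha>) x) + I x * monomial (\<alpha> + \<alpha> + \<alpha> + \<alpha>) x" for e x
  proof -
    have "(w e x)\<^sup>2 = (I x * I x) * (1 + e * monomial \<alpha> x + (monomial \<alpha> x)\<^sup>2)\<^sup>2"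
      unfolding w_def by (simp add: power2_eq_square mult_ac)
    then show ?thesis
      unfolding I01(3) by (simp add: monomial_add power2_eq_square algebra_simps)
  qed
  have X: "(x $ i) ^ n = monomial (axis i n) x" for x n by simp
  have eq: "(\<integral>x. w e x * indicator (B i) (x $ i) \<partial>\<mu>) = (\<integral>x. w e x * indicator (B i) (x $ i) \<partial>\<nu>)" if "e \<in> {0, 1}" for e
  proof (rule weighted_distribution_eqI[where m = "\<lambda>n. \<phi> (axis i n)"])
    show "(\<integral>x. w e x * (x $ i) ^ n \<partial>\<mu>) = (\<integral>x. w e x * (x $ i) ^ n \<partial>\<nu>)" for n
      unfolding wX using insert.IH iI[OF M] iI[OF N] by (simp flip: I_def del: monomial_axis)
    show "integrable \<mu> (\<lambda>x. w e x * (x $ i) ^ n)" "integrable \<nu> (\<lambda>x. w e x * (x $ i) ^ n)" for n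
      unfolding wX using iI[OF M] iI[OF N] by (auto simp del: monomial_axis)
  qed (use w0[OF that] iI[OF M] iI[OF N] M N carl in
      \<open>simp_all add: wX w2 X has_moments_def del: monomial_axis monomial_zero\<close>)
  have int: "integrable L (\<lambda>x. w e x * indicator (B i) (x $ i))" if L: "has_moments L \<phi>" for e L
  proof (rule integrable_bounded_mult)
    have [measurable_cong]: "sets L = sets borel" using L by (simp add: has_moments_def)
    show "(\<lambda>x. indicator (B i) (x $ i)) \<in> borel_measurable L" by measurable
    have "w e = (\<lambda>x. w e x * (x $ i) ^ 0)" by simp
    then show "integrable L (w e)"
      unfolding wX using iI[OF L] by (auto simp del: monomial_axis)
  qed (auto split: split_indicator)
  have diff: "(\<Prod>i\<in>insert i J. indicator (B i) (x $ i)) * monomial \<alpha> x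
      = w 1 x * indicator (B i) (x $ i) - w 0 x * indicator (B i) (x $ i)" for x
    using insert.hyps by (simp add: w_def flip: I_def) (simp add: algebra_simps)
  show ?case
    unfolding diff using int[OF M] int[OF N] eq[of 0] eq[of 1] by simp
qed

theorem has_moments_unique:
  fixes \<mu> \<nu> :: "(real ^ 'n::finite) measure"
  assumes M: "has_moments \<mu> \<phi>" and N: "has_moments \<nu> \<phi>"
    and carl: "\<And>i. carleman_real (\<lambda>n. \<phi> (axis i n))"
  shows "\<mu> = \<nu>"
proof -
  interpret M: finite_measure \<mu> using M by (rule has_moments_finite_measure)
  interpret N: finite_measure \<nu> using N by (rule has_moments_finite_measure)
  have [measurable_cong]: "sets \<mu> = sets borel" "sets \<nu> = sets borel"
    using M N by (simp_all add: has_moments_def)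
  define E where "E = range (\<lambda>(a, b). box a (b :: real ^ 'n))"
  have ind: "(\<Prod>i\<in>UNIV. indicator {a $ i<..<b $ i} (x $ i)) * monomial 0 x = indicator (box a b) x" for a b x :: "real ^ 'n"
  proof (cases "x \<in> box a b")
    case True
    then show ?thesis by (simp add: mem_box_cart)
  next
    case False
    then obtain i where "x $ i \<notin> {a $ i<..<b $ i}" by (auto simp: mem_box_cart)
    then have "(\<Prod>i\<in>UNIV. indicator {a $ i<..<b $ i} (x $ i) :: real) = 0"
      by (intro prod_zero bexI[of _ i]) auto
    then show ?thesis using False by simp
  qed
  have box: "measure \<mu> (box a b) = measure \<nu> (box a b)" for a b
    using box_moments_eq[OF M N carl, of "\<lambda>i. {a $ i<..<b $ i}" UNIV 0] unfolding ind by simp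
  show ?thesis
  proof (rule measure_eqI_generator_eq[where E = E and \<Omega> = UNIV and A = "\<lambda>n. box (- (real n *\<^sub>R One)) (real n *\<^sub>R One)"])
    show "Int_stable E" by (auto simp: Int_stable_def E_def box_Int_box)
    show "emeasure \<mu> X = emeasure \<nu> X" if "X \<in> E" for X
      using that box by (auto simp: E_def M.emeasure_eq_measure N.emeasure_eq_measure)
    show "sets \<mu> = sigma_sets UNIV E" "sets \<nu> = sigma_sets UNIV E"
      using \<open>sets \<mu> = _\<close> \<open>sets \<nu> = _\<close> by (simp_all add: borel_eq_box E_def)
    show "(\<Union>n. box (- (real n *\<^sub>R One)) (real n *\<^sub>R One)) = (UNIV :: (real ^ 'n) set)"
      by (rule UN_box_eq_UNIV)
  qed (auto simp: E_def)
qed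

section \<open>The truncated Hamburger problem\<close>

lemma poly_nonneg_right_limit:
  fixes p :: "real poly"
  assumes "\<And>x. x > u \<Longrightarrow> 0 \<le> poly p x"
  shows "0 \<le> poly p u"
proof (rule tendsto_lowerbound)
  show "(poly p \<longlongrightarrow> poly p u) (at_right u)"
    using poly_isCont[of u p] by (auto simp: isCont_def intro: filterlim_mono[OF _ order.refl] at_le)
  show "\<forall>\<^sub>F x in at_right u. 0 \<le> poly p x"
    using assms by (auto simp: eventually_at_filter)
qed simp

lemma poly_nonneg_left_limit:
  fixes p :: "real poly"
  assumes "\<And>x. x < u \<Longrightarrow> 0 \<le> poly p x"
  shows "0 \<le> poly p u"
proof (rule tendsto_lowerbound)
  show "(poly p \<longlongrightarrow> poly p u) (at_left u)"
    using poly_isCont[of u p] by (auto simp: isCont_def intro: filterlim_mono[OF _ order.refl] at_le)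
  show "\<forall>\<^sub>F x in at_left u. 0 \<le> poly p x"
    using assms by (auto simp: eventually_at_filter)
qed simp

text \<open>A complex root \<open>u + i v\<close> splits off the factor
  \<open>(x - u)^2 + v^2\<close>, the cofactor is again nonnegative, and products of sums of two
  squares are sums of two squares.\<close>

theorem nonneg_poly_sum_of_two_squares:
  fixes p :: "real poly"
  assumes "\<And>x. 0 \<le> poly p x"
  shows "\<exists>a b. p = a\<^sup>2 + b\<^sup>2"
  using assms
proof (induction "degree p" arbitrary: p rule: less_induct)
  case less
  show ?case
  proof (cases "degree p = 0")
    case True
    then obtain c where c: "p = [:c:]" by (rule degree_eq_zeroE)
    then have "c \<ge> 0" using less.prems[of 0] by simp
    then have "p = [:sqrt c:]\<^sup>2 + 0\<^sup>2" by (simp add: c power2_eq_square)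
    then show ?thesis by blast
  next
    case False
    define pc where "pc = map_poly complex_of_real p"
    have "degree pc > 0" using False by (simp add: pc_def degree_map_poly)
    then obtain z where z: "poly pc z = 0"
      using alg_closed_imp_poly_has_root[of pc] by blast
    define u v where "u = Re z" and "v = Im z"
    define q where "q = [:u\<^sup>2 + v\<^sup>2, - 2 * u, 1:]"
    have q: "poly q x = (x - u)\<^sup>2 + v\<^sup>2" for x
      by (simp add: q_def power2_eq_square algebra_simps)
    have degq: "degree q = 2" "q \<noteq> 0" by (simp_all add: q_def)
    define d r where "d = p div q" and "r = p mod q"
    have pdr: "p = q * d + r" by (simp add: d_def r_def)
    have "degree r < 2" using degree_mod_less'[of q p] degq by (cases "r = 0") (auto simp: r_def)
    obtain c0 r' where r': "r = pCons c0 r'" by (cases r)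
    with \<open>degree r < 2\<close> have "degree r' = 0" by (cases "r' = 0") auto
    then obtain c1 where "r' = [:c1:]" by (rule degree_eq_zeroE)
    with r' have r: "r = [:c0, c1:]" by simp
    have map: "map_poly complex_of_real (f * g + h) = map_poly complex_of_real f * map_poly complex_of_real g + map_poly complex_of_real h"
      for f g h by (simp add: poly_eq_iff coeff_map_poly coeff_mult)
    have "poly pc z = poly (map_poly complex_of_real q) z * poly (map_poly complex_of_real d) z + poly (map_poly complex_of_real r) z"
      unfolding pc_def poly_mult[symmetric] poly_add[symmetric] by (subst pdr) (simp only: map)
    moreover have "poly (map_poly complex_of_real q) z = 0"
      by (simp add: q_def map_poly_pCons u_def v_def complex_eq_iff power2_eq_square algebra_simps)
    ultimately have "complex_of_real c0 + complex_of_real c1 * z = 0"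
      using z by (simp add: r map_poly_pCons mult.commute)
    then have cz: "c0 + c1 * u = 0" "c1 * v = 0"
      by (simp_all add: complex_eq_iff u_def v_def)
    \<comment> \<open>For a nonreal root the remainder vanishes at once. A real root must be double:
      \<open>p\<close> is \<open>x - u\<close> times a polynomial whose value at \<open>u\<close> is
      \<open>c1\<close>, and nonnegativity of \<open>p\<close> makes that value nonnegative from the
      right and nonpositive from the left.\<close>
    have c1: "c1 = 0"
    proof (cases "v = 0")
      case True
      then have px: "poly p x = (x - u) * poly ([:- u, 1:] * d + [:c1:]) x" for x
      proof -
        have "poly p x = (x - u)\<^sup>2 * poly d x + (c0 + c1 * x)"
          using True q[of x] by (subst pdr) (simp add: r mult.commute)
        moreover have "c0 = - c1 * u" using cz by simp
        ultimately show ?thesis by (simp add: power2_eq_square algebra_simps)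
      qed
      have "0 \<le> poly ([:- u, 1:] * d + [:c1:]) u"
      proof (rule poly_nonneg_right_limit)
        fix x assume "x > u"
        then show "0 \<le> poly ([:- u, 1:] * d + [:c1:]) x"
          using less.prems[of x] unfolding px by (simp add: zero_le_mult_iff)
      qed
      moreover have "0 \<le> poly (- ([:- u, 1:] * d + [:c1:])) u"
      proof (rule poly_nonneg_left_limit)
        fix x assume "x < u"
        then show "0 \<le> poly (- ([:- u, 1:] * d + [:c1:])) x"
          using less.prems[of x] unfolding px poly_minus by (simp only: zero_le_mult_iff) auto
      qed
      ultimately show ?thesis by simp
    qed (use cz in simp)
    then have pqd: "p = q * d" using cz pdr r by simp
    have dpos': "0 \<le> poly d x" if "x \<noteq> u" for x
    proof -
      have "poly q x > 0" using that unfolding q by (simp add: sum_power2_gt_zero_iff)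
      then show ?thesis using less.prems[of x] by (simp add: pqd zero_le_mult_iff)
    qed
    then have dpos: "0 \<le> poly d x" for x
      using poly_nonneg_right_limit[of u d] by (cases "x = u") auto
    have "degree d < degree p"
      using False degq by (cases "d = 0") (auto simp: pqd degree_mult_eq)
    then obtain a b where ab: "d = a\<^sup>2 + b\<^sup>2" using less.hyps dpos by blast
    have "q = [:- u, 1:]\<^sup>2 + [:v:]\<^sup>2" by (simp add: q_def power2_eq_square)
    \<comment> \<open>Multiplicativity of the squared complex modulus, read as a polynomial
      identity.\<close>
    then have "p = ([:- u, 1:] * a - [:v:] * b)\<^sup>2 + ([:- u, 1:] * b + [:v:] * a)\<^sup>2"
      unfolding pqd ab by (simp only: power2_eq_square) (simp only: algebra_simps)
    then show ?thesis by blast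
  qed
qed

definition poly_functional :: "(nat \<Rightarrow> real) \<Rightarrow> real poly \<Rightarrow> real" where
  "poly_functional s p = (\<Sum>k\<le>degree p. coeff p k * s k)"

lemma poly_functional_eq:
  assumes "degree p \<le> N"
  shows "poly_functional s p = (\<Sum>k\<le>N. coeff p k * s k)"
  unfolding poly_functional_def using assms
  by (intro sum.mono_neutral_left) (auto simp: coeff_eq_0)

text \<open>The moment sequences of finite sums of point masses \<open>c j\<close> at
  \<open>t j\<close>. They form a convex cone.\<close>

definition finite_moments :: "(nat \<Rightarrow> real) \<Rightarrow> bool" where
  "finite_moments v \<longleftrightarrow> (\<exists>m t c. (\<forall>j<m. 0 \<le> c j) \<and> v = (\<lambda>n. \<Sum>j<(m::nat). c j * t j ^ n))"

lemma finite_moments_add_atom: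
  assumes "finite_moments v" "0 \<le> a"
  shows "finite_moments (\<lambda>n. v n + a * t ^ n)"
proof -
  obtain m \<tau> c where *: "\<And>j. j < m \<Longrightarrow> 0 \<le> c j" "v = (\<lambda>n. \<Sum>j<(m::nat). c j * \<tau> j ^ n)"
    using assms(1) unfolding finite_moments_def by blast
  show ?thesis
    unfolding finite_moments_def
    by (rule exI[of _ "Suc m"], rule exI[of _ "\<tau>(m := t)"], rule exI[of _ "c(m := a)"])
      (use * assms(2) in \<open>auto simp: less_Suc_eq fun_eq_iff\<close>)
qed

lemma finite_moments_scale:
  assumes "finite_moments v" "0 \<le> a"
  shows "finite_moments (\<lambda>n. a * v n)"
proof -
  obtain m \<tau> c where *: "\<And>j. j < m \<Longrightarrow> 0 \<le> c j" "v = (\<lambda>n. \<Sum>j<(m::nat). c j * \<tau> j ^ n)"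
    using assms(1) unfolding finite_moments_def by blast
  show ?thesis
    unfolding finite_moments_def
    by (rule exI[of _ m], rule exI[of _ \<tau>], rule exI[of _ "\<lambda>j. a * c j"])
      (use * assms(2) in \<open>auto simp: fun_eq_iff sum_distrib_left mult.assoc\<close>)
qed

text \<open>Finitely supported measures come close to the least squares distance from \<open>s\<close>. A near minimiser
  \<open>v\<close> is tested against perturbations by the atoms \<open>\<delta> / (1 + t ^ K)\<close> and by \<open>- \<delta> v\<close>: the former turn
  the residual \<open>s - v\<close> into an almost nonnegative polynomial. The atoms are normalised because the
  moment curve is unbounded.\<close>
theorem truncated_hamburger:
  fixes s :: "nat \<Rightarrow> real"
  assumes pos: "\<And>p. (\<And>x. 0 \<le> poly p x) \<Longrightarrow> 0 \<le> poly_functional s p" and "0 < \<eta>"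
  shows "\<exists>v. finite_moments v \<and> (\<forall>n\<le>N. \<bar>v n - s n\<bar> \<le> \<eta>)"
proof -
  \<comment> \<open>An even order, so that \<open>1 + t ^ K\<close> is positive and dominates every
    \<open>\<bar>t\<bar> ^ n\<close> with \<open>n \<le> K\<close>.\<close>
  define K where "K = 2 * N"
  define Q where "Q v = (\<Sum>n\<le>K. (s n - v n)\<^sup>2)" for v
  define D where "D = Q ` {v. finite_moments v}"
  have "finite_moments (\<lambda>n. 0)"
    unfolding finite_moments_def by (intro exI[of _ 0]) auto
  then have D: "D \<noteq> {}" "bdd_below D" by (auto simp: D_def Q_def intro!: bdd_belowI[of _ 0] sum_nonneg)
  define d where "d = Inf D"
  have dle: "d \<le> Q v" if "finite_moments v" for v
    using that D unfolding d_def by (intro cInf_lower) (auto simp: D_def)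
  define S where "S = (\<Sum>n\<le>K. (s n)\<^sup>2)"
  define A where "A = (real K + 2) / 2 * (s 0 + s K) + (1 + 2 * S + 2 * (d + 1)) / 2"
  have small: "d \<le> \<delta> * A" if \<delta>: "0 < \<delta>" "\<delta> \<le> 1" for \<delta>
  proof -
    \<comment> \<open>The slack is quadratic, so that dividing by the size \<open>\<delta>\<close>
      of the perturbation leaves an error of order \<open>\<delta>\<close>.\<close>
    have "Inf D < d + \<delta>\<^sup>2" using \<delta> by (simp add: d_def)
    then obtain v where v: "finite_moments v" "Q v < d + \<delta>\<^sup>2"
      using cInf_lessD[OF D(1)] by (auto simp: D_def)
    define w where "w n = s n - v n" for n
    have Qw: "Q v = (\<Sum>n\<le>K. (w n)\<^sup>2)" by (simp add: Q_def w_def)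
    have atom: "(\<Sum>n\<le>K. w n * t ^ n) \<le> \<delta> * (real K + 2) / 2 * (1 + t ^ K)" for t
    proof -
      have tK: "1 + t ^ K > 0" by (simp add: K_def power_mult add_pos_nonneg)
      define u where "u n = t ^ n / (1 + t ^ K)" for n
      have u1: "(u n)\<^sup>2 \<le> 1" if "n \<le> K" for n
      proof -
        have "\<bar>t\<bar> ^ n \<le> 1 + \<bar>t\<bar> ^ K"
        proof (cases "\<bar>t\<bar> \<le> 1")
          case True
          then have "\<bar>t\<bar> ^ n \<le> 1" by (intro power_le_one) auto
          moreover have "0 \<le> \<bar>t\<bar> ^ K" by simp
          ultimately show ?thesis by linarith
        next
          case False
          then have "\<bar>t\<bar> ^ n \<le> \<bar>t\<bar> ^ K" using that by (intro power_increasing) auto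
          then show ?thesis by linarith
        qed
        moreover have "\<bar>t\<bar> ^ K = t ^ K" by (simp add: K_def power_mult)
        ultimately have "\<bar>u n\<bar> \<le> 1" using tK by (simp add: u_def power_abs)
        then show ?thesis by (simp add: abs_square_le_1)
      qed
      have "d \<le> Q (\<lambda>n. v n + \<delta> / (1 + t ^ K) * t ^ n)"
        using \<delta> tK by (intro dle finite_moments_add_atom v) simp
      also have "\<dots> = (\<Sum>n\<le>K. (w n)\<^sup>2 - 2 * \<delta> * (w n * u n) + \<delta>\<^sup>2 * (u n)\<^sup>2)"
        unfolding Q_def
      proof (intro sum.cong refl)
        fix n
        have *: "s n - (v n + \<delta> / (1 + t ^ K) * t ^ n) = w n - \<delta> * u n" by (simp add: w_def u_def)
        show "(s n - (v n + \<delta> / (1 + t ^ K) * t ^ n))\<^sup>2 = (w n)\<^sup>2 - 2 * \<delta> * (w n * u n) + \<delta>\<^sup>2 * (u n)\<^sup>2"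
          unfolding * by (simp add: power2_eq_square algebra_simps)
      qed
      also have "\<dots> = Q v - 2 * \<delta> * (\<Sum>n\<le>K. w n * u n) + \<delta>\<^sup>2 * (\<Sum>n\<le>K. (u n)\<^sup>2)"
        by (simp add: Qw sum.distrib sum_subtractf sum_distrib_left)
      also have "\<dots> \<le> (d + \<delta>\<^sup>2) - 2 * \<delta> * (\<Sum>n\<le>K. w n * u n) + \<delta>\<^sup>2 * (\<Sum>n\<le>K. 1)"
        using v(2) u1 by (intro add_mono diff_right_mono mult_left_mono sum_mono) auto
      finally have "\<delta> * (2 * (\<Sum>n\<le>K. w n * u n)) \<le> \<delta> * (\<delta> * (real K + 2))"
        by (simp add: power2_eq_square algebra_simps)
      then have "2 * (\<Sum>n\<le>K. w n * u n) \<le> \<delta> * (real K + 2)"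
        using \<delta> by (simp only: mult_le_cancel_left_pos)
      moreover have "(\<Sum>n\<le>K. w n * u n) = (\<Sum>n\<le>K. w n * t ^ n) / (1 + t ^ K)"
        by (simp add: u_def sum_divide_distrib)
      ultimately have "2 * ((\<Sum>n\<le>K. w n * t ^ n) / (1 + t ^ K)) \<le> \<delta> * (real K + 2)" by simp
      then show ?thesis using tK by (simp add: field_simps)
    qed
    define \<epsilon> where "\<epsilon> = \<delta> * (real K + 2) / 2"
    \<comment> \<open>Nonnegativity of \<open>p\<close> is the bound \<open>atom\<close>; applying
      the positive functional bounds the inner product of the residual \<open>w\<close> with
      \<open>s\<close>. For \<open>K = 0\<close> both \<open>\<epsilon>\<close> terms fall on the
      same coefficient.\<close>
    define p where "p = [:\<epsilon>:] + monom \<epsilon> K - (\<Sum>n\<le>K. monom (w n) n)"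
    have "0 \<le> poly p x" for x
      using atom[of x] by (simp add: p_def poly_sum poly_monom \<epsilon>_def distrib_left)
    then have "0 \<le> poly_functional s p" by (rule pos)
    also have "degree p \<le> K"
      unfolding p_def
      by (intro degree_diff_le degree_add_le degree_sum_le) (auto intro: order.trans[OF degree_monom_le])
    then have "poly_functional s p = (\<Sum>n\<le>K. coeff p n * s n)" by (rule poly_functional_eq)
    also have "\<dots> = (\<Sum>n\<le>K. ((if n = 0 then \<epsilon> else 0) + (if n = K then \<epsilon> else 0) - w n) * s n)"
    proof (intro sum.cong refl)
      fix n assume "n \<in> {..K}"
      then have "coeff (\<Sum>n\<le>K. monom (w n) n) n = w n" by (simp add: coeff_sum)
      then show "coeff p n * s n = ((if n = 0 then \<epsilon> else 0) + (if n = K then \<epsilon> else 0) - w n) * s n"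
        by (auto simp: p_def coeff_pCons split: nat.split)
    qed
    also have "\<dots> = \<epsilon> * (s 0 + s K) - (\<Sum>n\<le>K. w n * s n)"
      by (simp add: distrib_right distrib_left left_diff_distrib sum.distrib sum_subtractf
          if_distrib[of "\<lambda>x. x * _"] cong: if_cong)
    finally have ws: "(\<Sum>n\<le>K. w n * s n) \<le> \<epsilon> * (s 0 + s K)" by simp
    define V where "V = (\<Sum>n\<le>K. (v n)\<^sup>2)"
    \<comment> \<open>Moving towards the apex of the cone bounds the inner product of
      \<open>w\<close> with \<open>v\<close> from below.\<close>
    have "d \<le> Q (\<lambda>n. (1 - \<delta>) * v n)"
      using \<delta> by (intro dle finite_moments_scale v) simp
    also have "\<dots> = (\<Sum>n\<le>K. (w n)\<^sup>2 + 2 * \<delta> * (w n * v n) + \<delta>\<^sup>2 * (v n)\<^sup>2)"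
      unfolding Q_def by (intro sum.cong) (auto simp: w_def power2_eq_square algebra_simps)
    also have "\<dots> = Q v + 2 * \<delta> * (\<Sum>n\<le>K. w n * v n) + \<delta>\<^sup>2 * V"
      by (simp add: Qw V_def sum.distrib sum_distrib_left)
    finally have "d \<le> (d + \<delta>\<^sup>2) + 2 * \<delta> * (\<Sum>n\<le>K. w n * v n) + \<delta>\<^sup>2 * V" using v(2) by linarith
    then have "\<delta> * (- 2 * (\<Sum>n\<le>K. w n * v n)) \<le> \<delta> * (\<delta> * (1 + V))"
      by (simp add: power2_eq_square algebra_simps)
    then have wv: "- 2 * (\<Sum>n\<le>K. w n * v n) \<le> \<delta> * (1 + V)"
      using \<delta> by (simp only: mult_le_cancel_left_pos)
    have "V \<le> (\<Sum>n\<le>K. 2 * (s n)\<^sup>2 + 2 * (w n)\<^sup>2)"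
      unfolding V_def
    proof (rule sum_mono)
      fix n
      have "0 \<le> (s n + w n)\<^sup>2" by simp
      then show "(v n)\<^sup>2 \<le> 2 * (s n)\<^sup>2 + 2 * (w n)\<^sup>2"
        by (simp add: w_def power2_eq_square algebra_simps)
    qed
    also have "\<dots> = 2 * S + 2 * Q v" by (simp add: S_def Qw sum.distrib sum_distrib_left)
    also have "\<dots> \<le> 2 * S + 2 * (d + 1)" using v(2) power_le_one[of \<delta> 2] \<delta> by simp
    finally have "\<delta> * (1 + V) \<le> \<delta> * (1 + 2 * S + 2 * (d + 1))" using \<delta> by simp
    with wv have wv: "- (\<Sum>n\<le>K. w n * v n) \<le> \<delta> * ((1 + 2 * S + 2 * (d + 1)) / 2)" by simp
    have "d \<le> Q v" by (rule dle[OF v(1)])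
    \<comment> \<open>The squared distance is the inner product of \<open>w\<close> with
      \<open>s - v\<close>; both parts have been bounded by multiples of
      \<open>\<delta>\<close>.\<close>
    also have "Q v = (\<Sum>n\<le>K. w n * s n) - (\<Sum>n\<le>K. w n * v n)"
      by (simp add: Qw sum_subtractf[symmetric] w_def power2_eq_square algebra_simps)
    also have "\<dots> \<le> \<epsilon> * (s 0 + s K) + \<delta> * ((1 + 2 * S + 2 * (d + 1)) / 2)"
      using ws wv by linarith
    also have "\<dots> = \<delta> * A" by (simp add: A_def \<epsilon>_def algebra_simps)
    finally show ?thesis .
  qed
  have "((\<lambda>\<delta>. \<delta> * A) \<longlongrightarrow> 0 * A) (at_right 0)"
    by (intro tendsto_intros)
  moreover have "\<forall>\<^sub>F \<delta> in at_right 0. d \<le> \<delta> * A"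
    using small by (intro eventually_at_rightI[of 0 1]) auto
  ultimately have "d \<le> 0"
    using tendsto_lowerbound[of "\<lambda>\<delta>. \<delta> * A" "0 * A" "at_right 0" d] by simp
  moreover have "0 < \<eta>\<^sup>2" using \<open>0 < \<eta>\<close> by simp
  ultimately have "Inf D < \<eta>\<^sup>2" unfolding d_def by linarith
  then obtain v where v: "finite_moments v" "Q v < \<eta>\<^sup>2"
    using cInf_lessD[OF D(1)] by (auto simp: D_def)
  have "\<bar>v n - s n\<bar> \<le> \<eta>" if "n \<le> N" for n
  proof -
    have "(s n - v n)\<^sup>2 \<le> Q v"
      unfolding Q_def using that by (intro member_le_sum) (auto simp: K_def)
    then have "\<bar>s n - v n\<bar> \<le> \<eta>" using v(2) \<open>0 < \<eta>\<close>
      by (metis abs_le_square_iff abs_of_pos less_le_not_le order.trans linear)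
    then show ?thesis by (simp add: abs_minus_commute)
  qed
  then show ?thesis using v(1) by blast
qed

section \<open>A proper space-filling curve\<close>

text \<open>The triangle wave of period 2 with \<open>tri t = t\<close> on \<open>{0..1}\<close>.\<close>
definition tri :: "real \<Rightarrow> real" where
  "tri t = arccos (cos (pi * t)) / pi"

lemma tri_continuous [continuous_intros]:
  fixes f :: "real \<Rightarrow> real"
  shows "continuous_on S f \<Longrightarrow> continuous_on S (\<lambda>x. tri (f x))"
  unfolding tri_def by (auto intro!: continuous_intros)

lemma tri_shift: "0 \<le> x \<Longrightarrow> x \<le> 1 \<Longrightarrow> tri (2 * of_int k + x) = x"
proof -
  assume x: "0 \<le> x" "x \<le> 1"
  have "cos (pi * (2 * of_int k + x)) = cos (pi * x)"
    using cos_int_2pin[of k] sin_int_2pin[of k]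
    by (simp add: cos_add distrib_left mult_ac)
  then show ?thesis using x arccos_cos[of "pi * x"] by (simp add: tri_def)
qed

text \<open>Schoenberg's plateau function reads off a ternary digit: it is \<open>0\<close> resp. \<open>1\<close> on arguments whose
  first ternary digit (modulo even integers) is \<open>0\<close> resp. \<open>2\<close>.\<close>
definition plateau :: "real \<Rightarrow> real" where
  "plateau t = max 0 (min 1 (3 * tri t - 1))"

lemma plateau_continuous [continuous_intros]:
  fixes f :: "real \<Rightarrow> real"
  shows "continuous_on S f \<Longrightarrow> continuous_on S (\<lambda>x. plateau (f x))"
  unfolding plateau_def by (intro continuous_intros)

lemma plateau_bounds: "0 \<le> plateau t" "plateau t \<le> 1"
  by (auto simp: plateau_def)

lemma plateau_digit:
  assumes "b \<in> {0, 1}" "0 \<le> r" "r \<le> 1 / 3"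
  shows "plateau (2 * of_int k + (2 / 3 * b + r)) = b"
proof -
  have "tri (2 * of_int k + (2 / 3 * b + r)) = 2 / 3 * b + r"
    using assms by (intro tri_shift) auto
  then show ?thesis using assms by (auto simp: plateau_def)
qed

text \<open>On suitable \<open>t\<close> the ternary digit in position \<open>e i k\<close> supplies
  the \<open>k\<close>-th binary digit of coordinate \<open>i\<close>. For injective
  \<open>e\<close> all these digits can be prescribed independently.\<close>

definition schoenberg :: "('n \<Rightarrow> nat \<Rightarrow> nat) \<Rightarrow> real \<Rightarrow> real ^ 'n" where
  "schoenberg e t = (\<chi> i. suminf (\<lambda>k. plateau (3 ^ e i k * t) / 2 ^ Suc k))"

lemma schoenberg_continuous:
  fixes e :: "'n::finite \<Rightarrow> nat \<Rightarrow> nat"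
  shows "continuous_on UNIV (schoenberg e)"
  unfolding schoenberg_def[abs_def]
proof (intro continuous_on_vec_lambda)
  fix i :: 'n
  have "uniform_limit UNIV (\<lambda>n t. \<Sum>k<n. plateau (3 ^ e i k * t) / 2 ^ Suc k)
      (\<lambda>t. suminf (\<lambda>k. plateau (3 ^ e i k * t) / 2 ^ Suc k)) sequentially"
  proof (rule Weierstrass_m_test[where M = "\<lambda>k. (1 / 2) ^ Suc k"])
    show "summable (\<lambda>k. (1 / 2 :: real) ^ Suc k)" by (rule sums_summable[OF power_half_series])
  qed (auto simp: plateau_bounds abs_of_nonneg power_one_over divide_simps)
  then show "continuous_on UNIV (\<lambda>t. suminf (\<lambda>k. plateau (3 ^ e i k * t) / 2 ^ Suc k))"
    by (rule uniform_limit_theorem[rotated]) (auto intro!: always_eventually continuous_intros)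
qed

lemma binary_expansion:
  fixes x :: real
  assumes "0 \<le> x" "x \<le> 1"
  shows "\<exists>b. (\<forall>k. b k \<in> {0, 1}) \<and> (\<lambda>k. b k / 2 ^ Suc k) sums x"
proof (cases "x = 1")
  case True
  have "(\<lambda>k. (1 / 2) ^ Suc k) sums (1 :: real)" by (rule power_half_series)
  then show ?thesis using True by (intro exI[of _ "\<lambda>_. 1"]) (simp add: power_one_over divide_simps)
next
  case False
  define y where "y n = (of_int \<lfloor>2 ^ n * x\<rfloor> / 2 ^ n :: real)" for n
  define b where "b k = (of_int (\<lfloor>2 ^ Suc k * x\<rfloor> - 2 * \<lfloor>2 ^ k * x\<rfloor>) :: real)" for k
  have b01: "b k \<in> {0, 1}" for k
  proof -
    have "2 * \<lfloor>2 ^ k * x\<rfloor> \<le> \<lfloor>2 ^ Suc k * x\<rfloor>" "\<lfloor>2 ^ Suc k * x\<rfloor> < 2 * \<lfloor>2 ^ k * x\<rfloor> + 2"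
      by (simp; linarith)+
    then have "\<lfloor>2 ^ Suc k * x\<rfloor> - 2 * \<lfloor>2 ^ k * x\<rfloor> \<in> {0, 1}" by force
    then show ?thesis unfolding b_def by force
  qed
  have sum: "(\<Sum>k<n. b k / 2 ^ Suc k) = y n" for n
  proof (induction n)
    case 0
    have "\<lfloor>x\<rfloor> = 0" using assms False by (simp add: floor_eq_iff)
    then show ?case by (simp add: y_def)
  next
    case (Suc n)
    then show ?case by (simp add: y_def b_def field_simps)
  qed
  have "(\<lambda>n. y n - x) \<longlonglongrightarrow> 0"
  proof (rule Lim_null_comparison[of _ "\<lambda>n. (1 / 2) ^ n"])
    have "norm (y n - x) \<le> (1 / 2) ^ n" for n
    proof -
      have "y n - x = (of_int \<lfloor>2 ^ n * x\<rfloor> - 2 ^ n * x) / 2 ^ n" by (simp add: y_def field_simps)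
      then have "norm (y n - x) = \<bar>of_int \<lfloor>2 ^ n * x\<rfloor> - 2 ^ n * x\<bar> / 2 ^ n" by simp
      also have "\<dots> \<le> 1 / 2 ^ n" by (intro divide_right_mono; (simp; fail)?) linarith
      finally show ?thesis by (simp add: power_one_over)
    qed
    then show "\<forall>\<^sub>F n in sequentially. norm (y n - x) \<le> (1 / 2) ^ n" by simp
  qed (auto intro: LIMSEQ_power_zero)
  then have "y \<longlonglongrightarrow> x" by (rule LIM_zero_cancel)
  then have "(\<lambda>k. b k / 2 ^ Suc k) sums x" unfolding sums_def sum .
  with b01 show ?thesis by blast
qed

text \<open>Take \<open>t\<close> with ternary digits \<open>2 * a j\<close>. Multiplication by
  \<open>3 ^ j\<close> moves the earlier digits into an even integer, which the period of the wave
  removes; digit \<open>j\<close> then leads and the later ones add at most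
  \<open>1 / 3\<close>.\<close>

lemma ternary_digits:
  fixes a :: "nat \<Rightarrow> real"
  assumes a: "\<And>j. a j \<in> {0, 1}"
  shows "\<exists>t. 0 \<le> t \<and> t \<le> 1 \<and> (\<forall>j. plateau (3 ^ j * (2 * of_int k + t)) = a j)"
proof -
  define g where "g j = 2 * a j / 3 ^ Suc j" for j
  have a01: "0 \<le> a j" "a j \<le> 1" for j using a[of j] by auto
  have le: "g j \<le> 2 / 3 * (1 / 3) ^ j" and g0: "0 \<le> g j" for j
    using a01[of j] by (auto simp: g_def power_one_over divide_simps)
  have geo: "(\<lambda>j. 2 / 3 * (1 / 3 :: real) ^ j) sums (2 / 3 * (1 / (1 - 1 / 3)))"
    by (intro sums_mult geometric_sums) auto
  have sg: "summable g"
    by (rule summable_comparison_test[OF _ sums_summable[OF geo]]) (use le g0 in auto)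
  define t where "t = suminf g"
  have tail: "0 \<le> (suminf (\<lambda>i. g (i + j)))" "(suminf (\<lambda>i. g (i + j))) \<le> 1 / 3 ^ j" for j
  proof -
    have s: "summable (\<lambda>i. g (i + j))" using sg by (simp add: summable_iff_shift)
    then show "0 \<le> (suminf (\<lambda>i. g (i + j)))" by (intro suminf_nonneg g0)
    have "(suminf (\<lambda>i. g (i + j))) \<le> (suminf (\<lambda>i. (1 / 3) ^ j * (2 / 3 * (1 / 3 :: real) ^ i)))"
      using le[of "_ + j"] by (intro suminf_le s summable_mult sums_summable[OF geo]) (simp add: power_add mult_ac)
    also have "\<dots> = (1 / 3) ^ j * (2 / 3 * (1 / (1 - 1 / 3)))"
      by (intro sums_unique[symmetric] sums_mult geo)
    finally show "(suminf (\<lambda>i. g (i + j))) \<le> 1 / 3 ^ j" by (simp add: power_one_over)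
  qed
  have "plateau (3 ^ j * (2 * of_int k + t)) = a j" for j
  proof -
    have "3 ^ j * (\<Sum>i<j. g i) \<in> range (\<lambda>i::int. 2 * of_int i)"
    proof -
      have "3 ^ j * g i = 2 * (a i * 3 ^ (j - Suc i))" if "i < j" for i
      proof -
        have "(3::real) ^ j = 3 ^ Suc i * 3 ^ (j - Suc i)"
          using that by (simp add: power_add[symmetric] del: power_Suc)
        then show ?thesis by (simp add: g_def)
      qed
      then have "3 ^ j * (\<Sum>i<j. g i) = 2 * (\<Sum>i<j. a i * 3 ^ (j - Suc i))"
        by (simp add: sum_distrib_left)
      moreover have "(\<Sum>i<j. a i * 3 ^ (j - Suc i)) \<in> \<int>"
      proof (intro Ints_sum Ints_mult Ints_power)
        show "a i \<in> \<int>" for i using a[of i] by auto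
      qed auto
      ultimately show ?thesis by (auto elim!: Ints_cases)
    qed
    then obtain l :: int where l: "3 ^ j * (\<Sum>i<j. g i) = 2 * of_int l" by auto
    have "t = (\<Sum>i<j. g i) + (g j + (suminf (\<lambda>i. g (i + Suc j))))"
      unfolding t_def using suminf_split_initial_segment[OF sg, of "Suc j"] by simp
    then have "3 ^ j * t = 2 * of_int l + (2 / 3 * a j + 3 ^ j * (suminf (\<lambda>i. g (i + Suc j))))"
      by (simp add: distrib_left l) (simp add: g_def)
    then have eq: "3 ^ j * (2 * of_int k + t) = 2 * of_int (3 ^ j * k + l) + (2 / 3 * a j + 3 ^ j * (suminf (\<lambda>i. g (i + Suc j))))"
      by (simp add: algebra_simps)
    have "3 ^ j * (suminf (\<lambda>i. g (i + Suc j))) \<le> 3 ^ j * (1 / 3 ^ Suc j)"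
      by (intro mult_left_mono tail) auto
    then have "3 ^ j * (suminf (\<lambda>i. g (i + Suc j))) \<le> 1 / 3" by simp
    then show ?thesis
      unfolding eq using tail(1)[of "Suc j"] by (intro plateau_digit a mult_nonneg_nonneg) auto
  qed
  moreover have "0 \<le> t" "t \<le> 1" using tail[of 0] by (simp_all add: t_def)
  ultimately show ?thesis by blast
qed

lemma schoenberg_surj:
  fixes x :: "real ^ 'n::finite"
  assumes x: "\<And>i. 0 \<le> x $ i" "\<And>i. x $ i \<le> 1"
    and inj: "inj (\<lambda>(i, k). e i k)"
  shows "\<exists>t. 0 \<le> t \<and> t \<le> 1 \<and> schoenberg e (2 * of_int k + t) = x"
proof -
  have "\<forall>i. \<exists>b. (\<forall>k. b k \<in> {0, 1}) \<and> (\<lambda>k. b k / 2 ^ Suc k) sums (x $ i)"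
    using x binary_expansion by blast
  then obtain b where b: "\<And>i k. b i k \<in> {0, 1}" "\<And>i. (\<lambda>k. b i k / 2 ^ Suc k) sums (x $ i)"
    by metis
  define a where "a j = (if j \<in> range (\<lambda>(i, k). e i k) then (\<lambda>(i, k). b i k) (inv (\<lambda>(i, k). e i k) j) else 0)" for j
  have a: "a j \<in> {0, 1}" for j using b by (auto simp: a_def split: prod.splits)
  have ae: "a (e i k) = b i k" for i k
    using inv_f_f[OF inj, of "(i, k)"] by (auto simp: a_def)
  obtain t where t: "0 \<le> t" "t \<le> 1" "\<And>j. plateau (3 ^ j * (2 * of_int k + t)) = a j"
    using ternary_digits[of a k] a by blast
  have "schoenberg e (2 * of_int k + t) = x"
    unfolding schoenberg_def t(3) ae by (simp add: vec_eq_iff sums_unique[OF b(2), symmetric] del: power_Suc)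
  then show ?thesis using t by blast
qed

text \<open>On \<open>{2 k..2 k + 1}\<close> the scale factor \<open>t - tri t\<close> is the constant \<open>2 k\<close>, so that this interval
  is mapped onto the cube of half side \<open>2 k\<close>.\<close>
lemma proper_space_filling_curve:
  "\<exists>G :: real \<Rightarrow> real ^ 'n::finite. continuous_on UNIV G \<and>
    (\<forall>x. \<exists>t. \<bar>t\<bar> \<le> norm x + 3 \<and> G t = x)"
proof -
  define e where "e i k = to_nat (i :: 'n, k :: nat)" for i k
  have e: "inj (\<lambda>(i, k). e i k)" by (auto simp: inj_def e_def)
  \<comment> \<open>Here \<open>1\<close> is the all-ones vector: the unit cube is recentred to the
    cube with half side 1 before scaling.\<close>
  define G where "G t = (t - tri t) *\<^sub>R (2 *\<^sub>R schoenberg e t - 1)" for t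
  have "continuous_on UNIV G"
    unfolding G_def[abs_def] by (intro continuous_intros schoenberg_continuous)
  moreover have "\<exists>t. \<bar>t\<bar> \<le> norm x + 3 \<and> G t = x" for x :: "real ^ 'n"
  proof -
    obtain f :: int where f: "of_int f \<le> norm x / 2" "norm x / 2 < of_int (f + 1)"
      using floor_exists by blast
    \<comment> \<open>The cube of half side \<open>2 * k\<close> contains \<open>x\<close>, yet
      \<open>2 * k\<close> exceeds the norm by at most 2; the parameter adds at most 1, which gives
      the constant 3.\<close>
    define k where "k = f + 1"
    have k: "norm x \<le> 2 * of_int k" "2 * of_int k \<le> norm x + 2"
      using f by (simp_all add: k_def)
    have "0 < real_of_int k" using f norm_ge_zero[of x] unfolding k_def by linarith
    with k have k: "norm x \<le> 2 * of_int k" "2 * of_int k \<le> norm x + 2" "k > 0" by simp_all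
    define y where "y = (\<chi> i. (x $ i / (2 * of_int k) + 1) / 2)"
    have "\<bar>x $ i\<bar> \<le> 2 * of_int k" for i using component_le_norm_cart[of x i] k(1) by linarith
    then have "0 \<le> y $ i" "y $ i \<le> 1" for i
      using k(3) by (simp_all add: y_def abs_le_iff divide_simps) (smt (verit))+
    then obtain t where t: "0 \<le> t" "t \<le> 1" "schoenberg e (2 * of_int k + t) = y"
      using schoenberg_surj[OF _ _ e, of y k] by blast
    have "G (2 * of_int k + t) = (2 * of_int k) *\<^sub>R (2 *\<^sub>R y - 1)"
      unfolding G_def t(3) using t by (simp add: tri_shift)
    also have "\<dots> = x" using k(3) by (simp add: vec_eq_iff y_def) (simp add: field_simps)
    finally have "G (2 * of_int k + t) = x" .
    moreover have "\<bar>2 * of_int k + t\<bar> \<le> norm x + 3" using k t by simp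
    ultimately show ?thesis by blast
  qed
  ultimately show ?thesis by blast
qed

section \<open>Limits of moments\<close>

text \<open>Bounded second moments give uniform integrability: cutting \<open>f\<close> off at
  height \<open>k\<close> changes every integral by at most \<open>C / k\<close>.\<close>

lemma weak_convergence_unbounded:
  fixes Q :: "nat \<Rightarrow> real measure" and f :: "real \<Rightarrow> real"
  assumes Q: "\<And>n. real_distribution (Q n)" and M: "real_distribution M" and conv: "weak_conv_m Q M"
    and f: "continuous_on UNIV f"
    and int: "\<And>n. integrable (Q n) f" "\<And>n. integrable (Q n) (\<lambda>x. (f x)\<^sup>2)"
    and C: "\<And>n. (\<integral>x. (f x)\<^sup>2 \<partial>Q n) \<le> C"
  shows "integrable M f" and "(\<lambda>n. \<integral>x. f x \<partial>Q n) \<longlonglongrightarrow> (\<integral>x. f x \<partial>M)"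
proof -
  interpret M: real_distribution M by (rule M)
  interpret Q: real_distribution "Q n" for n by (rule Q)
  have [measurable]: "f \<in> borel_measurable borel" using f by (rule borel_measurable_continuous_onI)
  have cont: "isCont f x" for x using f by (simp add: continuous_on_eq_continuous_at)
  have lim: "(\<lambda>n. \<integral>x. g x \<partial>Q n) \<longlonglongrightarrow> (\<integral>x. g x \<partial>M)"
    if "\<And>x. isCont g x" "\<And>x. \<bar>g x\<bar> \<le> K" for g :: "real \<Rightarrow> real" and K
    using that by (intro weak_conv_imp_integral_bdd_continuous_conv[OF Q M conv, where B = K]) auto
  \<comment> \<open>Weak convergence transfers the bound \<open>C\<close> to the truncated squares;
    monotone convergence then removes the truncation for \<open>M\<close>.\<close>
  define h where "h k x = min ((f x)\<^sup>2) (real k)" for k x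
  have [measurable]: "h k \<in> borel_measurable borel" for k unfolding h_def[abs_def] by measurable
  have h_int: "integrable L (h k)" if "real_distribution L" for k L
  proof -
    interpret real_distribution L by (rule that)
    show ?thesis by (rule integrable_const_bound[of _ "real k"]) (auto simp: h_def)
  qed
  have h_le: "(\<integral>x. h k x \<partial>M) \<le> C" for k
  proof (rule LIMSEQ_le_const2[OF lim])
    show "isCont (h k) x" for x unfolding h_def[abs_def] by (intro continuous_intros cont)
    show "\<bar>h k x\<bar> \<le> real k" for x by (simp add: h_def)
    have "(\<integral>x. h k x \<partial>Q n) \<le> C" for n
      by (rule order.trans[OF integral_mono C[of n]]) (use h_int[OF Q] int in \<open>auto simp: h_def\<close>)
    then show "\<exists>N. \<forall>n\<ge>N. (\<integral>x. h k x \<partial>Q n) \<le> C" by blast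
  qed
  have "incseq (\<lambda>k. \<integral>x. h k x \<partial>M)"
    by (intro incseq_SucI integral_mono h_int[OF M]) (auto simp: h_def)
  then obtain L where L: "(\<lambda>k. \<integral>x. h k x \<partial>M) \<longlonglongrightarrow> L"
    using incseq_convergent[of _ C] h_le by blast
  have hlim: "(\<lambda>k. h k x) \<longlonglongrightarrow> (f x)\<^sup>2" for x
  proof (rule tendsto_eventually)
    obtain K where "(f x)\<^sup>2 \<le> real K" using real_arch_simple by blast
    then have "h k x = (f x)\<^sup>2" if "k \<ge> K" for k
      using that unfolding h_def by (intro min_absorb1) (meson of_nat_mono order.trans)
    then show "\<forall>\<^sub>F k in sequentially. h k x = (f x)\<^sup>2" by (auto simp: eventually_sequentially)
  qed
  have f2: "integrable M (\<lambda>x. (f x)\<^sup>2)" "(\<integral>x. (f x)\<^sup>2 \<partial>M) = L"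
    by (rule integral_monotone_convergence_nonneg[OF h_int[OF M] _ _ _ L];
      use hlim in \<open>auto simp: h_def incseq_def min_def\<close>)+
  have LC: "L \<le> C" using LIMSEQ_le_const2[OF L] h_le by blast
  show fM: "integrable M f"
  proof (rule Bochner_Integration.integrable_bound)
    show "integrable M (\<lambda>x. 1 + (f x)\<^sup>2)" using f2 by simp
    have "\<bar>f x\<bar> \<le> 1 + (f x)\<^sup>2" for x
      using zero_le_power2[of "\<bar>f x\<bar> - 1"] by (simp add: power2_eq_square algebra_simps abs_mult_self_eq)
    then show "AE x in M. norm (f x) \<le> norm (1 + (f x)\<^sup>2)"
      by (intro always_eventually allI) (auto simp: abs_of_nonneg)
  qed simp
  have C0: "0 \<le> C" using order.trans[OF integral_nonneg_AE C[of 0]] by simp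
  define T where "T k x = max (- k) (min k (f x))" for k x
  have [measurable]: "T k \<in> borel_measurable borel" for k unfolding T_def[abs_def] by measurable
  have T_int: "integrable L (T k)" if "real_distribution L" "k > 0" for k L
  proof -
    interpret real_distribution L by (rule that)
    show ?thesis by (rule integrable_const_bound[of _ k]) (use that in \<open>auto simp: T_def abs_le_iff\<close>)
  qed
  have Tf: "\<bar>(\<integral>x. f x \<partial>P) - (\<integral>x. T k x \<partial>P)\<bar> \<le> C / k"
    if P: "real_distribution P" and k: "k > 0" and iP: "integrable P f" "integrable P (\<lambda>x. (f x)\<^sup>2)"
      and CP: "(\<integral>x. (f x)\<^sup>2 \<partial>P) \<le> C" for P k
  proof -
    have "(\<integral>x. f x \<partial>P) - (\<integral>x. T k x \<partial>P) = (\<integral>x. f x - T k x \<partial>P)"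
      using iP T_int[OF P k] by simp
    also have "\<bar>\<dots>\<bar> \<le> (\<integral>x. (f x)\<^sup>2 / k \<partial>P)"
    proof (rule order.trans[OF integral_abs_bound integral_mono])
      show "\<bar>f x - T k x\<bar> \<le> (f x)\<^sup>2 / k" for x
      proof -
        have "k * \<bar>f x - T k x\<bar> \<le> (f x)\<^sup>2"
        proof (cases "\<bar>f x\<bar> \<le> k")
          case True
          then show ?thesis by (simp add: T_def)
        next
          case False
          then have "\<bar>f x - T k x\<bar> \<le> \<bar>f x\<bar>" using k by (auto simp: T_def abs_if split: if_splits)
          then have "k * \<bar>f x - T k x\<bar> \<le> \<bar>f x\<bar> * \<bar>f x\<bar>" using False k by (intro mult_mono) auto
          then show ?thesis by (simp add: power2_eq_square)
        qed
        then show ?thesis using k by (simp add: field_simps)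
      qed
    qed (use iP T_int[OF P k] in auto)
    also have "\<dots> = (\<integral>x. (f x)\<^sup>2 \<partial>P) / k" by simp
    also have "\<dots> \<le> C / k" using CP k by (intro divide_right_mono) auto
    finally show ?thesis .
  qed
  show "(\<lambda>n. \<integral>x. f x \<partial>Q n) \<longlonglongrightarrow> (\<integral>x. f x \<partial>M)"
  proof (rule LIMSEQ_I)
    fix \<epsilon> :: real assume \<epsilon>: "\<epsilon> > 0"
    \<comment> \<open>Makes each of the two truncation errors less than
      \<open>\<epsilon> / 4\<close>.\<close>
    define k where "k = 4 * (C + 1) / \<epsilon>"
    have k: "k > 0" using C0 \<epsilon> by (simp add: k_def)
    have "4 * (C / k) < \<epsilon>" using C0 \<epsilon> by (simp add: k_def field_simps)
    have "(\<lambda>n. \<integral>x. T k x \<partial>Q n) \<longlonglongrightarrow> (\<integral>x. T k x \<partial>M)"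
      by (rule lim[of _ k]; use k in \<open>auto simp: T_def[abs_def] abs_le_iff intro!: continuous_intros cont\<close>)
    then obtain N where N: "\<And>n. n \<ge> N \<Longrightarrow> \<bar>(\<integral>x. T k x \<partial>Q n) - (\<integral>x. T k x \<partial>M)\<bar> < \<epsilon> / 2"
      using LIMSEQ_D[of _ _ "\<epsilon> / 2"] \<epsilon> by fastforce
    have "\<bar>(\<integral>x. f x \<partial>Q n) - (\<integral>x. f x \<partial>M)\<bar> < \<epsilon>" if "n \<ge> N" for n
      using N[OF that] Tf[OF Q k int C, of n] Tf[OF M k fM f2(1)] f2(2) LC \<open>4 * (C / k) < \<epsilon>\<close> by linarith
    then show "\<exists>no. \<forall>n\<ge>no. norm ((\<integral>x. f x \<partial>Q n) - (\<integral>x. f x \<partial>M)) < \<epsilon>" by auto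
  qed
qed

lemma convergent_bounded_above:
  fixes a :: "nat \<Rightarrow> real"
  assumes "a \<longlonglongrightarrow> l"
  obtains B where "\<And>n. a n \<le> B"
proof -
  have "Bseq a" using assms convergent_imp_Bseq convergentI by blast
  then show ?thesis using that unfolding Bseq_def by (metis abs_le_D1 real_norm_def)
qed

text \<open>The space-filling curve lifts the discrete measures to the real line, where Helly's theorem applies.\<close>
theorem moments_limit:
  fixes y :: "nat \<Rightarrow> 'j \<Rightarrow> real ^ 'n::finite" and c :: "nat \<Rightarrow> 'j \<Rightarrow> real"
  assumes fin: "\<And>N. finite (J N)" and c0: "\<And>N j. j \<in> J N \<Longrightarrow> 0 \<le> c N j"
    and lim: "\<And>\<alpha>. (\<lambda>N. \<Sum>j\<in>J N. c N j * monomial \<alpha> (y N j)) \<longlonglongrightarrow> \<phi> \<alpha>"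
  shows "\<exists>\<mu>. has_moments \<mu> \<phi>"
proof (cases "\<phi> 0 = 0")
  case True
  \<comment> \<open>With zero limiting mass no normalisation is possible, but Cauchy-Schwarz against
    the mass forces all limits to vanish.\<close>
  have "\<phi> \<alpha> = 0" for \<alpha>
  proof -
    have "(\<phi> \<alpha>)\<^sup>2 \<le> \<phi> 0 * \<phi> (\<alpha> + \<alpha>)"
    proof (rule LIMSEQ_le[OF tendsto_power[OF lim] tendsto_mult[OF lim lim]], intro exI allI impI)
      fix N
      have "(\<Sum>j\<in>J N. sqrt (c N j) * (sqrt (c N j) * monomial \<alpha> (y N j)))\<^sup>2
          \<le> (\<Sum>j\<in>J N. (sqrt (c N j))\<^sup>2) * (\<Sum>j\<in>J N. (sqrt (c N j) * monomial \<alpha> (y N j))\<^sup>2)"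
        by (rule Cauchy_Schwarz_ineq_sum)
      then show "(\<Sum>j\<in>J N. c N j * monomial \<alpha> (y N j))\<^sup>2
          \<le> (\<Sum>j\<in>J N. c N j * monomial 0 (y N j)) * (\<Sum>j\<in>J N. c N j * monomial (\<alpha> + \<alpha>) (y N j))"
        using c0 by (simp add: monomial_add power_mult_distrib mult.assoc[symmetric] power2_eq_square[of "monomial _ _"] cong: sum.cong)
    qed
    then show ?thesis using True by simp
  qed
  then have "has_moments (null_measure borel) \<phi>" by (simp add: has_moments_def)
  then show ?thesis by blast
next
  case False
  define m where "m N = (\<Sum>j\<in>J N. c N j)" for N
  have mlim: "m \<longlonglongrightarrow> \<phi> 0" using lim[of 0] by (simp add: m_def[abs_def])
  have m0: "0 \<le> m N" for N unfolding m_def by (intro sum_nonneg c0)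
  then have "0 \<le> \<phi> 0" using LIMSEQ_le_const[OF mlim] by blast
  then have \<phi>0: "0 < \<phi> 0" using False by simp
  then obtain N0 where N0: "\<And>N. N \<ge> N0 \<Longrightarrow> 0 < m N"
    using order_tendstoD(1)[OF mlim] by (auto simp: eventually_sequentially)
  obtain G :: "real \<Rightarrow> real ^ 'n" where G: "continuous_on UNIV G" "\<And>x. \<exists>t. \<bar>t\<bar> \<le> norm x + 3 \<and> G t = x"
    using proper_space_filling_curve by blast
  obtain \<tau> where \<tau>: "\<And>x. \<bar>\<tau> x\<bar> \<le> norm x + 3" "\<And>x. G (\<tau> x) = x" using G(2) by metis
  have [measurable]: "G \<in> borel_measurable borel" using G(1) by (rule borel_measurable_continuous_onI)
  \<comment> \<open>The shift discards the indices where the mass may be zero, so the weights can be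
    normalised.\<close>
  define A where "A N = J (N + N0)" for N
  define d where "d N j = c (N + N0) j / m (N + N0)" for N j
  define z where "z N j = y (N + N0) j" for N j
  have mpos: "0 < m (N + N0)" for N by (rule N0) simp
  have d0: "0 \<le> d N j" if "j \<in> A N" for N j using c0 m0 that by (simp add: d_def A_def)
  have finA: "finite (A N)" for N by (simp add: A_def fin)
  have d1: "(\<Sum>j\<in>A N. d N j) = 1" for N
    using mpos[of N] by (simp add: d_def A_def sum_divide_distrib[symmetric] m_def[symmetric])
  \<comment> \<open>The section \<open>\<tau>\<close> of the curve need not be measurable: it is
    only composed with a map on a discrete space.\<close>
  define P where "P N = distr (point_measure (A N) (\<lambda>j. ennreal (d N j))) borel (\<lambda>j. \<tau> (z N j))" for N
  have [measurable]: "g \<in> measurable (point_measure (A N) (\<lambda>j. ennreal (d N j))) borel" for g N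
    by (simp add: measurable_point_measure_eq1)
  have P: "real_distribution (P N)" for N
  proof -
    have "emeasure (point_measure (A N) (\<lambda>j. ennreal (d N j))) (A N) = (\<Sum>j\<in>A N. ennreal (d N j))"
      by (simp add: emeasure_point_measure_finite finA)
    also have "\<dots> = 1" using d0 d1 by (simp add: sum_ennreal)
    finally have "prob_space (point_measure (A N) (\<lambda>j. ennreal (d N j)))"
      by (intro prob_spaceI) (simp add: space_point_measure)
    then show ?thesis unfolding P_def by (intro prob_space.real_distribution_distr) auto
  qed
  have P_int: "integrable (P N) f" "(\<integral>t. f t \<partial>P N) = (\<Sum>j\<in>A N. d N j * f (\<tau> (z N j)))"
    if [measurable]: "f \<in> borel_measurable borel" for f :: "real \<Rightarrow> real" and N
    unfolding P_def using finA d0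
    by (simp_all add: integrable_distr_eq integral_distr integrable_point_measure_finite lebesgue_integral_point_measure_finite)
  have Plim: "(\<lambda>N. \<Sum>j\<in>A N. d N j * monomial \<alpha> (z N j)) \<longlonglongrightarrow> \<phi> \<alpha> / \<phi> 0" for \<alpha>
  proof -
    have "(\<lambda>N. (\<Sum>j\<in>J (N + N0). c (N + N0) j * monomial \<alpha> (y (N + N0) j)) / m (N + N0)) \<longlonglongrightarrow> \<phi> \<alpha> / \<phi> 0"
      using False by (intro tendsto_divide LIMSEQ_ignore_initial_segment lim mlim) auto
    then show ?thesis by (simp add: A_def d_def z_def sum_divide_distrib)
  qed
  have "tight P"
    unfolding tight_def
  proof (intro conjI allI impI P)
    fix \<epsilon> :: real assume \<epsilon>: "\<epsilon> > 0"
    have "(\<lambda>N. \<Sum>i\<in>UNIV. \<Sum>j\<in>A N. d N j * monomial (axis i 2) (z N j)) \<longlonglongrightarrow> (\<Sum>i\<in>UNIV. \<phi> (axis i 2) / \<phi> 0)"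
      by (intro tendsto_sum Plim)
    then obtain B where B: "\<And>N. (\<Sum>i\<in>UNIV. \<Sum>j\<in>A N. d N j * monomial (axis i 2) (z N j)) \<le> B"
      by (rule convergent_bounded_above) blast
    \<comment> \<open>This is where the norm control of the curve parameter is needed: without it,
      bounded moments of the atoms would not keep the lifted mass from escaping.\<close>
    have B2: "(\<integral>t. t\<^sup>2 \<partial>P N) \<le> 2 * B + 18" for N
    proof -
      have "(\<tau> x)\<^sup>2 \<le> 2 * (norm x)\<^sup>2 + 18" for x
      proof -
        have "\<bar>\<tau> x\<bar>\<^sup>2 \<le> (norm x + 3)\<^sup>2" by (intro power_mono \<tau>) auto
        moreover have "0 \<le> (norm x - 3)\<^sup>2" by simp
        ultimately show ?thesis by (simp add: power2_eq_square algebra_simps)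
      qed
      then have "(\<integral>t. t\<^sup>2 \<partial>P N) \<le> (\<Sum>j\<in>A N. d N j * (2 * (norm (z N j))\<^sup>2 + 18))"
        using d0 by (subst P_int) (auto intro!: sum_mono mult_left_mono)
      also have "\<dots> = 2 * (\<Sum>j\<in>A N. \<Sum>i\<in>UNIV. d N j * (z N j $ i)\<^sup>2) + 18 * (\<Sum>j\<in>A N. d N j)"
      proof -
        have "d N j * (2 * (norm (z N j))\<^sup>2 + 18) = 2 * (\<Sum>i\<in>UNIV. d N j * (z N j $ i)\<^sup>2) + 18 * d N j" for j
          by (simp add: norm_vec_def L2_set_def sum_nonneg sum_distrib_left[symmetric] distrib_left)
        then show ?thesis by (simp only: sum.distrib sum_distrib_left[symmetric])
      qed
      also have "(\<Sum>j\<in>A N. \<Sum>i\<in>UNIV. d N j * (z N j $ i)\<^sup>2) \<le> B"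
        using B[of N] by (subst sum.swap) simp
      finally show ?thesis by (simp add: d1)
    qed
    have Bpos: "0 < 2 * B + 19" using order.trans[OF integral_nonneg_AE B2[of 0]] by simp
    \<comment> \<open>Chebyshev's radius; 19 instead of 18 makes the inequality strict and
      \<open>R\<close> positive.\<close>
    define R where "R = sqrt ((2 * B + 19) / \<epsilon>)"
    have R: "R > 0" "R\<^sup>2 = (2 * B + 19) / \<epsilon>" using Bpos \<epsilon> by (simp_all add: R_def)
    have "measure (P N) {- R<..R} > 1 - \<epsilon>" for N
    proof -
      interpret real_distribution "P N" by (rule P)
      have "1 - (\<integral>t. t\<^sup>2 / R\<^sup>2 \<partial>P N) = (\<integral>t. 1 - t\<^sup>2 / R\<^sup>2 \<partial>P N)"
        by (subst Bochner_Integration.integral_diff) (auto simp: P_int prob_space simp del: space_eq_univ)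
      also have "\<dots> \<le> (\<integral>t. indicator {- R<..R} t \<partial>P N)"
      proof (rule integral_mono)
        fix t :: real
        show "1 - t\<^sup>2 / R\<^sup>2 \<le> indicator {- R<..R} t"
        proof (cases "t \<in> {- R<..R}")
          case False
          then have "R \<le> \<bar>t\<bar>" by auto
          then have "R\<^sup>2 \<le> t\<^sup>2" using R(1) by (simp add: abs_le_square_iff[symmetric])
          then show ?thesis using False R(1) by simp
        qed simp
      qed (auto simp: P_int)
      also have "\<dots> = measure (P N) {- R<..R}" by simp
      finally have *: "1 - (\<integral>t. t\<^sup>2 \<partial>P N) / R\<^sup>2 \<le> measure (P N) {- R<..R}" by simp
      have "(\<integral>t. t\<^sup>2 \<partial>P N) / R\<^sup>2 < (2 * B + 19) / R\<^sup>2"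
        using B2[of N] R(1) by (intro divide_strict_right_mono) auto
      also have "\<dots> = \<epsilon>" using Bpos \<epsilon> by (simp add: R(2))
      finally show ?thesis using * by linarith
    qed
    then show "\<exists>a b. a < b \<and> (\<forall>n. 1 - \<epsilon> < measure (P n) {a<..b})"
      using R(1) by (intro exI[of _ "- R"] exI[of _ R]) auto
  qed
  then obtain r M where r: "strict_mono r" and M: "real_distribution M" and conv: "weak_conv_m (P \<circ> r) M"
    using tight_imp_convergent_subsubsequence[of P id] by (auto simp: strict_mono_id)
  interpret M: real_distribution M by (rule M)
  have mom: "integrable M (\<lambda>t. monomial \<alpha> (G t))" "(\<integral>t. monomial \<alpha> (G t) \<partial>M) = \<phi> \<alpha> / \<phi> 0" for \<alpha>
  proof -
    obtain C where C: "\<And>N. (\<Sum>j\<in>A N. d N j * monomial (\<alpha> + \<alpha>) (z N j)) \<le> C"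
      using Plim convergent_bounded_above by blast
    have cont: "continuous_on UNIV (\<lambda>t. monomial \<alpha> (G t))"
      by (rule continuous_on_compose2[OF monomial_continuous G(1)]) auto
    have *: "(\<integral>t. (monomial \<alpha> (G t))\<^sup>2 \<partial>(P \<circ> r) n) \<le> C" for n
      using C[of "r n"] by (simp add: P_int \<tau> monomial_add power2_eq_square)
    note W = weak_convergence_unbounded[OF _ M conv cont _ _ *]
    show "integrable M (\<lambda>t. monomial \<alpha> (G t))" by (rule W) (auto intro!: P P_int)
    have "(\<lambda>n. \<integral>t. monomial \<alpha> (G t) \<partial>(P \<circ> r) n) \<longlonglongrightarrow> (\<integral>t. monomial \<alpha> (G t) \<partial>M)"
      by (rule W) (auto intro!: P P_int)
    moreover have "(\<lambda>n. \<integral>t. monomial \<alpha> (G t) \<partial>(P \<circ> r) n) \<longlonglongrightarrow> \<phi> \<alpha> / \<phi> 0"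
      using LIMSEQ_subseq_LIMSEQ[OF Plim r] by (simp add: P_int \<tau> comp_def)
    ultimately show "(\<integral>t. monomial \<alpha> (G t) \<partial>M) = \<phi> \<alpha> / \<phi> 0" by (rule LIMSEQ_unique)
  qed
  \<comment> \<open>The limit law is carried back along the curve and given its original
    mass.\<close>
  define \<mu> where "\<mu> = density (distr M borel G) (\<lambda>_. ennreal (\<phi> 0))"
  have "has_moments \<mu> \<phi>"
    unfolding has_moments_def
  proof (intro conjI allI)
    show "sets \<mu> = sets borel" by (simp add: \<mu>_def)
    fix \<alpha>
    show "integrable \<mu> (monomial \<alpha>)"
      unfolding \<mu>_def using \<phi>0 mom by (subst integrable_density) (auto simp: integrable_distr_eq)
    show "(\<integral>x. monomial \<alpha> x \<partial>\<mu>) = \<phi> \<alpha>"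
      unfolding \<mu>_def using \<phi>0 mom by (subst integral_density) (auto simp: integral_distr)
  qed
  then show ?thesis by blast
qed

section \<open>Positive semidefinite functionals\<close>

text \<open>The finitely supported functions with convolution form the monoid algebra, for
  \<open>nat ^ 'n\<close> the ring of polynomials in several variables. This is the functional
  taking the value \<open>\<phi> k\<close> on the monomial \<open>k\<close>.\<close>

definition linear_functional :: "('a \<Rightarrow> real) \<Rightarrow> ('a::comm_monoid_add \<Rightarrow>\<^sub>0 real) \<Rightarrow> real" where
  "linear_functional \<phi> f = (\<Sum>k\<in>Poly_Mapping.keys f. Poly_Mapping.lookup f k * \<phi> k)"

lemma linear_functional_eq:
  assumes "finite A" "Poly_Mapping.keys f \<subseteq> A"
  shows "linear_functional \<phi> f = (\<Sum>k\<in>A. Poly_Mapping.lookup f k * \<phi> k)"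
  unfolding linear_functional_def using assms
  by (intro sum.mono_neutral_left) (auto simp: in_keys_iff)

lemma linear_functional_add: "linear_functional \<phi> (f + g) = linear_functional \<phi> f + linear_functional \<phi> g"
proof -
  have "finite (Poly_Mapping.keys f \<union> Poly_Mapping.keys g)" by simp
  from linear_functional_eq[OF this, of f \<phi>] linear_functional_eq[OF this, of g \<phi>]
    linear_functional_eq[OF this keys_add, of \<phi>] show ?thesis
    by (simp add: lookup_add distrib_right sum.distrib)
qed

lemma linear_functional_zero [simp]: "linear_functional \<phi> 0 = 0"
  by (simp add: linear_functional_def)

lemma linear_functional_sum: "linear_functional \<phi> (\<Sum>x\<in>A. f x) = (\<Sum>x\<in>A. linear_functional \<phi> (f x))"
  by (induction A rule: infinite_finite_induct) (simp_all add: linear_functional_add)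

lemma linear_functional_single [simp]: "linear_functional \<phi> (Poly_Mapping.single k a) = a * \<phi> k"
  by (subst linear_functional_eq[of "{k}"]) auto

lemma poly_mapping_as_sum: "(\<Sum>k\<in>Poly_Mapping.keys f. Poly_Mapping.single k (Poly_Mapping.lookup f k)) = f"
  by (rule poly_mapping_eqI) (simp add: lookup_sum lookup_single when_def in_keys_iff)

lemma linear_functional_mult:
  "linear_functional \<phi> (f * g) = (\<Sum>a\<in>Poly_Mapping.keys f. \<Sum>b\<in>Poly_Mapping.keys g.
    Poly_Mapping.lookup f a * Poly_Mapping.lookup g b * \<phi> (a + b))"
proof -
  have "f * g = (\<Sum>a\<in>Poly_Mapping.keys f. \<Sum>b\<in>Poly_Mapping.keys g.
      Poly_Mapping.single (a + b) (Poly_Mapping.lookup f a * Poly_Mapping.lookup g b))"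
    by (subst (1 2) poly_mapping_as_sum[symmetric]) (simp add: sum_product mult_single)
  then show ?thesis by (simp add: linear_functional_sum)
qed

lemma linear_functional_cmult [simp]:
  "linear_functional \<phi> (Poly_Mapping.single 0 c * f) = c * linear_functional \<phi> f"
proof (cases "c = 0")
  case False
  then show ?thesis
    by (simp add: linear_functional_mult) (simp add: linear_functional_def sum_distrib_left mult.assoc)
qed simp

lemma linear_functional_shift:
  "linear_functional (\<lambda>a. linear_functional \<phi> (Poly_Mapping.single a 1 * g)) f = linear_functional \<phi> (f * g)"
  unfolding linear_functional_mult
  by (simp add: linear_functional_def[of _ f] sum_distrib_left mult.assoc)

definition psd :: "('a::comm_monoid_add \<Rightarrow> real) \<Rightarrow> bool" where
  "psd \<phi> \<longleftrightarrow> (\<forall>f. 0 \<le> linear_functional \<phi> (f * f))"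

lemma psd_cauchy_schwarz:
  assumes "psd \<phi>"
  shows "(linear_functional \<phi> (f * g))\<^sup>2 \<le> linear_functional \<phi> (f * f) * linear_functional \<phi> (g * g)"
proof (rule quadratic_nonneg_discriminant)
  fix t :: real
  define c where "c = Poly_Mapping.single (0::'a) t"
  have "(f + c * g) * (f + c * g) = f * f + (c * (f * g) + c * (f * g)) + c * (c * (g * g))"
    by (simp add: algebra_simps)
  then have "linear_functional \<phi> ((f + c * g) * (f + c * g))
      = linear_functional \<phi> (f * f) + 2 * linear_functional \<phi> (f * g) * t + linear_functional \<phi> (g * g) * t\<^sup>2"
    by (simp only: linear_functional_add) (simp add: c_def power2_eq_square)
  then show "0 \<le> linear_functional \<phi> (f * f) + 2 * linear_functional \<phi> (f * g) * t + linear_functional \<phi> (g * g) * t\<^sup>2"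
    using assms by (metis psd_def)
qed

section \<open>Polynomials in a single coordinate as weights\<close>

definition poly_in :: "'n::finite \<Rightarrow> real poly \<Rightarrow> (nat ^ 'n \<Rightarrow>\<^sub>0 real)" where
  "poly_in i p = (\<Sum>k\<le>degree p. Poly_Mapping.single (axis i k) (coeff p k))"

lemma poly_in_eq:
  assumes "degree p \<le> N"
  shows "poly_in i p = (\<Sum>k\<le>N. Poly_Mapping.single (axis i k) (coeff p k))"
  unfolding poly_in_def using assms
  by (intro sum.mono_neutral_left) (auto simp: coeff_eq_0)

lemma poly_in_add: "poly_in i (p + q) = poly_in i p + poly_in i q"
  by (subst (1 2 3) poly_in_eq[where N = "max (degree p) (degree q)"])
    (auto simp: single_add sum.distrib degree_add_le)

lemma poly_in_zero [simp]: "poly_in i 0 = 0"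
  by (simp add: poly_in_def)

lemma poly_in_sum: "poly_in i (\<Sum>x\<in>A. f x) = (\<Sum>x\<in>A. poly_in i (f x))"
  by (induction A rule: infinite_finite_induct) (simp_all add: poly_in_add)

lemma poly_in_monom: "poly_in i (monom a n) = Poly_Mapping.single (axis i n) a"
proof -
  have "poly_in i (monom a n) = (\<Sum>k\<le>n. Poly_Mapping.single (axis i k) (coeff (monom a n) k))"
    by (rule poly_in_eq) (rule degree_monom_le)
  also have "\<dots> = (\<Sum>k\<le>n. if k = n then Poly_Mapping.single (axis i n) a else 0)"
    by (intro sum.cong) auto
  finally show ?thesis by simp
qed

lemma poly_in_mult: "poly_in i (p * q) = poly_in i p * poly_in i q"
proof -
  have "p * q = (\<Sum>j\<le>degree p. \<Sum>k\<le>degree q. monom (coeff p j * coeff q k) (j + k))"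
    by (subst (1 2) poly_as_sum_of_monoms[symmetric]) (simp add: sum_product mult_monom)
  then have "poly_in i (p * q) = (\<Sum>j\<le>degree p. \<Sum>k\<le>degree q. Poly_Mapping.single (axis i (j + k)) (coeff p j * coeff q k))"
    by (simp only: poly_in_sum poly_in_monom)
  then show ?thesis
    by (simp add: poly_in_def sum_product mult_single axis_add)
qed

lemma poly_in_smult: "poly_in i (smult c p) = Poly_Mapping.single 0 c * poly_in i p"
proof -
  have "poly_in i (smult c p) = poly_in i ([:c:] * p)" by simp
  also have "\<dots> = poly_in i [:c:] * poly_in i p" by (rule poly_in_mult)
  also have "poly_in i [:c:] = Poly_Mapping.single 0 c" by (simp add: poly_in_def axis_zero)
  finally show ?thesis .
qed

text \<open>If \<open>\<phi>\<close> came from a measure, these would be the moments of that measure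
  with density \<open>p\<close> in \<open>x\<^sub>i\<close>.\<close>

definition weighted :: "(nat ^ 'n::finite \<Rightarrow> real) \<Rightarrow> 'n \<Rightarrow> real poly \<Rightarrow> nat ^ 'n \<Rightarrow> real" where
  "weighted \<phi> i p \<alpha> = linear_functional \<phi> (Poly_Mapping.single \<alpha> 1 * poly_in i p)"

lemma weighted_add: "weighted \<phi> i (p + q) \<alpha> = weighted \<phi> i p \<alpha> + weighted \<phi> i q \<alpha>"
  by (simp add: weighted_def poly_in_add distrib_left linear_functional_add)

lemma weighted_smult: "weighted \<phi> i (smult c p) \<alpha> = c * weighted \<phi> i p \<alpha>"
  unfolding weighted_def poly_in_smult by (subst mult.left_commute) simp

lemma weighted_monom: "weighted \<phi> i (monom 1 n) \<alpha> = \<phi> (\<alpha> + axis i n)"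
  by (simp add: weighted_def poly_in_monom mult_single)

text \<open>Writing \<open>p = u^2 + v^2\<close>, the weighted value at \<open>f * f\<close> is the
  sum of the values of the functional at the squares of \<open>f * u\<close> and
  \<open>f * v\<close>.\<close>

lemma psd_weighted:
  assumes "psd \<phi>" "\<And>x. 0 \<le> poly p x"
  shows "psd (weighted \<phi> i p)"
  unfolding psd_def
proof
  fix f
  obtain u v where p: "p = u\<^sup>2 + v\<^sup>2" using nonneg_poly_sum_of_two_squares[of p] assms(2) by blast
  define a b where "a = f * poly_in i u" and "b = f * poly_in i v"
  have "linear_functional (weighted \<phi> i p) (f * f) = linear_functional \<phi> (f * f * poly_in i p)"
    using linear_functional_shift[of \<phi> "poly_in i p" "f * f"] by (simp add: weighted_def[abs_def])
  also have "f * f * poly_in i p = a * a + b * b"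
    unfolding p power2_eq_square poly_in_add poly_in_mult a_def b_def by (simp add: algebra_simps)
  also have "0 \<le> linear_functional \<phi> (a * a + b * b)"
    using assms(1) by (simp add: linear_functional_add psd_def)
  finally show "0 \<le> linear_functional (weighted \<phi> i p) (f * f)" .
qed

section \<open>Stability of the Carleman condition under a polynomial weight\<close>

lemma psd_axis_cauchy_schwarz:
  fixes \<phi> :: "nat ^ 'n::finite \<Rightarrow> real"
  assumes "psd \<phi>"
  shows "(\<phi> (axis j (a + b)))\<^sup>2 \<le> \<phi> (axis j (2 * a)) * \<phi> (axis j (2 * b))"
  using psd_cauchy_schwarz[OF assms, of "Poly_Mapping.single (axis j a) 1" "Poly_Mapping.single (axis j b) 1"]
  by (simp add: mult_single mult_2 flip: axis_add)

lemma weighted_cauchy_schwarz: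
  assumes "psd \<phi>"
  shows "(weighted \<phi> i p (axis j (2 * n)))\<^sup>2
    \<le> linear_functional \<phi> (poly_in i p * poly_in i p) * \<phi> (axis j (2 * (2 * n)))"
  using psd_cauchy_schwarz[OF assms, of "Poly_Mapping.single (axis j (2 * n)) 1" "poly_in i p"]
  by (simp add: weighted_def mult_single mult_2[of "2 * n"] mult.commute flip: axis_add)

lemma psd_axis_nonneg:
  fixes \<phi> :: "nat ^ 'n::finite \<Rightarrow> real"
  assumes "psd \<phi>"
  shows "0 \<le> \<phi> (axis j (2 * n))"
proof -
  have "0 \<le> linear_functional \<phi> (Poly_Mapping.single (axis j n) 1 * Poly_Mapping.single (axis j n) 1)"
    using assms unfolding psd_def by blast
  then show ?thesis by (simp add: mult_single mult_2 flip: axis_add)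
qed

text \<open>The roots \<open>a n powr (1 / n)\<close> increase; the form with integer powers lets
  the induction multiply the convexity inequality to the power \<open>Suc n\<close> by the previous
  case and cancel.\<close>

lemma log_convex_root_mono:
  fixes a :: "nat \<Rightarrow> real"
  assumes pos: "\<And>n. 0 < a n" and "a 0 = 1" and conv: "\<And>n. (a (Suc n))\<^sup>2 \<le> a n * a (Suc (Suc n))"
  shows "a n ^ Suc n \<le> a (Suc n) ^ n"
proof (induction n)
  case (Suc n)
  have "a (Suc n) ^ n * a (Suc n) ^ Suc (Suc n) = ((a (Suc n))\<^sup>2) ^ Suc n"
    by (simp add: power_add[symmetric] power_mult[symmetric] mult_2 del: power_Suc)
  also have "\<dots> \<le> (a n * a (Suc (Suc n))) ^ Suc n"
    by (intro power_mono conv) simp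
  also have "\<dots> = a n ^ Suc n * a (Suc (Suc n)) ^ Suc n"
    by (rule power_mult_distrib)
  also have "\<dots> \<le> a (Suc n) ^ n * a (Suc (Suc n)) ^ Suc n"
    using Suc.IH pos by (intro mult_right_mono) (auto simp: less_imp_le)
  finally show ?case
    using pos[of "Suc n"] by (simp only: mult_le_cancel_left_pos zero_less_power)
qed (simp add: assms)

lemma log_convex_powr_antimono:
  fixes a :: "nat \<Rightarrow> real"
  assumes pos: "\<And>n. 0 < a n" and "a 0 = 1" and conv: "\<And>n. (a (Suc n))\<^sup>2 \<le> a n * a (Suc (Suc n))"
    and n: "n > 0"
  shows "a (Suc n) powr (- 1 / (2 * real (Suc n))) \<le> a n powr (- 1 / (2 * real n))"
proof -
  define c where "c = - 1 / (2 * real n * real (Suc n))"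
  have "a (Suc n) powr (- 1 / (2 * real (Suc n))) = (a (Suc n) ^ n) powr c"
    using pos[of "Suc n"] n by (simp add: powr_realpow[symmetric] powr_powr c_def del: of_nat_Suc)
  also have "\<dots> \<le> (a n ^ Suc n) powr c"
    using log_convex_root_mono[of a, OF assms(1-3)] pos[of n]
    by (intro powr_mono2') (auto simp: c_def zero_less_power simp del: power_Suc)
  also have "\<dots> = a n powr (- 1 / (2 * real n))"
    using pos[of n] n by (simp add: powr_realpow[symmetric] powr_powr c_def del: of_nat_Suc power_Suc)
  finally show ?thesis .
qed

lemma summable_even_antimono:
  fixes h :: "nat \<Rightarrow> real"
  assumes h0: "\<And>n. 0 \<le> h n" and dec: "\<And>n. n > 0 \<Longrightarrow> h (Suc n) \<le> h n"
    and s: "summable (\<lambda>n. h (2 * Suc n))"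
  shows "summable (\<lambda>n. h (Suc n))"
proof -
  have "summable (\<lambda>n. h (Suc (Suc n)))"
  proof (rule summableI_nonneg_bounded)
    fix N
    have *: "(\<Sum>n<2 * N. h (Suc (Suc n))) \<le> 2 * (\<Sum>n<N. h (2 * Suc n))" for N
    proof (induction N)
      case (Suc N)
      have "h (Suc (2 * Suc N)) \<le> h (2 * Suc N)" by (intro dec) simp
      then show ?case using Suc by simp
    qed simp
    have "(\<Sum>n<N. h (Suc (Suc n))) \<le> (\<Sum>n<2 * N. h (Suc (Suc n)))"
      using h0 by (intro sum_mono2) auto
    also note *
    also have "(\<Sum>n<N. h (2 * Suc n)) \<le> suminf (\<lambda>n. h (2 * Suc n))"
      using h0 s by (intro sum_le_suminf) auto
    finally show "(\<Sum>n<N. h (Suc (Suc n))) \<le> 2 * suminf (\<lambda>n. h (2 * Suc n))" by simp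
  qed (rule h0)
  then show ?thesis by (simp add: summable_Suc_iff[of "\<lambda>n. h (Suc n)"])
qed

text \<open>A lower bound uniform in the exponent, so constant factors inside the roots cannot
  influence divergence.\<close>

lemma powr_ge_min:
  fixes K e :: real
  assumes "0 < K" "0 \<le> e" "e \<le> 1"
  shows "min 1 K \<le> K powr e"
proof (cases "1 \<le> K")
  case True
  then show ?thesis using assms ge_one_powr_ge_zero[of K e] by auto
next
  case False
  then have "K powr 1 \<le> K powr e" using assms by (intro powr_mono') auto
  then show ?thesis using assms by auto
qed

text \<open>Half of the exponents suffice for the Carleman condition, since the terms are
  monotone after normalisation.\<close>
lemma carleman_real_weighted:
  fixes m m' :: "nat \<Rightarrow> real"
  assumes carl: "carleman_real m"
    and cs: "\<And>a b. (m (a + b))\<^sup>2 \<le> m (2 * a) * m (2 * b)" and m0: "\<And>n. 0 \<le> m (2 * n)"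
    and m'0: "\<And>n. 0 \<le> m' (2 * n)" and le: "\<And>n. (m' (2 * n))\<^sup>2 \<le> K * m (2 * (2 * n))"
  shows "carleman_real m'"
proof (cases "\<exists>n. m' (2 * Suc n) = 0")
  case True
  then show ?thesis unfolding carleman_real_def by blast
next
  case False
  have m'pos: "0 < m' (2 * Suc n)" for n
    using m'0[of "Suc n"] False by (metis order_le_less)
  have Kpos: "0 < K" and m4: "m (2 * (2 * Suc n)) \<noteq> 0" for n
  proof -
    have *: "0 < K * m (2 * (2 * Suc n))" for n
      using less_le_trans[OF zero_less_power[OF m'pos[of n], of 2] le[of "Suc n"]] .
    show "m (2 * (2 * Suc n)) \<noteq> 0" using *[of n] by auto
    show "0 < K" using *[of 0] m0[of "2 * Suc 0"] by (auto simp: zero_less_mult_iff)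
  qed
  \<comment> \<open>Cauchy-Schwarz would carry a zero at \<open>2 * n\<close> to index
    \<open>4 * n\<close>, or to index 4 if \<open>n = 0\<close>, where \<open>m4\<close> excludes
    it.\<close>
  have mpos: "0 < m (2 * n)" for n
  proof -
    have "m (2 * n) \<noteq> 0"
    proof
      assume z: "m (2 * n) = 0"
      show False
      proof (cases n)
        case 0
        have "(m (0 + 2 * (2 * Suc 0)))\<^sup>2 \<le> m (2 * 0) * m (2 * (2 * (2 * Suc 0)))" by (rule cs)
        then show False using z 0 m4[of 0] by simp
      next
        case (Suc k)
        have "(m (n + 3 * n))\<^sup>2 \<le> m (2 * n) * m (2 * (3 * n))" by (rule cs)
        moreover have "n + 3 * n = 2 * (2 * Suc k)" using Suc by simp
        ultimately show False using z m4[of k] by simp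
      qed
    qed
    then show ?thesis using m0[of n] by simp
  qed
  define a where "a n = m (2 * n) / m 0" for n
  have m00: "0 < m 0" using mpos[of 0] by simp
  have apos: "0 < a n" for n using mpos m00 by (simp add: a_def)
  have a0: "a 0 = 1" using m00 by (simp add: a_def)
  have aconv: "(a (Suc n))\<^sup>2 \<le> a n * a (Suc (Suc n))" for n
  proof -
    have "n + Suc (Suc n) = 2 * Suc n" by simp
    then have "(m (2 * Suc n))\<^sup>2 \<le> m (2 * n) * m (2 * Suc (Suc n))" by (metis cs)
    then show ?thesis using m00 by (simp add: a_def power_divide divide_right_mono power2_eq_square[of "m 0"])
  qed
  define h where "h n = a n powr (- 1 / (2 * real n))" for n
  have hdec: "h (Suc n) \<le> h n" if "n > 0" for n
    unfolding h_def by (rule log_convex_powr_antimono[of a, OF apos a0 aconv that])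
  have nosum: "\<not> summable (\<lambda>n. h (2 * Suc n))"
  proof
    assume "summable (\<lambda>n. h (2 * Suc n))"
    then have s: "summable (\<lambda>n. h (Suc n))"
      using hdec by (intro summable_even_antimono[of h]) (simp add: h_def)
    have "summable (\<lambda>n. m (2 * Suc n) powr (- 1 / real (2 * Suc n)))"
    proof (rule summable_comparison_test[OF _ summable_mult[OF s, of "1 / min 1 (m 0)"]], intro exI allI impI)
      fix n :: nat
      define e where "e = 1 / real (2 * Suc n)"
      have e: "0 \<le> e" "e \<le> 1" by (simp_all add: e_def)
      have "h (Suc n) = m (2 * Suc n) powr (- e) * m 0 powr e"
      proof -
        have "- 1 / (2 * real (Suc n)) = - e" by (simp add: e_def)
        then have "h (Suc n) = (m (2 * Suc n) / m 0) powr (- e)" unfolding h_def a_def by (simp only:)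
        then show ?thesis
          using mpos[of "Suc n"] m00 by (simp add: powr_divide powr_minus_divide)
      qed
      also have "\<dots> \<ge> m (2 * Suc n) powr (- e) * min 1 (m 0)"
        by (intro mult_left_mono powr_ge_min m00 e) auto
      finally show "norm (m (2 * Suc n) powr (- 1 / real (2 * Suc n))) \<le> 1 / min 1 (m 0) * h (Suc n)"
        using m00 by (simp add: e_def field_simps)
    qed
    then show False using carl mpos less_irrefl unfolding carleman_real_def by metis
  qed
  define \<kappa> where "\<kappa> = min 1 (1 / (K * m 0))"
  have \<kappa>: "0 < \<kappa>" using Kpos m00 by (simp add: \<kappa>_def)
  have "\<not> summable (\<lambda>n. m' (2 * Suc n) powr (- 1 / real (2 * Suc n)))"
  proof
    assume s: "summable (\<lambda>n. m' (2 * Suc n) powr (- 1 / real (2 * Suc n)))"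
    have "summable (\<lambda>n. h (2 * Suc n))"
    proof (rule summable_comparison_test[OF _ summable_mult[OF s, of "1 / \<kappa>"]], intro exI allI impI)
      fix n :: nat
      define e where "e = 1 / (2 * real (2 * Suc n))"
      have e: "0 \<le> e" "e \<le> 1" by (simp_all add: e_def)
      have "\<kappa> * h (2 * Suc n) \<le> (1 / (K * m 0)) powr e * a (2 * Suc n) powr (- e)"
        unfolding h_def e_def[symmetric] \<kappa>_def using Kpos m00 e
        by (intro mult_mono powr_ge_min) (auto simp: e_def)
      also have "\<dots> = (K * m 0 * a (2 * Suc n)) powr (- e)"
        using Kpos m00 apos[of "2 * Suc n"] by (simp add: powr_mult powr_divide powr_minus_divide)
      also have "K * m 0 * a (2 * Suc n) = K * m (2 * (2 * Suc n))"
        using m00 by (simp add: a_def)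
      also have "(K * m (2 * (2 * Suc n))) powr (- e) \<le> ((m' (2 * Suc n))\<^sup>2) powr (- e)"
        using le[of "Suc n"] m'pos[of n] e by (intro powr_mono2') auto
      also have "\<dots> = m' (2 * Suc n) powr (2 * (- e))"
        using m'pos[of n] by (simp add: powr_powr flip: powr_numeral)
      also have "2 * (- e) = - 1 / real (2 * Suc n)"
        by (simp add: e_def divide_simps)
      finally show "norm (h (2 * Suc n)) \<le> 1 / \<kappa> * m' (2 * Suc n) powr (- 1 / real (2 * Suc n))"
        using \<kappa> by (simp add: h_def field_simps)
    qed
    then show False using nosum by blast
  qed
  then show ?thesis unfolding carleman_real_def by blast
qed

lemma carleman_weighted:
  assumes "psd \<phi>" "carleman_real (\<lambda>n. \<phi> (axis j n))" "\<And>x. 0 \<le> poly p x"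
  shows "carleman_real (\<lambda>n. weighted \<phi> i p (axis j n))"
  by (rule carleman_real_weighted[OF assms(2) psd_axis_cauchy_schwarz[OF assms(1)] psd_axis_nonneg[OF assms(1)]
    psd_axis_nonneg[OF psd_weighted[OF assms(1,3)]] weighted_cauchy_schwarz[OF assms(1)]])

section \<open>Existence\<close>

definition sum_measure :: "'a measure \<Rightarrow> 'a measure \<Rightarrow> 'a measure" where
  "sum_measure M N = measure_of (space M) (sets M) (\<lambda>A. emeasure M A + emeasure N A)"

lemma space_sum_measure [simp]: "space (sum_measure M N) = space M"
  and sets_sum_measure [simp, measurable_cong]: "sets (sum_measure M N) = sets M"
  by (simp_all add: sum_measure_def)

lemma emeasure_sum_measure:
  assumes "sets N = sets M" "A \<in> sets M"
  shows "emeasure (sum_measure M N) A = emeasure M A + emeasure N A"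
proof (rule emeasure_measure_of[OF sum_measure_def])
  show "countably_additive (sets (sum_measure M N)) (\<lambda>A. emeasure M A + emeasure N A)"
    using assms(1) by (auto simp: countably_additive_def suminf_emeasure[symmetric] suminf_add[symmetric])
qed (use assms sets.space_closed in \<open>auto simp: positive_def\<close>)

lemma nn_integral_sum_measure:
  assumes sets: "sets N = sets M" and "f \<in> borel_measurable M"
  shows "(\<integral>\<^sup>+x. f x \<partial>sum_measure M N) = (\<integral>\<^sup>+x. f x \<partial>M) + (\<integral>\<^sup>+x. f x \<partial>N)"
  using assms(2)
proof (induction rule: borel_measurable_induct)
  case (cong f g)
  have "(\<integral>\<^sup>+x. f x \<partial>L) = (\<integral>\<^sup>+x. g x \<partial>L)" if "space L = space M" for L
    using cong that by (intro nn_integral_cong) auto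
  then show ?case using cong sets_eq_imp_space_eq[OF sets] by simp
next
  case (set A)
  then show ?case using sets by (simp add: emeasure_sum_measure)
next
  case (mult u c)
  then show ?case
    using sets by (simp add: nn_integral_cmult distrib_left measurable_cong_sets[OF sets refl] measurable_cong_sets[OF sets_sum_measure refl])
next
  case (add u v)
  then show ?case
    using sets by (simp add: nn_integral_add measurable_cong_sets[OF sets refl] measurable_cong_sets[OF sets_sum_measure refl] add_ac)
next
  case (seq U)
  have m: "U i \<in> borel_measurable N" "U i \<in> borel_measurable (sum_measure M N)" for i
    using seq by (simp_all add: measurable_cong_sets[OF sets refl] measurable_cong_sets[OF sets_sum_measure refl])
  have inc: "incseq (\<lambda>i. \<integral>\<^sup>+x. U i x \<partial>L)" for L
    using seq by (auto simp: incseq_def le_fun_def intro!: nn_integral_mono)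
  have "(\<integral>\<^sup>+x. Sup (range U) x \<partial>L) = (SUP i. \<integral>\<^sup>+x. U i x \<partial>L)" if "\<And>i. U i \<in> borel_measurable L" for L
    using nn_integral_monotone_convergence_SUP[OF \<open>incseq U\<close> that] by (simp add: image_image)
  then show ?case
    using seq m inc by (simp add: ennreal_SUP_add)
qed

lemma integral_sum_measure:
  fixes f :: "'a \<Rightarrow> real"
  assumes sets: "sets N = sets M" and M: "integrable M f" and N: "integrable N f"
  shows "integrable (sum_measure M N) f" "(\<integral>x. f x \<partial>sum_measure M N) = (\<integral>x. f x \<partial>M) + (\<integral>x. f x \<partial>N)"
proof -
  have [measurable]: "f \<in> borel_measurable M" using M by auto
  show i: "integrable (sum_measure M N) f"
    using M N unfolding integrable_iff_bounded
    by (auto simp: nn_integral_sum_measure[OF sets] measurable_cong_sets[OF sets_sum_measure refl])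
  have fin: "(\<integral>\<^sup>+x. ennreal (f x) \<partial>L) < \<infinity>" "(\<integral>\<^sup>+x. ennreal (- f x) \<partial>L) < \<infinity>" if "integrable L f" for L
    using that by (auto simp: real_integrable_def less_top)
  show "(\<integral>x. f x \<partial>sum_measure M N) = (\<integral>x. f x \<partial>M) + (\<integral>x. f x \<partial>N)"
    using fin[OF M] fin[OF N]
    by (simp add: real_lebesgue_integral_def[OF i] real_lebesgue_integral_def[OF M] real_lebesgue_integral_def[OF N]
        nn_integral_sum_measure[OF sets] enn2real_plus)
qed

lemma has_moments_sum:
  fixes \<mu> \<nu> :: "(real ^ 'n::finite) measure"
  assumes M: "has_moments \<mu> \<phi>" and N: "has_moments \<nu> \<psi>"
  shows "has_moments (sum_measure \<mu> \<nu>) (\<lambda>\<alpha>. \<phi> \<alpha> + \<psi> \<alpha>)"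
    and "A \<in> sets borel \<Longrightarrow> measure (sum_measure \<mu> \<nu>) A = measure \<mu> A + measure \<nu> A"
proof -
  interpret M: finite_measure \<mu> using M by (rule has_moments_finite_measure)
  interpret N: finite_measure \<nu> using N by (rule has_moments_finite_measure)
  have s: "sets \<nu> = sets \<mu>" "sets \<mu> = sets borel" using M N by (simp_all add: has_moments_def)
  show "has_moments (sum_measure \<mu> \<nu>) (\<lambda>\<alpha>. \<phi> \<alpha> + \<psi> \<alpha>)"
    using M N by (auto simp: has_moments_def integral_sum_measure)
  show "A \<in> sets borel \<Longrightarrow> measure (sum_measure \<mu> \<nu>) A = measure \<mu> A + measure \<nu> A"
    using s by (subst measure_def) (simp add: emeasure_sum_measure M.emeasure_eq_measure N.emeasure_eq_measure flip: ennreal_plus)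
qed

lemma has_moments_scale:
  fixes \<mu> :: "(real ^ 'n::finite) measure"
  assumes M: "has_moments \<mu> \<phi>" and c: "0 \<le> c"
  shows "has_moments (density \<mu> (\<lambda>_. ennreal c)) (\<lambda>\<alpha>. c * \<phi> \<alpha>)"
    and "A \<in> sets borel \<Longrightarrow> measure (density \<mu> (\<lambda>_. ennreal c)) A = c * measure \<mu> A"
proof -
  have s: "sets \<mu> = sets borel" using M by (simp add: has_moments_def)
  have [measurable_cong]: "sets \<mu> = sets borel" by (rule s)
  show "has_moments (density \<mu> (\<lambda>_. ennreal c)) (\<lambda>\<alpha>. c * \<phi> \<alpha>)"
    unfolding has_moments_def
  proof (intro conjI allI)
    fix \<alpha>
    show "integrable (density \<mu> (\<lambda>_. ennreal c)) (monomial \<alpha>)"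
      using c M by (subst integrable_density) (auto simp: has_moments_def)
    show "(\<integral>x. monomial \<alpha> x \<partial>density \<mu> (\<lambda>_. ennreal c)) = c * \<phi> \<alpha>"
      using c M by (subst integral_density) (auto simp: has_moments_def)
  qed (simp add: s)
  show "A \<in> sets borel \<Longrightarrow> measure (density \<mu> (\<lambda>_. ennreal c)) A = c * measure \<mu> A"
    using c s by (simp add: measure_def emeasure_density_const enn2real_mult)
qed

definition supported_on :: "'n set \<Rightarrow> nat ^ 'n::finite \<Rightarrow> bool" where
  "supported_on I \<alpha> \<longleftrightarrow> (\<forall>j. j \<notin> I \<longrightarrow> \<alpha> $ j = 0)"

text \<open>The moments of a measure carried by the subspace where the coordinates outside
  \<open>I\<close> are 0. The induction on \<open>I\<close> thus stays in one fixed space.\<close>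

definition restrict_moments :: "'n set \<Rightarrow> (nat ^ 'n::finite \<Rightarrow> real) \<Rightarrow> nat ^ 'n \<Rightarrow> real" where
  "restrict_moments I \<phi> \<alpha> = (if supported_on I \<alpha> then \<phi> \<alpha> else 0)"

text \<open>Outside \<open>I\<close> the restricted marginal has a vanishing entry of positive even
  index, so the condition holds trivially there and uniqueness is available in all
  coordinates.\<close>

lemma carleman_restrict_moments:
  assumes "\<And>j. j \<in> I \<Longrightarrow> carleman_real (\<lambda>n. \<phi> (axis j n))"
  shows "carleman_real (\<lambda>n. restrict_moments I \<phi> (axis j n))"
proof (cases "j \<in> I")
  case True
  then have "supported_on I (axis j n)" for n by (auto simp: supported_on_def axis_def)
  then show ?thesis using assms[OF True] by (simp add: restrict_moments_def)
next
  case False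
  then have "\<not> supported_on I (axis j (2 * Suc 0))" by (auto simp: supported_on_def axis_def)
  then have "\<exists>n. restrict_moments I \<phi> (axis j (2 * Suc n)) = 0"
    unfolding restrict_moments_def by (intro exI[of _ 0]) (simp only: if_False)
  then show ?thesis unfolding carleman_real_def by blast
qed

lemma simple_rounding:
  "\<exists>F :: nat \<Rightarrow> real \<Rightarrow> real. (\<forall>N. F N \<in> borel_measurable borel \<and> finite (range (F N))) \<and>
    (\<forall>x. (\<lambda>N. F N x) \<longlonglongrightarrow> x) \<and> (\<forall>N x. \<bar>F N x\<bar> \<le> 2 * \<bar>x\<bar>)"
proof -
  have "(\<lambda>x. x) \<in> borel_measurable (borel :: real measure)" by simp
  from borel_measurable_implies_sequence_metric[OF this, of 0]
  obtain F where F: "\<And>N. simple_function borel (F N)" "\<And>x. (\<lambda>N. F N x) \<longlonglongrightarrow> (x :: real)"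
      "\<And>N x. dist (F N x) 0 \<le> 2 * dist x 0"
    by auto
  have "F N \<in> borel_measurable borel" for N using F(1) by (rule borel_measurable_simple_function)
  moreover have "finite (range (F N))" for N using F(1)[of N] by (simp add: simple_function_def)
  ultimately show ?thesis using F(2,3) by (intro exI[of _ F]) auto
qed

lemma finite_vectors:
  assumes "finite S"
  shows "finite {v :: 'a ^ 'n::finite. \<forall>j. v $ j \<in> S}"
proof -
  have "finite (PiE (UNIV :: 'n set) (\<lambda>_. S))" using assms by (intro finite_PiE) auto
  then have "finite (vec_lambda ` (PiE (UNIV :: 'n set) (\<lambda>_. S)))" by (rule finite_imageI)
  moreover have "{v :: 'a ^ 'n. \<forall>j. v $ j \<in> S} \<subseteq> vec_lambda ` (PiE UNIV (\<lambda>_. S))"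
    by (auto intro!: image_eqI[of _ _ "($) _"] simp: vec_lambda_eta)
  ultimately show ?thesis by (rule finite_subset[rotated])
qed

lemma nonneg_poly_one_plus_minus:
  fixes p :: "real poly"
  shows "0 \<le> poly ((p + 1)\<^sup>2) x" "0 \<le> poly ((p - 1)\<^sup>2) x"
  by (simp_all add: poly_power)

lemma supported_on_monomial_cong:
  assumes "supported_on I \<alpha>" "\<And>j. j \<in> I \<Longrightarrow> x $ j = y $ j"
  shows "monomial \<alpha> x = monomial \<alpha> y"
  unfolding monomial_def
proof (intro prod.cong refl)
  fix j
  show "x $ j ^ \<alpha> $ j = y $ j ^ \<alpha> $ j"
    using assms by (cases "j \<in> I") (auto simp: supported_on_def)
qed

text \<open>The remaining coordinate \<open>i\<close> needs no Carleman condition: conditionally on a cell of a partition of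
  the coordinates in \<open>I\<close> the moments in \<open>x\<^sub>i\<close> form a positive sequence, which is approximated by
  finitely many atoms. Uniqueness of the measures \<open>\<sigma> p\<close> makes them additive in the weight \<open>p\<close>.\<close>
lemma existence_step:
  fixes \<phi> :: "nat ^ 'n::finite \<Rightarrow> real"
  assumes psd: "psd \<phi>" and i: "i \<notin> I"
    and carl: "\<And>j. j \<in> I \<Longrightarrow> carleman_real (\<lambda>n. \<phi> (axis j n))"
    and IH: "\<And>\<psi>. psd \<psi> \<Longrightarrow> (\<And>j. j \<in> I \<Longrightarrow> carleman_real (\<lambda>n. \<psi> (axis j n))) \<Longrightarrow>
      \<exists>\<mu>. has_moments \<mu> (restrict_moments I \<psi>)"
  shows "\<exists>\<mu>. has_moments \<mu> (restrict_moments (insert i I) \<phi>)"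
proof -
  define W where "W p = restrict_moments I (weighted \<phi> i p)" for p
  define \<sigma> where "\<sigma> p = (SOME \<mu>. has_moments \<mu> (W p))" for p
  define nonneg where "nonneg p \<longleftrightarrow> (\<forall>x. 0 \<le> poly p x)" for p :: "real poly"
  have \<sigma>: "has_moments (\<sigma> p) (W p)" if "nonneg p" for p
  proof -
    have "\<exists>\<mu>. has_moments \<mu> (W p)"
      unfolding W_def using that
      by (intro IH psd_weighted psd carleman_weighted carl) (auto simp: nonneg_def)
    then show ?thesis unfolding \<sigma>_def by (rule someI_ex)
  qed
  have unique: "\<mu> = \<sigma> p" if "nonneg p" "has_moments \<mu> (W p)" for p \<mu>
  proof (rule has_moments_unique[OF that(2) \<sigma>[OF that(1)]])
    show "carleman_real (\<lambda>n. W p (axis j n))" for j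
      unfolding W_def using that(1)
      by (intro carleman_restrict_moments carleman_weighted psd carl) (auto simp: nonneg_def)
  qed
  define m where "m p A = measure (\<sigma> p) A" for p A
  have m_add: "m (p + q) A = m p A + m q A" if "nonneg p" "nonneg q" "A \<in> sets borel" for p q A
  proof -
    have "(\<lambda>\<alpha>. W p \<alpha> + W q \<alpha>) = W (p + q)"
      by (auto simp: W_def restrict_moments_def weighted_add)
    moreover have "nonneg (p + q)" using that by (simp add: nonneg_def add_nonneg_nonneg)
    ultimately have "sum_measure (\<sigma> p) (\<sigma> q) = \<sigma> (p + q)"
      using unique has_moments_sum(1)[OF \<sigma>[OF that(1)] \<sigma>[OF that(2)]] by metis
    then show ?thesis
      using has_moments_sum(2)[OF \<sigma>[OF that(1)] \<sigma>[OF that(2)] that(3)] by (simp add: m_def)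
  qed
  have m_scale: "m (smult c p) A = c * m p A" if "nonneg p" "0 \<le> c" "A \<in> sets borel" for c p A
  proof -
    have "(\<lambda>\<alpha>. c * W p \<alpha>) = W (smult c p)"
      by (auto simp: W_def restrict_moments_def weighted_smult)
    moreover have "nonneg (smult c p)" using that by (simp add: nonneg_def)
    ultimately have "density (\<sigma> p) (\<lambda>_. ennreal c) = \<sigma> (smult c p)"
      using unique has_moments_scale(1)[OF \<sigma>[OF that(1)] that(2)] by metis
    then show ?thesis
      using has_moments_scale(2)[OF \<sigma>[OF that(1)] that(2,3)] by (simp add: m_def)
  qed
  have nn: "nonneg ((p + 1)\<^sup>2)" "nonneg ((p - 1)\<^sup>2)" for p
    unfolding nonneg_def using nonneg_poly_one_plus_minus by auto
  have nn_add: "nonneg (p + q)" if "nonneg p" "nonneg q" for p q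
    using that by (simp add: nonneg_def add_nonneg_nonneg)
  have nn_smult: "nonneg (smult c p)" if "nonneg p" "0 \<le> c" for c p
    using that by (simp add: nonneg_def)
  \<comment> \<open>Polarisation, \<open>4 p = (p + 1)^2 - (p - 1)^2\<close>, extends
    \<open>m\<close> from nonnegative polynomials to a linear functional on all polynomials.\<close>
  define l where "l A p = (m ((p + 1)\<^sup>2) A - m ((p - 1)\<^sup>2) A) / 4" for A p
  have l_nonneg: "l A p = m p A" if "nonneg p" "A \<in> sets borel" for A p
  proof -
    have "(p + 1)\<^sup>2 = (p - 1)\<^sup>2 + smult 4 p"
      by (rule poly_ext) (simp add: power2_eq_square algebra_simps)
    then show ?thesis
      using that nn nn_smult by (simp add: l_def m_add m_scale)
  qed
  have l_add: "l A (p + q) = l A p + l A q" if "A \<in> sets borel" for A p q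
  proof -
    \<comment> \<open>Additivity of \<open>m\<close> is known for nonnegative weights only, so the
      identity is arranged without subtracting squares.\<close>
    have "(p + q + 1)\<^sup>2 + ((p - 1)\<^sup>2 + (q - 1)\<^sup>2) = (p + q - 1)\<^sup>2 + ((p + 1)\<^sup>2 + (q + 1)\<^sup>2)"
      by (simp add: power2_eq_square algebra_simps)
    then have "m ((p + q + 1)\<^sup>2 + ((p - 1)\<^sup>2 + (q - 1)\<^sup>2)) A = m ((p + q - 1)\<^sup>2 + ((p + 1)\<^sup>2 + (q + 1)\<^sup>2)) A"
      by (simp only:)
    then have "m ((p + q + 1)\<^sup>2) A + (m ((p - 1)\<^sup>2) A + m ((q - 1)\<^sup>2) A)
        = m ((p + q - 1)\<^sup>2) A + (m ((p + 1)\<^sup>2) A + m ((q + 1)\<^sup>2) A)"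
      by (simp only: m_add nn nn_add that)
    moreover have "a + (b + c) = d + (e + f) \<Longrightarrow> (a - d) / 4 = (e - b) / 4 + (f - c) / 4" for a b c d e f :: real
      by (simp add: field_simps)
    ultimately show ?thesis unfolding l_def by blast
  qed
  have l_scale: "l A (smult c p) = c * l A p" if A: "A \<in> sets borel" for A c p
  proof (cases "0 \<le> c")
    case True
    have aux: "a + c * b = d + c * e \<Longrightarrow> (a - d) / 4 = c * ((e - b) / 4)" for a b d e :: real
      by (simp add: field_simps)
    have "(smult c p + 1)\<^sup>2 + smult c ((p - 1)\<^sup>2) = (smult c p - 1)\<^sup>2 + smult c ((p + 1)\<^sup>2)"
      by (rule poly_ext) (simp add: power2_eq_square algebra_simps)
    then have "m ((smult c p + 1)\<^sup>2 + smult c ((p - 1)\<^sup>2)) A = m ((smult c p - 1)\<^sup>2 + smult c ((p + 1)\<^sup>2)) A"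
      by (simp only:)
    then have "m ((smult c p + 1)\<^sup>2) A + c * m ((p - 1)\<^sup>2) A = m ((smult c p - 1)\<^sup>2) A + c * m ((p + 1)\<^sup>2) A"
      by (simp only: m_add m_scale nn nn_smult True A)
    then show ?thesis unfolding l_def by (rule aux)
  next
    case False
    have aux: "a + - c * b = d + - c * e \<Longrightarrow> (a - d) / 4 = c * ((b - e) / 4)" for a b d e :: real
      by (simp add: field_simps)
    have "(smult c p + 1)\<^sup>2 + smult (- c) ((p + 1)\<^sup>2) = (smult c p - 1)\<^sup>2 + smult (- c) ((p - 1)\<^sup>2)"
      by (rule poly_ext) (simp add: power2_eq_square algebra_simps)
    then have "m ((smult c p + 1)\<^sup>2 + smult (- c) ((p + 1)\<^sup>2)) A = m ((smult c p - 1)\<^sup>2 + smult (- c) ((p - 1)\<^sup>2)) A"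
      by (simp only:)
    moreover have "0 \<le> - c" using False by simp
    ultimately have "m ((smult c p + 1)\<^sup>2) A + - c * m ((p + 1)\<^sup>2) A = m ((smult c p - 1)\<^sup>2) A + - c * m ((p - 1)\<^sup>2) A"
      by (simp only: m_add m_scale nn nn_smult A)
    then show ?thesis unfolding l_def by (rule aux)
  qed
  have l_sum: "l A (sum f S) = (\<Sum>x\<in>S. l A (f x))" if A: "A \<in> sets borel" for A S and f :: "nat \<Rightarrow> real poly"
  proof (induction S rule: infinite_finite_induct)
    case empty
    then show ?case using l_scale[OF A, of 0 0] by simp
  next
    case (infinite S)
    then show ?case using l_scale[OF A, of 0 0] by simp
  qed (simp add: l_add A)
  have l_pos: "0 \<le> poly_functional (\<lambda>n. l A (monom 1 n)) p" if A: "A \<in> sets borel" and "\<And>x. 0 \<le> poly p x" for A p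
  proof -
    have "l A p = l A (\<Sum>k\<le>degree p. smult (coeff p k) (monom 1 k))"
      by (simp add: smult_monom poly_as_sum_of_monoms)
    also have "\<dots> = poly_functional (\<lambda>n. l A (monom 1 n)) p"
      by (simp add: l_sum[OF A] l_scale[OF A] poly_functional_def)
    also have "l A p = m p A" using that by (intro l_nonneg) (auto simp: nonneg_def)
    finally show ?thesis unfolding m_def by (metis measure_nonneg)
  qed
  obtain F :: "nat \<Rightarrow> real \<Rightarrow> real" where F: "\<And>N. F N \<in> borel_measurable borel" "\<And>N. finite (range (F N))"
      "\<And>x. (\<lambda>N. F N x) \<longlonglongrightarrow> x" "\<And>N x. \<bar>F N x\<bar> \<le> 2 * \<bar>x\<bar>"
    using simple_rounding by blast
  note F(1)[measurable]
  define R :: "nat \<Rightarrow> real ^ 'n \<Rightarrow> real ^ 'n" where "R N x = (\<chi> j. if j \<in> I then F N (x $ j) else 0)" for N x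
  have finR: "finite (range (R N))" for N
    by (rule finite_subset[OF _ finite_vectors[of "insert 0 (range (F N))"]]) (auto simp: R_def F(2))
  define cell where "cell N a = {x. R N x = a}" for N a
  have cell [measurable]: "cell N a \<in> sets borel" for N a
  proof -
    have "cell N a = {x \<in> space borel. \<forall>j. (if j \<in> I then F N (x $ j) else 0) = a $ j}"
      by (auto simp: cell_def R_def vec_eq_iff)
    also have "\<dots> \<in> sets borel" by measurable
    finally show ?thesis .
  qed
  \<comment> \<open>The sums are integrals of the rounded monomial; the factor 2 in the rounding
    bound provides the integrable majorant.\<close>
  have cell_lim: "(\<lambda>N. \<Sum>a\<in>range (R N). monomial \<alpha> a * m p (cell N a)) \<longlonglongrightarrow> weighted \<phi> i p \<alpha>"
    if p: "nonneg p" and \<alpha>: "supported_on I \<alpha>" for p \<alpha>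
  proof -
    interpret finite_measure "\<sigma> p" by (rule has_moments_finite_measure[OF \<sigma>[OF p]])
    have [measurable_cong]: "sets (\<sigma> p) = sets borel" using \<sigma>[OF p] by (simp add: has_moments_def)
    have mono: "integrable (\<sigma> p) (monomial \<alpha>)" "(\<integral>x. monomial \<alpha> x \<partial>\<sigma> p) = weighted \<phi> i p \<alpha>"
      using \<sigma>[OF p] \<alpha> by (simp_all add: has_moments_def W_def restrict_moments_def)
    have simple: "monomial \<alpha> (R N x) = (\<Sum>a\<in>range (R N). monomial \<alpha> a * indicator (cell N a) x)" for N x
    proof -
      have "(\<Sum>a\<in>range (R N). monomial \<alpha> a * indicator (cell N a) x)
          = (\<Sum>a\<in>range (R N). if a = R N x then monomial \<alpha> (R N x) else 0)"
        by (intro sum.cong) (auto simp: cell_def)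
      then show ?thesis using finR by simp
    qed
    have "(\<lambda>N. \<integral>x. monomial \<alpha> (R N x) \<partial>\<sigma> p) \<longlonglongrightarrow> (\<integral>x. monomial \<alpha> x \<partial>\<sigma> p)"
    proof (rule integral_dominated_convergence[where w = "\<lambda>x. (\<Prod>j\<in>UNIV. 2 ^ (\<alpha> $ j)) * \<bar>monomial \<alpha> x\<bar>"])
      show "(\<lambda>x. monomial \<alpha> (R N x)) \<in> borel_measurable (\<sigma> p)" for N
        unfolding simple by measurable
      show "AE x in \<sigma> p. (\<lambda>N. monomial \<alpha> (R N x)) \<longlonglongrightarrow> monomial \<alpha> x"
      proof (rule AE_I2)
        fix x
        have "(\<lambda>N. R N x $ j ^ \<alpha> $ j) \<longlonglongrightarrow> x $ j ^ \<alpha> $ j" for j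
          using \<alpha> by (cases "j \<in> I") (auto simp: R_def supported_on_def intro!: tendsto_power F(3))
        then show "(\<lambda>N. monomial \<alpha> (R N x)) \<longlonglongrightarrow> monomial \<alpha> x"
          unfolding monomial_def by (intro tendsto_prod)
      qed
      show "AE x in \<sigma> p. norm (monomial \<alpha> (R N x)) \<le> (\<Prod>j\<in>UNIV. 2 ^ (\<alpha> $ j)) * \<bar>monomial \<alpha> x\<bar>" for N
      proof (rule AE_I2)
        fix x
        have "\<bar>R N x $ j\<bar> ^ \<alpha> $ j \<le> (2 * \<bar>x $ j\<bar>) ^ \<alpha> $ j" for j
          using F(4) by (intro power_mono) (auto simp: R_def)
        then have "(\<Prod>j\<in>UNIV. \<bar>R N x $ j\<bar> ^ \<alpha> $ j) \<le> (\<Prod>j\<in>UNIV. (2 * \<bar>x $ j\<bar>) ^ \<alpha> $ j)"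
          by (intro prod_mono) auto
        then show "norm (monomial \<alpha> (R N x)) \<le> (\<Prod>j\<in>UNIV. 2 ^ (\<alpha> $ j)) * \<bar>monomial \<alpha> x\<bar>"
          by (simp add: monomial_def abs_prod power_abs power_mult_distrib prod.distrib)
      qed
    qed (use mono in auto)
    moreover have "(\<integral>x. monomial \<alpha> (R N x) \<partial>\<sigma> p) = (\<Sum>a\<in>range (R N). monomial \<alpha> a * m p (cell N a))" for N
      unfolding simple by (subst Bochner_Integration.integral_sum) (auto simp: m_def emeasure_eq_measure)
    ultimately show ?thesis by (simp add: mono(2))
  qed
  have l_lim: "(\<lambda>N. \<Sum>a\<in>range (R N). monomial \<alpha> a * l (cell N a) (monom 1 n)) \<longlonglongrightarrow> \<phi> (\<alpha> + axis i n)"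
    if \<alpha>: "supported_on I \<alpha>" for n \<alpha>
  proof -
    define p :: "real poly" where "p = monom 1 n"
    have "(\<lambda>N. ((\<Sum>a\<in>range (R N). monomial \<alpha> a * m ((p + 1)\<^sup>2) (cell N a))
        - (\<Sum>a\<in>range (R N). monomial \<alpha> a * m ((p - 1)\<^sup>2) (cell N a))) / 4)
      \<longlonglongrightarrow> (weighted \<phi> i ((p + 1)\<^sup>2) \<alpha> - weighted \<phi> i ((p - 1)\<^sup>2) \<alpha>) / 4"
      by (intro tendsto_divide tendsto_diff cell_lim nn \<alpha> tendsto_const) auto
    moreover have "(p + 1)\<^sup>2 = (p - 1)\<^sup>2 + smult 4 p"
      by (rule poly_ext) (simp add: power2_eq_square algebra_simps)
    ultimately show ?thesis
      by (simp add: weighted_add weighted_smult p_def weighted_monom l_def sum_subtractf[symmetric]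
          sum_divide_distrib[symmetric] right_diff_distrib[symmetric])
  qed
  \<comment> \<open>\<open>K N\<close> bounds the sum over all cells of any monomial with exponents
    at most \<open>N\<close>. With tolerance \<open>1 / ((real N + 1) * K N)\<close> per cell the
    total error stays below \<open>1 / (real N + 1)\<close>.\<close>
  define K where "K N = 1 + (\<Sum>a\<in>range (R N). (\<Prod>j\<in>UNIV. (1 + \<bar>a $ j\<bar>) ^ N))" for N
  have K: "1 \<le> K N" for N unfolding K_def by (simp add: sum_nonneg prod_nonneg)
  have "\<exists>v. finite_moments v \<and> (\<forall>n\<le>N. \<bar>v n - l (cell N a) (monom 1 n)\<bar> \<le> 1 / ((real N + 1) * K N))" for N a
    using K[of N] by (intro truncated_hamburger l_pos cell) auto
  then obtain v where v: "\<And>N a. finite_moments (v N a)"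
      "\<And>N a n. n \<le> N \<Longrightarrow> \<bar>v N a n - l (cell N a) (monom 1 n)\<bar> \<le> 1 / ((real N + 1) * K N)"
    by metis
  define atomic where "atomic v k t c \<longleftrightarrow> (\<forall>j<k. 0 \<le> c j) \<and> v = (\<lambda>n. \<Sum>j<(k::nat). c j * t j ^ n)"
    for v :: "nat \<Rightarrow> real" and k t c
  have "\<forall>N a. \<exists>k t c. atomic (v N a) k t c"
    using v(1) unfolding finite_moments_def atomic_def by blast
  then obtain k t c where "\<And>N a. atomic (v N a) (k N a) (t N a) (c N a)"
    unfolding choice_iff by blast
  then have atoms: "j < k N a \<Longrightarrow> 0 \<le> c N a j" "v N a = (\<lambda>n. \<Sum>j<k N a. c N a j * t N a j ^ n)" for N a j
    unfolding atomic_def by blast+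
  define J where "J N = (SIGMA a:range (R N). {..<k N a})" for N
  \<comment> \<open>The atom sits at the representative of its cell in the coordinates
    \<open>I\<close> and at the one-dimensional node in coordinate \<open>i\<close>.\<close>
  define y where "y N = (\<lambda>(a :: real ^ 'n, j). \<chi> h. if h = i then t N a j else a $ h)" for N
  define d where "d N = (\<lambda>(a, j). c N a j)" for N
  show ?thesis
  proof (rule moments_limit)
    show "finite (J N)" for N unfolding J_def by (intro finite_SigmaI finR) auto
    show "0 \<le> d N j" if "j \<in> J N" for N j using that atoms(1) by (auto simp: J_def d_def)
    fix \<alpha> :: "nat ^ 'n"
    define n where "n = \<alpha> $ i"
    define \<beta> where "\<beta> = (\<chi> j. if j = i then 0 else \<alpha> $ j)"
    have \<alpha>: "\<alpha> = \<beta> + axis i n" by (simp add: vec_eq_iff \<beta>_def axis_def n_def)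
    have \<beta>cong: "monomial \<beta> (y N (a, j)) = monomial \<beta> a" for N a j
      by (rule supported_on_monomial_cong[of "UNIV - {i}"]) (auto simp: supported_on_def \<beta>_def y_def)
    have y: "monomial \<alpha> (y N (a, j)) = monomial \<beta> a * t N a j ^ n" for N a j
      unfolding \<alpha> monomial_add \<beta>cong by (simp add: y_def)
    have sum: "(\<Sum>j\<in>J N. d N j * monomial \<alpha> (y N j)) = (\<Sum>a\<in>range (R N). monomial \<beta> a * v N a n)" for N
    proof -
      have "(\<Sum>j\<in>J N. d N j * monomial \<alpha> (y N j)) = (\<Sum>a\<in>range (R N). \<Sum>j<k N a. d N (a, j) * monomial \<alpha> (y N (a, j)))"
        unfolding J_def by (subst sum.Sigma) (auto simp: finR)
      then show ?thesis by (simp add: y d_def atoms(2) sum_distrib_left mult_ac)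
    qed
    show "(\<lambda>N. \<Sum>j\<in>J N. d N j * monomial \<alpha> (y N j)) \<longlonglongrightarrow> restrict_moments (insert i I) \<phi> \<alpha>"
    proof (cases "supported_on I \<beta>")
      case False
      then have ns: "\<not> supported_on (insert i I) \<alpha>"
        by (auto simp: supported_on_def \<beta>_def split: if_splits)
      \<comment> \<open>All representatives vanish in this coordinate, so the approximating moment
        is 0, as is the target.\<close>
      obtain j where j: "j \<notin> I" "\<beta> $ j \<noteq> 0" using False by (auto simp: supported_on_def)
      have "monomial \<beta> a = 0" if "a \<in> range (R N)" for a N
        unfolding monomial_def using that j by (intro prod_zero bexI[of _ j]) (auto simp: R_def)
      then have "(\<Sum>a\<in>range (R N). monomial \<beta> a * v N a n) = 0" for N by (intro sum.neutral) auto
      then show ?thesis unfolding sum restrict_moments_def using ns by simp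
    next
      case True
      then have s: "supported_on (insert i I) \<alpha>"
        by (auto simp: supported_on_def \<beta>_def split: if_splits)
      have "(\<lambda>N. (\<Sum>a\<in>range (R N). monomial \<beta> a * v N a n)
          - (\<Sum>a\<in>range (R N). monomial \<beta> a * l (cell N a) (monom 1 n))) \<longlonglongrightarrow> 0"
      proof (rule Lim_null_comparison[where g = "\<lambda>N. 1 / (real N + 1)"])
        show "(\<lambda>N. 1 / (real N + 1)) \<longlonglongrightarrow> 0" by real_asymp
        show "\<forall>\<^sub>F N in sequentially. norm ((\<Sum>a\<in>range (R N). monomial \<beta> a * v N a n)
          - (\<Sum>a\<in>range (R N). monomial \<beta> a * l (cell N a) (monom 1 n))) \<le> 1 / (real N + 1)"
        proof (rule eventually_sequentiallyI[of "\<Sum>j\<in>UNIV. \<alpha> $ j"])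
          fix N assume N: "(\<Sum>j\<in>UNIV. \<alpha> $ j) \<le> N"
          have \<alpha>N: "\<alpha> $ j \<le> N" for j
            using member_le_sum[of j UNIV "\<lambda>j. \<alpha> $ j"] N by simp
          have \<beta>N: "\<bar>monomial \<beta> a\<bar> \<le> (\<Prod>j\<in>UNIV. (1 + \<bar>a $ j\<bar>) ^ N)" for a :: "real ^ 'n"
            unfolding monomial_def abs_prod power_abs
          proof (intro prod_mono conjI)
            fix j
            have "\<bar>a $ j\<bar> ^ \<beta> $ j \<le> (1 + \<bar>a $ j\<bar>) ^ \<beta> $ j" by (intro power_mono) auto
            also have "\<dots> \<le> (1 + \<bar>a $ j\<bar>) ^ N"
              using \<alpha>N[of j] by (intro power_increasing) (auto simp: \<beta>_def)
            finally show "\<bar>a $ j\<bar> ^ \<beta> $ j \<le> (1 + \<bar>a $ j\<bar>) ^ N" .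
          qed auto
          have "norm ((\<Sum>a\<in>range (R N). monomial \<beta> a * v N a n)
              - (\<Sum>a\<in>range (R N). monomial \<beta> a * l (cell N a) (monom 1 n)))
            = \<bar>\<Sum>a\<in>range (R N). monomial \<beta> a * (v N a n - l (cell N a) (monom 1 n))\<bar>"
            by (simp add: sum_subtractf right_diff_distrib)
          also have "\<dots> \<le> (\<Sum>a\<in>range (R N). (\<Prod>j\<in>UNIV. (1 + \<bar>a $ j\<bar>) ^ N) * (1 / ((real N + 1) * K N)))"
          proof (rule order.trans[OF sum_abs sum_mono])
            fix a
            show "\<bar>monomial \<beta> a * (v N a n - l (cell N a) (monom 1 n))\<bar>
                \<le> (\<Prod>j\<in>UNIV. (1 + \<bar>a $ j\<bar>) ^ N) * (1 / ((real N + 1) * K N))"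
              unfolding abs_mult using \<alpha>N[of i]
              by (intro mult_mono \<beta>N v) (auto simp: n_def intro!: prod_nonneg)
          qed
          also have "\<dots> = (K N - 1) / ((real N + 1) * K N)"
            by (simp add: K_def sum_divide_distrib)
          also have "\<dots> \<le> K N / ((real N + 1) * K N)"
            using K[of N] by (intro divide_right_mono) auto
          also have "\<dots> = 1 / (real N + 1)" using K[of N] by simp
          finally show "norm ((\<Sum>a\<in>range (R N). monomial \<beta> a * v N a n)
              - (\<Sum>a\<in>range (R N). monomial \<beta> a * l (cell N a) (monom 1 n))) \<le> 1 / (real N + 1)" .
        qed
      qed
      from tendsto_add[OF this l_lim[OF True, of n]] show ?thesis
        unfolding sum restrict_moments_def using s by (simp flip: \<alpha>)
    qed
  qed
qed

theorem nussbaum_existence: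
  fixes \<phi> :: "nat ^ 'n::finite \<Rightarrow> real"
  assumes "finite I" "psd \<phi>" "\<And>j. j \<in> I \<Longrightarrow> carleman_real (\<lambda>n. \<phi> (axis j n))"
  shows "\<exists>\<mu>. has_moments \<mu> (restrict_moments I \<phi>)"
  using assms
proof (induction I arbitrary: \<phi>)
  case empty
  \<comment> \<open>With no coordinate left, the measure is the mass \<open>\<phi> 0\<close> at the
    origin, obtained as a constant sequence in \<open>moments_limit\<close>.\<close>
  have \<phi>0: "0 \<le> \<phi> 0" using psd_axis_nonneg[OF empty.prems(1), of undefined 0] by (simp add: axis_zero)
  have mono: "monomial \<alpha> 0 = (if supported_on {} \<alpha> then 1 else 0)" for \<alpha> :: "nat ^ 'n"
    by (auto simp: monomial_def supported_on_def intro!: prod.neutral)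
  have "\<alpha> = 0" if "supported_on {} \<alpha>" for \<alpha> :: "nat ^ 'n"
    using that by (simp add: supported_on_def vec_eq_iff)
  then have *: "\<phi> 0 * monomial \<alpha> 0 = restrict_moments {} \<phi> \<alpha>" for \<alpha>
    by (auto simp: mono restrict_moments_def)
  show ?case
    by (rule moments_limit[where J = "\<lambda>_. {()}" and c = "\<lambda>_ _. \<phi> 0" and y = "\<lambda>_ _. 0"]) (simp_all add: \<phi>0 *)
next
  case (insert i I)
  show ?case
    by (rule existence_step[OF insert.prems(1) insert.hyps(2) _ insert.IH]) (use insert.prems(2) in auto)
qed

section \<open>From complex sequences to real functionals, and the final assembly\<close>

lemma positive_semidefinite_real:
  assumes "positive_semidefinite s"
  shows "Im (s \<gamma>) = 0"
proof -
  have form: "Im (\<Sum>\<alpha>\<in>A. \<Sum>\<beta>\<in>A. s (\<alpha> + \<beta>)) = 0" if "finite A" for A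
  proof -
    define \<xi> :: "'a \<Rightarrow> complex" where "\<xi> \<alpha> = (if \<alpha> \<in> A then 1 else 0)" for \<alpha>
    have A: "{\<alpha>. \<xi> \<alpha> \<noteq> 0} = A" by (auto simp: \<xi>_def)
    have fin: "finite {\<alpha>. \<xi> \<alpha> \<noteq> 0}" using that A by simp
    have "(\<Sum>\<alpha> | \<xi> \<alpha> \<noteq> 0. \<Sum>\<beta> | \<xi> \<beta> \<noteq> 0. s (\<alpha> + \<beta>) * \<xi> \<alpha> * cnj (\<xi> \<beta>)) \<in> \<real>\<^sub>\<ge>\<^sub>0"
      using assms fin unfolding positive_semidefinite_def by blast
    moreover have "(\<Sum>\<alpha> | \<xi> \<alpha> \<noteq> 0. \<Sum>\<beta> | \<xi> \<beta> \<noteq> 0. s (\<alpha> + \<beta>) * \<xi> \<alpha> * cnj (\<xi> \<beta>)) = (\<Sum>\<alpha>\<in>A. \<Sum>\<beta>\<in>A. s (\<alpha> + \<beta>))"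
      unfolding A by (intro sum.cong) (auto simp: \<xi>_def)
    ultimately show ?thesis by (auto simp: complex_nonneg_Reals_iff)
  qed
  show ?thesis
  proof (cases "\<gamma> = 0")
    case True
    then show ?thesis using form[of "{0}"] by simp
  next
    case False
    \<comment> \<open>The third sum is
      \<open>s 0 + 2 * s \<gamma> + s (\<gamma> + \<gamma>)\<close>; its outer terms are real by the
      first two.\<close>
    then show ?thesis using form[of "{0}"] form[of "{\<gamma>}"] form[of "{0, \<gamma>}"] by simp
  qed
qed

lemma positive_semidefinite_imp_psd:
  fixes s :: "'a::comm_monoid_add \<Rightarrow> complex"
  assumes "positive_semidefinite s"
  shows "psd (\<lambda>\<alpha>. Re (s \<alpha>))"
  unfolding psd_def
proof
  fix f :: "'a \<Rightarrow>\<^sub>0 real"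
  define \<xi> where "\<xi> \<alpha> = complex_of_real (Poly_Mapping.lookup f \<alpha>)" for \<alpha>
  have keys: "{\<alpha>. \<xi> \<alpha> \<noteq> 0} = Poly_Mapping.keys f" by (auto simp: \<xi>_def in_keys_iff)
  have fin: "finite {\<alpha>. \<xi> \<alpha> \<noteq> 0}" unfolding keys by simp
  have "(\<Sum>\<alpha> | \<xi> \<alpha> \<noteq> 0. \<Sum>\<beta> | \<xi> \<beta> \<noteq> 0. s (\<alpha> + \<beta>) * \<xi> \<alpha> * cnj (\<xi> \<beta>)) \<in> \<real>\<^sub>\<ge>\<^sub>0"
    using assms fin unfolding positive_semidefinite_def by blast
  then have "0 \<le> Re (\<Sum>\<alpha> | \<xi> \<alpha> \<noteq> 0. \<Sum>\<beta> | \<xi> \<beta> \<noteq> 0. s (\<alpha> + \<beta>) * \<xi> \<alpha> * cnj (\<xi> \<beta>))"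
    by (simp add: complex_nonneg_Reals_iff)
  also have "\<dots> = linear_functional (\<lambda>\<alpha>. Re (s \<alpha>)) (f * f)"
    unfolding keys linear_functional_mult by (simp add: \<xi>_def mult_ac)
  finally show "0 \<le> linear_functional (\<lambda>\<alpha>. Re (s \<alpha>)) (f * f)" .
qed

lemma carleman_imp_carleman_real:
  assumes "carleman s" and real: "\<And>n. Im (s n) = 0"
  shows "carleman_real (\<lambda>n. Re (s n))"
proof (rule ccontr)
  assume "\<not> carleman_real (\<lambda>n. Re (s n))"
  then have nz: "Re (s (2 * Suc n)) \<noteq> 0"
    and sum: "summable (\<lambda>n. Re (s (2 * Suc n)) powr (- 1 / real (2 * Suc n)))" for n
    unfolding carleman_real_def by blast+
  have "s (2 * Suc n) \<noteq> 0" for n using nz[of n] by (metis zero_complex.sel(1))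
  then have "suminf (\<lambda>n. ennreal (Re (s (2 * Suc n)) powr (- 1 / real (2 * Suc n)))) = \<infinity>"
    using assms(1) unfolding carleman_def by (simp only: if_False)
  moreover have "suminf (\<lambda>n. ennreal (Re (s (2 * Suc n)) powr (- 1 / real (2 * Suc n)))) < \<infinity>"
    using sum by (subst suminf_ennreal2) (auto simp del: mult_Suc_right)
  ultimately show False by simp
qed

theorem theorem25:
  fixes s :: "nat ^ 'n::{finite,linorder} \<Rightarrow> complex"
  assumes "positive_semidefinite s"
    and "\<And>i. i < Max UNIV \<Longrightarrow> carleman (marginal s i)"
  shows "moment_sequence s \<and> (carleman (marginal s (Max UNIV)) \<longrightarrow> determinate s)"
proof -
  define \<phi> where "\<phi> \<alpha> = Re (s \<alpha>)" for \<alpha>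
  define i where "i = Max (UNIV :: 'n set)"
  have s: "s \<alpha> = complex_of_real (\<phi> \<alpha>)" for \<alpha>
    using positive_semidefinite_real[OF assms(1)] by (simp add: \<phi>_def complex_eq_iff)
  have psd: "psd \<phi>"
    unfolding \<phi>_def[abs_def] by (rule positive_semidefinite_imp_psd[OF assms(1)])
  have carl: "carleman_real (\<lambda>n. \<phi> (axis j n))" if "carleman (marginal s j)" for j
    using carleman_imp_carleman_real[OF that] by (simp add: marginal_def s)
  have less: "j < Max UNIV" if "j \<noteq> i" for j
    using that Max_ge[of UNIV j] by (auto simp: i_def less_le)
  \<comment> \<open>The last coordinate is added by one further step, which asks no growth of it;
    all other coordinates satisfy Carleman and are covered by
    \<open>nussbaum_existence\<close>.\<close>
  have "\<exists>\<mu>. has_moments \<mu> (restrict_moments (insert i (UNIV - {i})) \<phi>)"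
    using psd by (rule existence_step) (auto intro!: carl assms(2) less nussbaum_existence)
  moreover have "restrict_moments (insert i (UNIV - {i})) \<phi> = \<phi>"
    by (auto simp: restrict_moments_def supported_on_def)
  ultimately obtain \<mu> where \<mu>: "has_moments \<mu> \<phi>" by auto
  have iff: "has_moments \<nu> \<phi> \<longleftrightarrow> \<nu> \<in> finite_moment_measures \<and> represents \<nu> s" for \<nu>
    by (auto simp: has_moments_def finite_moment_measures_def represents_def s)
  have "moment_sequence s"
    unfolding moment_sequence_def using \<mu> iff by blast
  moreover have "determinate s" if "carleman (marginal s (Max UNIV))"
  proof -
    have "carleman_real (\<lambda>n. \<phi> (axis j n))" for j
      using that less assms(2) by (cases "j = i") (auto simp: i_def intro!: carl)
    then show ?thesis
      unfolding determinate_def iff[symmetric] using \<mu> has_moments_unique by blast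
  qed
  ultimately show ?thesis by blast
qed

end
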